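(* There exist absolute constants $C_1,C_2>0$ and, for all $c_0,c_1>0$, a constant $C_0'>0$ depending only on $c_0,c_1$, such that the following holds. Let $d,m$ be positive integers with $d\ge(\log 6)^2m$, and let $0<h\le\sqrt m$. Let $a\in\mathbb{R}^d$ with $\|a\|_{l_1^d}=1$ and let $g\colon[-1,1]\to\mathbb{R}$ be a differentiable function such that $|g(t_1)-g(t_2)|\le c_0|t_1-t_2|$ and $|g'(t_1)-g'(t_2)|\le c_1|t_1-t_2|$ for all $t_1,t_2\in[-1,1]$, and $g'(0)>0$. Let $f\colon[-1,1]^d\to\mathbb{R}$, $f(x)=g(\langle a,x\rangle)$. Let $\Phi\in\mathbb{R}^{m\times d}$ be a normalized Bernoulli matrix with rows $\varphi_1,\dots,\varphi_m$, and put $$\tilde b_j:=\frac{f(h\varphi_j)-f(0)}{h}\quad(j=1,\dots,m),$$ let $\tilde a\in\mathbb{R}^d$ be a solution of $$\min_{w\in\mathbb{R}^d}\|w\|_{l_1^d}\quad\text{subject to}\quad\Phi w=\tilde b,$$ and put $$\hat a:=\frac{\tilde a}{\|\tilde a\|_{l_1^d}},\qquad \hat g(t):=f\big(t\cdot\mathrm{sign}(\hat a)\big),\qquad\hat f(x):=\hat g(\langle\hat a,x\rangle).$$ Then for every positive integer $s$ with $2s\le (C_2m)/\log(d/m)$ and $g'(0)(1-\sigma_s(a)_1)-c_1h>0$, with probability at least $1-e^{-\sqrt{md}}-e^{-C_1m}$ (over the draw of $\Phi$) the minimization problem is feasible and, provided $\tilde a\ne0$ (so that $\hat a$ is defined),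 $$\|f-\hat f\|_\infty\le 2c_0\|\hat a-a\|_{l_1^d}\le 2c_0\cdot C_0'\cdot\frac{g'(0)\,\sigma_s(a)_1+h}{g'(0)(1-\sigma_s(a)_1)-c_1h}.$$
   Context: A normalized Bernoulli matrix $\Phi\in\mathbb{R}^{m\times d}$ is a random matrix whose entries are independent and equal to $+1/\sqrt m$ or $-1/\sqrt m$ with probability $1/2$ each. $\|x\|_{l_1^d}=\sum_{i=1}^d|x_i|$. The best $s$-term approximation error of $x\in\mathbb{R}^d$ is $\sigma_s(x)_1=\min\{\|x-z\|_{l_1^d}: z\in\mathbb{R}^d\text{ has at most }s\text{ nonzero entries}\}$. The sign of a vector is taken entrywise: $\mathrm{sign}(x)=(\mathrm{sign}(x_i))_i$, with $\mathrm{sign}(0)=0$. $\|f-\hat f\|_\infty=\sup_{x\in[-1,1]^d}|f(x)-\hat f(x)|$. $\log$ is the natural logarithm. *)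

theory Defs
  imports "HOL-Probability.Probability" "Jordan_Normal_Form.Matrix"
begin

no_notation inner (infix \<open>\<bullet>\<close> 70)
no_notation vec_nth (infixl \<open>$\<close> 90)

definition l1_norm :: "real vec \<Rightarrow> real" where
  "l1_norm x = (\<Sum>i<dim_vec x. \<bar>x $ i\<bar>)"

definition sparse :: "nat \<Rightarrow> real vec \<Rightarrow> bool" where
  "sparse s z \<longleftrightarrow> card {i. i < dim_vec z \<and> z $ i \<noteq> 0} \<le> s"

(* The infimum is attained: the minimum is taken over finitely many coordinate subspaces. *)
definition best_approx_error :: "nat \<Rightarrow> real vec \<Rightarrow> real" where
  "best_approx_error s x = (INF z \<in> {z \<in> carrier_vec (dim_vec x). sparse s z}. l1_norm (x - z))"

definition unit_cube :: "nat \<Rightarrow> real vec set" where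
  "unit_cube d = {x \<in> carrier_vec d. \<forall>i<d. \<bar>x $ i\<bar> \<le> 1}"

definition sup_norm_cube :: "nat \<Rightarrow> (real vec \<Rightarrow> real) \<Rightarrow> real" where
  "sup_norm_cube d u = (SUP x \<in> unit_cube d. \<bar>u x\<bar>)"

(* The law of a normalized m x d Bernoulli matrix.  The value 0 is only the default that
   Pi_pmf assigns outside the index set; it is discarded when passing to the matrix. *)
definition bernoulli_matrix :: "nat \<Rightarrow> nat \<Rightarrow> real mat pmf" where
  "bernoulli_matrix m d =
     map_pmf (Matrix.mat m d)
       (Pi_pmf ({..<m} \<times> {..<d}) 0 (\<lambda>_. pmf_of_set {1 / sqrt (real m), - 1 / sqrt (real m)}))"

(* For l1_norm a <= 1 the values on the unit cube depend on g only through its values on [-1,1]. *)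
definition ridge :: "(real \<Rightarrow> real) \<Rightarrow> real vec \<Rightarrow> real vec \<Rightarrow> real" where
  "ridge g a x = g (a \<bullet> x)"

definition measurements :: "(real vec \<Rightarrow> real) \<Rightarrow> real \<Rightarrow> real mat \<Rightarrow> real vec" where
  "measurements f h \<Phi> =
     Matrix.vec (dim_row \<Phi>) (\<lambda>j. (f (h \<cdot>\<^sub>v Matrix.row \<Phi> j) - f (0\<^sub>v (dim_col \<Phi>))) / h)"

definition feasible :: "real mat \<Rightarrow> real vec \<Rightarrow> real vec \<Rightarrow> bool" where
  "feasible \<Phi> b w \<longleftrightarrow> w \<in> carrier_vec (dim_col \<Phi>) \<and> \<Phi> *\<^sub>v w = b"

definition l1_solution :: "real mat \<Rightarrow> real vec \<Rightarrow> real vec \<Rightarrow> bool" where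
  "l1_solution \<Phi> b w \<longleftrightarrow> is_arg_min l1_norm (feasible \<Phi> b) w"

definition l1_normalize :: "real vec \<Rightarrow> real vec" where
  "l1_normalize w = (1 / l1_norm w) \<cdot>\<^sub>v w"

definition sign_vec :: "real vec \<Rightarrow> real vec" where
  "sign_vec x = Matrix.map_vec sgn x"

(* The approximation fhat, with the reconstructed profile ghat t = f (t * sign ahat) inlined. *)
definition reconstruction :: "(real vec \<Rightarrow> real) \<Rightarrow> real vec \<Rightarrow> real vec \<Rightarrow> real" where
  "reconstruction f ahat = ridge (\<lambda>t. f (t \<cdot>\<^sub>v sign_vec ahat)) ahat"

end

theory Submission
  imports Defs "Jordan_Normal_Form.Determinant"
begin

text \<open>
  Write \<open>\<Phi> = A / sqrt m\<close> with a sign matrix \<open>A\<close>.  The measurements are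
  \<open>b = g'(0) \<Phi> a + e\<close>, and the bound on the increments of \<open>g'\<close> makes every entry of the
  error \<open>e\<close> at most \<open>c1 h / m\<close>, because \<open>\<bar>\<langle>a, \<phi>\<^sub>j\<rangle>\<bar> \<le> 1 / sqrt m\<close>
  (\<open>linearization_error\<close>).  Two properties of \<open>A\<close> then suffice.

  \<^item> \<open>transpose_bounded_below\<close>: \<open>\<parallel>A\<^sup>T v\<parallel>\<^sub>2 \<ge> mesh sqrt d \<parallel>v\<parallel>\<^sub>2\<close> for all \<open>v\<close>.  Then \<open>A A\<^sup>T\<close> is
    invertible, so the minimum norm solution \<open>u\<close> of \<open>\<Phi> u = e\<close> exists, and
    \<open>\<parallel>u\<parallel>\<^sub>1 \<le> sqrt d \<parallel>u\<parallel>\<^sub>2 \<le> c1 h / mesh\<close>.  This gives feasibility, and it lets the noise be moved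
    into the signal: \<open>b = \<Phi> (g'(0) a + u)\<close> holds exactly.  It is a form of the \<open>l\<^sub>1\<close>-quotient property of
    \<open>\<Phi>\<close> in which \<open>e\<close> is measured in the Euclidean norm.

  \<^item> \<open>kernel_spread\<close>: a vector with small ratio \<open>\<parallel>z\<parallel>\<^sub>1 / \<parallel>z\<parallel>\<^sub>2\<close> is not in the
    kernel of \<open>A\<close>.  Hence kernel vectors carry at most a quarter of their \<open>l\<^sub>1\<close>-norm on any \<open>s\<close>
    coordinates, which is the null space property: an \<open>l\<^sub>1\<close>-minimizer differs from \<open>g'(0) a + u\<close> by at most
    four times the \<open>l\<^sub>1\<close>-mass of that vector outside \<open>s\<close> coordinates.

  The rest is deterministic: normalizing costs a factor 2, and the bound on the profile
  is \<open>sup_norm_reconstruction_le\<close>.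

  Both properties are lower bounds for \<open>\<parallel>A z\<parallel>\<^sub>2\<close> (or \<open>\<parallel>A\<^sup>T z\<parallel>\<^sub>2\<close>) that hold simultaneously for all
  \<open>z\<close> in a class, and both are proved by one method.  A vector \<open>z\<close> is rounded at random,
  without bias and coordinate by coordinate, to a lattice \<open>\<delta> \<int>\<^sup>n\<close>.  Because the entries of \<open>A\<close> have
  absolute value 1, the mean of \<open>\<parallel>A (z - z')\<parallel>\<^sub>2\<^sup>2\<close> is controlled for every single \<open>A\<close>, so some
  rounding \<open>z'\<close> is good for that \<open>A\<close> (\<open>exists_lattice_rounding\<close>); no bound on the
  operator norm is needed.  It remains to count lattice points of bounded \<open>l\<^sub>1\<close>-norm
  (\<open>card_int_ball_le\<close>) and to bound the failure probability for one lattice point.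

  \<^item> If \<open>\<parallel>z\<parallel>\<^sub>1\<close> is small compared with \<open>\<parallel>z\<parallel>\<^sub>2\<close> there are few lattice points, and a failure
    probability \<open>exp(-n/24)\<close>, obtained from fourth moments, is enough.  This handles
    \<open>kernel_spread\<close> and the compressible vectors in \<open>transpose_bounded_below\<close>.

  \<^item> The remaining vectors \<open>v\<close> of \<open>\<real>\<^sup>m\<close> are spread out.  There are about \<open>(C/\<delta>)\<^sup>m\<close> lattice points,
    but a random sign sum with spread weights lies in an interval of length \<open>\<delta>\<close> with
    probability at most \<open>C \<delta>\<close>.  All \<open>d\<close> columns are independent and \<open>d \<ge> (ln 6)\<^sup>2 m \<ge> 3 m\<close>, so
    \<open>(C \<delta>)\<^sup>d (C/\<delta>)\<^sup>m\<close> is at most \<open>exp(-m)\<close> for a small constant \<open>\<delta>\<close>.  The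
    small ball bound comes from writing \<open>exp(-x\<^sup>2/2)\<close> as the mean of \<open>cos(G x)\<close> over a standard normal \<open>G\<close>.

  Since \<open>2 \<le> 2 s \<le> C2 m / ln(d/m) \<le> C2 m\<close>, a small constant \<open>C2\<close> forces \<open>m\<close> to be as large
  as the estimates require.
\<close>

section \<open>Averages over sign patterns\<close>

text \<open>The law of the entries is uniform on this finite set, so that probabilities and
  expectations become finite sums and no integrability conditions arise.  The value 0 outside
  \<open>T\<close> is the default of \<open>Pi_pmf\<close>.\<close>

definition signs :: "'t set \<Rightarrow> ('t \<Rightarrow> real) set" where
  "signs T = PiE_dflt T 0 (\<lambda>_. {1, -1})"

definition sign_mean :: "'t set \<Rightarrow> (('t \<Rightarrow> real) \<Rightarrow> real) \<Rightarrow> real" where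
  "sign_mean T f = (\<Sum>\<epsilon>\<in>signs T. f \<epsilon>) / 2 ^ card T"

definition sign_prob :: "'t set \<Rightarrow> (('t \<Rightarrow> real) \<Rightarrow> bool) \<Rightarrow> real" where
  "sign_prob T P = sign_mean T (\<lambda>\<epsilon>. of_bool (P \<epsilon>))"

lemma finite_signs: "finite T \<Longrightarrow> finite (signs T)"
  unfolding signs_def by (rule finite_PiE_dflt) auto

lemma card_signs: "finite T \<Longrightarrow> card (signs T) = 2 ^ card T"
  unfolding signs_def by (subst card_PiE_dflt) (auto simp: numeral_2_eq_2)

lemma sign_mean_mono:
  assumes "\<And>\<epsilon>. \<epsilon> \<in> signs T \<Longrightarrow> f \<epsilon> \<le> g \<epsilon>"
  shows "sign_mean T f \<le> sign_mean T g"
  unfolding sign_mean_def by (intro divide_right_mono sum_mono assms) auto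

lemma sign_mean_add: "sign_mean T (\<lambda>\<epsilon>. f \<epsilon> + g \<epsilon>) = sign_mean T f + sign_mean T g"
  by (simp add: sign_mean_def sum.distrib add_divide_distrib)

lemma sign_mean_cmult: "sign_mean T (\<lambda>\<epsilon>. c * f \<epsilon>) = c * sign_mean T f"
  by (simp add: sign_mean_def sum_distrib_left)

lemma sign_mean_half_add:
  "sign_mean T (\<lambda>\<epsilon>. (f \<epsilon> + g \<epsilon>) / 2) = (sign_mean T f + sign_mean T g) / 2"
  by (simp add: sign_mean_def sum.distrib add_divide_distrib sum_divide_distrib mult.commute)

lemma sign_mean_const: "finite T \<Longrightarrow> sign_mean T (\<lambda>_. c) = c"
  by (simp add: sign_mean_def card_signs)

lemma sign_mean_sum:
  "sign_mean T (\<lambda>\<epsilon>. \<Sum>k\<in>K. f k \<epsilon>) = (\<Sum>k\<in>K. sign_mean T (f k))"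
  unfolding sign_mean_def
  by (subst sum.swap) (simp add: sum_divide_distrib)

lemma sign_mean_empty: "sign_mean ({} :: 't set) f = f (\<lambda>_. 0)"
  proof -
  have "signs {} = {\<lambda>_::'t. 0::real}" by (auto simp: signs_def PiE_dflt_def)
  then show ?thesis by (simp add: sign_mean_def)
qed

lemma sign_mean_insert:
  assumes "finite T" "t \<notin> T"
  shows "sign_mean (insert t T) f =
    (sign_mean T (\<lambda>\<epsilon>. f (\<epsilon>(t := 1))) + sign_mean T (\<lambda>\<epsilon>. f (\<epsilon>(t := -1)))) / 2"
proof -
  have img: "signs (insert t T) = (\<lambda>(y, \<epsilon>). \<epsilon>(t := y)) ` ({1, -1} \<times> signs T)"
  proof (intro equalityI subsetI)
    fix \<epsilon> assume "\<epsilon> \<in> signs (insert t T)"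
    then have "(\<epsilon> t, \<epsilon>(t := 0)) \<in> {1, -1} \<times> signs T"
      using assms(2) by (auto simp: signs_def PiE_dflt_def)
    moreover have "\<epsilon> = (\<lambda>(y, \<epsilon>). \<epsilon>(t := y)) (\<epsilon> t, \<epsilon>(t := 0))" by auto
    ultimately show "\<epsilon> \<in> (\<lambda>(y, \<epsilon>). \<epsilon>(t := y)) ` ({1, -1} \<times> signs T)" by (rule rev_image_eqI)
  next
    fix \<epsilon> assume "\<epsilon> \<in> (\<lambda>(y, \<epsilon>). \<epsilon>(t := y)) ` ({1, -1} \<times> signs T)"
    then obtain y \<epsilon>' where "y \<in> {1, -1}" "\<epsilon>' \<in> signs T" "\<epsilon> = \<epsilon>'(t := y)" by auto
    then show "\<epsilon> \<in> signs (insert t T)" by (simp add: signs_def PiE_dflt_def)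
  qed
  have off: "\<epsilon> t = 0" if "\<epsilon> \<in> signs T" for \<epsilon>
    using that assms(2) by (auto simp: signs_def PiE_dflt_def)
  have inj: "inj_on (\<lambda>(y, \<epsilon>). \<epsilon>(t := y)) ({1, -1} \<times> signs T)"
  proof (rule inj_onI, clarsimp simp del: One_nat_def)
    fix y \<epsilon> y' \<epsilon>'
    assume e: "\<epsilon> \<in> signs T" "\<epsilon>' \<in> signs T" and eq: "\<epsilon>(t := y) = \<epsilon>'(t := (y'::real))"
    have "y = y'" using fun_cong[OF eq, of t] by simp
    moreover have "\<epsilon> x = \<epsilon>' x" for x
      using fun_cong[OF eq, of x] off[OF e(1)] off[OF e(2)] by (cases "x = t") auto
    ultimately show "y = y' \<and> \<epsilon> = \<epsilon>'" by auto
  qed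
  have "(\<Sum>\<epsilon>\<in>signs (insert t T). f \<epsilon>) = (\<Sum>(y,\<epsilon>)\<in>{1,-1} \<times> signs T. f (\<epsilon>(t := y)))"
    unfolding img by (subst sum.reindex[OF inj]) (auto simp: case_prod_unfold)
  also have "\<dots> = (\<Sum>y\<in>{1,-1}. \<Sum>\<epsilon>\<in>signs T. f (\<epsilon>(t := y)))"
    by (subst sum.cartesian_product) auto
  finally show ?thesis
    using assms by (simp add: sign_mean_def field_simps)
qed

text \<open>Independence of disjoint blocks of entries.\<close>

lemma sign_mean_mult_disjoint:
  assumes "finite S" "finite T" "S \<inter> T = {}"
    and "\<And>\<epsilon> \<epsilon>'. (\<forall>t\<in>S. \<epsilon> t = \<epsilon>' t) \<Longrightarrow> F \<epsilon> = F \<epsilon>'"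
    and "\<And>\<epsilon> \<epsilon>'. (\<forall>t\<in>T. \<epsilon> t = \<epsilon>' t) \<Longrightarrow> G \<epsilon> = G \<epsilon>'"
  shows "sign_mean (S \<union> T) (\<lambda>\<epsilon>. F \<epsilon> * G \<epsilon>) = sign_mean S F * sign_mean T G"
  using assms(1,3,4)
proof (induction S arbitrary: F)
  case empty
  have "F \<epsilon> = F (\<lambda>_. 0)" for \<epsilon> by (rule empty.prems(2)) auto
  then have "(\<lambda>\<epsilon>. F \<epsilon> * G \<epsilon>) = (\<lambda>\<epsilon>. F (\<lambda>_. 0) * G \<epsilon>)" by metis
  then show ?case by (simp add: sign_mean_empty sign_mean_cmult)
next
  case (insert s S)
  have G: "G (\<epsilon>(s := y)) = G \<epsilon>" for \<epsilon> y
    by (rule assms(5)) (use insert.prems in auto)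
  have IH: "sign_mean (S \<union> T) (\<lambda>\<epsilon>. F (\<epsilon>(s := y)) * G \<epsilon>) = sign_mean S (\<lambda>\<epsilon>. F (\<epsilon>(s := y))) * sign_mean T G" for y
  proof (rule insert.IH)
    show "S \<inter> T = {}" using insert.prems by auto
    show "F (\<epsilon>(s := y)) = F (\<epsilon>'(s := y))" if "\<forall>t\<in>S. \<epsilon> t = \<epsilon>' t" for \<epsilon> \<epsilon>'
      by (rule insert.prems(2)) (use that in simp)
  qed
  have "sign_mean (insert s (S \<union> T)) (\<lambda>\<epsilon>. F \<epsilon> * G \<epsilon>) = sign_mean (insert s S) F * sign_mean T G"
    using insert.hyps insert.prems(1) assms(2)
    by (simp add: sign_mean_insert G IH, simp add: algebra_simps add_divide_distrib)
  then show ?case by simp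
qed

lemma sign_mean_prod_blocks:
  assumes "finite I" "\<And>i. i \<in> I \<Longrightarrow> finite (B i)" "disjoint_family_on B I"
    and "\<And>i \<epsilon> \<epsilon>'. i \<in> I \<Longrightarrow> (\<forall>t\<in>B i. \<epsilon> t = \<epsilon>' t) \<Longrightarrow> F i \<epsilon> = F i \<epsilon>'"
  shows "sign_mean (\<Union>i\<in>I. B i) (\<lambda>\<epsilon>. \<Prod>i\<in>I. F i \<epsilon>) = (\<Prod>i\<in>I. sign_mean (B i) (F i))"
  using assms
proof (induction I)
  case empty
  then show ?case by (simp add: sign_mean_empty)
next
  case (insert i I)
  have "sign_mean (B i \<union> (\<Union>i\<in>I. B i)) (\<lambda>\<epsilon>. F i \<epsilon> * (\<Prod>i\<in>I. F i \<epsilon>))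
      = sign_mean (B i) (F i) * sign_mean (\<Union>i\<in>I. B i) (\<lambda>\<epsilon>. \<Prod>i\<in>I. F i \<epsilon>)"
  proof (rule sign_mean_mult_disjoint)
    show "B i \<inter> (\<Union>i\<in>I. B i) = {}"
      using insert.prems(2) insert.hyps by (auto simp: disjoint_family_on_def)
    show "(\<Prod>i\<in>I. F i \<epsilon>) = (\<Prod>i\<in>I. F i \<epsilon>')" if "\<forall>t\<in>\<Union>i\<in>I. B i. \<epsilon> t = \<epsilon>' t" for \<epsilon> \<epsilon>'
      by (rule prod.cong[OF refl], rule insert.prems(3)) (use that in auto)
    show "F i \<epsilon> = F i \<epsilon>'" if "\<forall>t\<in>B i. \<epsilon> t = \<epsilon>' t" for \<epsilon> \<epsilon>'
      by (rule insert.prems(3)) (use that in auto)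
  qed (use insert.hyps insert.prems(1) in auto)
  also have "sign_mean (\<Union>i\<in>I. B i) (\<lambda>\<epsilon>. \<Prod>i\<in>I. F i \<epsilon>) = (\<Prod>i\<in>I. sign_mean (B i) (F i))"
  proof (rule insert.IH)
    show "disjoint_family_on B I"
      using insert.prems(2) by (auto simp: disjoint_family_on_def)
    show "F j \<epsilon> = F j \<epsilon>'" if "j \<in> I" "\<forall>t\<in>B j. \<epsilon> t = \<epsilon>' t" for j \<epsilon> \<epsilon>'
      by (rule insert.prems(3)) (use that in auto)
  qed (use insert.prems(1) in auto)
  finally show ?case using insert.hyps by simp
qed

lemma sign_prob_mono:
  "(\<And>\<epsilon>. \<epsilon> \<in> signs T \<Longrightarrow> P \<epsilon> \<Longrightarrow> Q \<epsilon>) \<Longrightarrow> sign_prob T P \<le> sign_prob T Q"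
  unfolding sign_prob_def by (rule sign_mean_mono) auto

lemma sign_prob_disj: "sign_prob T (\<lambda>\<epsilon>. P \<epsilon> \<or> Q \<epsilon>) \<le> sign_prob T P + sign_prob T Q"
  unfolding sign_prob_def sign_mean_add[symmetric] by (rule sign_mean_mono) auto

lemma sign_prob_union_bound:
  assumes "finite K" and "\<And>k. k \<in> K \<Longrightarrow> sign_prob T (P k) \<le> q"
  shows "sign_prob T (\<lambda>\<epsilon>. \<exists>k\<in>K. P k \<epsilon>) \<le> real (card K) * q"
proof -
  have "sign_prob T (\<lambda>\<epsilon>. \<exists>k\<in>K. P k \<epsilon>) \<le> sign_mean T (\<lambda>\<epsilon>. \<Sum>k\<in>K. of_bool (P k \<epsilon>))"
    unfolding sign_prob_def
  proof (rule sign_mean_mono)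
    fix \<epsilon>
    show "of_bool (\<exists>k\<in>K. P k \<epsilon>) \<le> (\<Sum>k\<in>K. of_bool (P k \<epsilon>) :: real)"
    proof (cases "\<exists>k\<in>K. P k \<epsilon>")
      case True
      then obtain k where "k \<in> K" "P k \<epsilon>" by auto
      then have "of_bool (P k \<epsilon>) \<le> (\<Sum>k\<in>K. of_bool (P k \<epsilon>) :: real)"
        by (intro member_le_sum) (use assms in auto)
      with True \<open>P k \<epsilon>\<close> show ?thesis by simp
    qed (auto intro: sum_nonneg)
  qed
  also have "\<dots> = (\<Sum>k\<in>K. sign_prob T (P k))"
    by (simp add: sign_mean_sum sign_prob_def)
  also have "\<dots> \<le> (\<Sum>k\<in>K. q::real)" by (intro sum_mono assms)
  finally show ?thesis by simp
qed

text \<open>The bridge from the product measure to counting.\<close>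

lemma prob_signs_compl:
  assumes "finite T"
  shows "measure_pmf.prob (Pi_pmf T 0 (\<lambda>_. pmf_of_set {1, -1::real})) {\<epsilon>. P \<epsilon>}
    = 1 - sign_prob T (\<lambda>\<epsilon>. \<not> P \<epsilon>)"
proof -
  have "Pi_pmf T 0 (\<lambda>_. pmf_of_set {1, -1::real}) = pmf_of_set (signs T)"
    unfolding signs_def using assms by (intro Pi_pmf_of_set) auto
  moreover have ne: "signs T \<noteq> {}"
    unfolding signs_def by auto
  ultimately have "measure_pmf.prob (Pi_pmf T 0 (\<lambda>_. pmf_of_set {1, -1::real})) {\<epsilon>. P \<epsilon>}
      = card (signs T \<inter> {\<epsilon>. P \<epsilon>}) / card (signs T)"
    using assms by (simp add: measure_pmf_of_set finite_signs)
  also have "\<dots> = 1 - card (signs T \<inter> {\<epsilon>. \<not> P \<epsilon>}) / card (signs T)"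
  proof -
    have "card (signs T) = card (signs T \<inter> {\<epsilon>. P \<epsilon>}) + card (signs T \<inter> {\<epsilon>. \<not> P \<epsilon>})"
      by (subst card_Un_disjoint[symmetric]) (use finite_signs[OF assms(1)] in \<open>auto intro!: arg_cong[where f = card]\<close>)
    moreover have "card (signs T) > 0" using ne finite_signs[OF assms(1)] by (simp add: card_gt_0_iff)
    ultimately show ?thesis by (auto simp: field_simps simp flip: of_nat_add)
  qed
  also have "card (signs T \<inter> {\<epsilon>. \<not> P \<epsilon>}) / card (signs T) = sign_prob T (\<lambda>\<epsilon>. \<not> P \<epsilon>)"
    using assms finite_signs[OF assms(1)]
    by (simp add: sign_prob_def sign_mean_def card_signs of_bool_def sum.If_cases Collect_neg_eq)
  finally show ?thesis .
qed

section \<open>Lower tails of sums of squares\<close>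

text \<open>The exponential Markov inequality for the lower tail of a sum of independent
  squares.  The indexing map \<open>e\<close> serves to treat the rows and the columns of one matrix
  alike: \<open>e i j\<close> is the entry used by the \<open>i\<close>-th sum at its \<open>j\<close>-th coordinate, and injectivity makes
  the sums independent.\<close>

lemma sign_prob_sum_squares_le:
  fixes e :: "'i \<Rightarrow> 'j \<Rightarrow> 't" and w :: "'j \<Rightarrow> real"
  assumes fin: "finite I" "finite J" and inj: "inj_on (case_prod e) (I \<times> J)"
    and lam: "\<theta> \<ge> 0"
    and q: "\<And>i. i \<in> I \<Longrightarrow> sign_mean (e i ` J) (\<lambda>\<epsilon>. exp (- \<theta> * (\<Sum>j\<in>J. \<epsilon> (e i j) * w j)\<^sup>2)) \<le> q"
  shows "sign_prob (\<Union>i\<in>I. e i ` J) (\<lambda>\<epsilon>. (\<Sum>i\<in>I. (\<Sum>j\<in>J. \<epsilon> (e i j) * w j)\<^sup>2) \<le> r)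
    \<le> exp (\<theta> * r) * q ^ card I"
proof -
  let ?X = "\<lambda>i \<epsilon>. (\<Sum>j\<in>J. \<epsilon> (e i j) * w j)\<^sup>2"
  let ?T = "\<Union>i\<in>I. e i ` J"
  have "sign_prob ?T (\<lambda>\<epsilon>. (\<Sum>i\<in>I. ?X i \<epsilon>) \<le> r)
      \<le> sign_mean ?T (\<lambda>\<epsilon>. exp (\<theta> * r) * (\<Prod>i\<in>I. exp (- \<theta> * ?X i \<epsilon>)))"
    unfolding sign_prob_def
  proof (rule sign_mean_mono)
    fix \<epsilon>
    have *: "exp (\<theta> * r) * (\<Prod>i\<in>I. exp (- \<theta> * ?X i \<epsilon>)) = exp (\<theta> * (r - (\<Sum>i\<in>I. ?X i \<epsilon>)))"
    proof -
      have "(\<Prod>i\<in>I. exp (- \<theta> * ?X i \<epsilon>)) = exp (- \<theta> * (\<Sum>i\<in>I. ?X i \<epsilon>))"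
        using fin(1) by (simp only: exp_sum sum_distrib_left)
      then show ?thesis by (simp only: exp_add[symmetric]) (simp add: right_diff_distrib)
    qed
    show "of_bool ((\<Sum>i\<in>I. ?X i \<epsilon>) \<le> r) \<le> exp (\<theta> * r) * (\<Prod>i\<in>I. exp (- \<theta> * ?X i \<epsilon>))"
    proof (cases "(\<Sum>i\<in>I. ?X i \<epsilon>) \<le> r")
      case True
      then have "0 \<le> \<theta> * (r - (\<Sum>i\<in>I. ?X i \<epsilon>))" using lam by simp
      with True show ?thesis unfolding * by simp
    qed (simp add: prod_nonneg)
  qed
  also have "\<dots> = exp (\<theta> * r) * (\<Prod>i\<in>I. sign_mean (e i ` J) (\<lambda>\<epsilon>. exp (- \<theta> * ?X i \<epsilon>)))"
    unfolding sign_mean_cmult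
  proof (subst sign_mean_prod_blocks)
    show "disjoint_family_on (\<lambda>i. e i ` J) I"
      unfolding disjoint_family_on_def
    proof (intro ballI impI equals0I)
      fix i i' t assume *: "i \<in> I" "i' \<in> I" "i \<noteq> i'" "t \<in> e i ` J \<inter> e i' ` J"
      then obtain j j' where "j \<in> J" "j' \<in> J" "e i j = e i' j'" by auto
      with * inj_onD[OF inj, of "(i, j)" "(i', j')"] show False by auto
    qed
    show "exp (- \<theta> * ?X i \<epsilon>) = exp (- \<theta> * ?X i \<epsilon>')" if "\<forall>t\<in>e i ` J. \<epsilon> t = \<epsilon>' t" for i \<epsilon> \<epsilon>'
    proof -
      have "(\<Sum>j\<in>J. \<epsilon> (e i j) * w j) = (\<Sum>j\<in>J. \<epsilon>' (e i j) * w j)"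
        using that by (intro sum.cong) auto
      then show ?thesis by simp
    qed
  qed (use fin in auto)
  also have "\<dots> \<le> exp (\<theta> * r) * (\<Prod>i\<in>I. q)"
  proof (intro mult_left_mono prod_mono conjI q)
    fix i assume "i \<in> I"
    show "0 \<le> sign_mean (e i ` J) (\<lambda>\<epsilon>. exp (- \<theta> * ?X i \<epsilon>))"
      unfolding sign_mean_def by (intro divide_nonneg_nonneg sum_nonneg) auto
  qed auto
  finally show ?thesis by simp
qed

lemma sign_mean_square:
  assumes "finite T"
  shows "sign_mean T (\<lambda>\<epsilon>. (\<Sum>t\<in>T. \<epsilon> t * w t)\<^sup>2) = (\<Sum>t\<in>T. (w t)\<^sup>2)"
  using assms
proof induction
  case empty
  then show ?case by (simp add: sign_mean_empty)
next
  case (insert t T)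
  let ?X = "\<lambda>\<epsilon>. \<Sum>t\<in>T. \<epsilon> t * w t"
  have X: "?X (\<epsilon>(t := y)) = ?X \<epsilon>" for \<epsilon> y
    by (rule sum.cong) (use insert.hyps in auto)
  have "sign_mean (insert t T) (\<lambda>\<epsilon>. (\<Sum>t\<in>insert t T. \<epsilon> t * w t)\<^sup>2)
     = (sign_mean T (\<lambda>\<epsilon>. (w t + ?X \<epsilon>)\<^sup>2) + sign_mean T (\<lambda>\<epsilon>. (- w t + ?X \<epsilon>)\<^sup>2)) / 2"
    by (simp only: sign_mean_insert[OF insert.hyps] sum.insert[OF insert.hyps] X) simp
  also have "\<dots> = sign_mean T (\<lambda>\<epsilon>. (w t)\<^sup>2 + (?X \<epsilon>)\<^sup>2)"
  proof -
    have "((w t + x)\<^sup>2 + (- w t + x)\<^sup>2) / 2 = (w t)\<^sup>2 + x\<^sup>2" for x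
      by (simp add: power2_eq_square algebra_simps)
    from this[of "?X _", symmetric] show ?thesis
      by (simp only: sign_mean_half_add)
  qed
  finally show ?case using insert by (simp add: sign_mean_add sign_mean_const)
qed

lemma sign_mean_fourth_power:
  assumes "finite T"
  shows "sign_mean T (\<lambda>\<epsilon>. (\<Sum>t\<in>T. \<epsilon> t * w t)^4) \<le> 3 * (\<Sum>t\<in>T. (w t)\<^sup>2)\<^sup>2"
  using assms
proof induction
  case empty
  then show ?case by (simp add: sign_mean_empty)
next
  case (insert t T)
  let ?X = "\<lambda>\<epsilon>. \<Sum>t\<in>T. \<epsilon> t * w t"
  let ?s = "\<Sum>t\<in>T. (w t)\<^sup>2"
  have X: "?X (\<epsilon>(t := y)) = ?X \<epsilon>" for \<epsilon> y
    by (rule sum.cong) (use insert.hyps in auto)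
  have "sign_mean (insert t T) (\<lambda>\<epsilon>. (\<Sum>t\<in>insert t T. \<epsilon> t * w t)^4)
     = (sign_mean T (\<lambda>\<epsilon>. (w t + ?X \<epsilon>)^4) + sign_mean T (\<lambda>\<epsilon>. (- w t + ?X \<epsilon>)^4)) / 2"
    by (simp only: sign_mean_insert[OF insert.hyps] sum.insert[OF insert.hyps] X) simp
  also have "\<dots> = sign_mean T (\<lambda>\<epsilon>. (w t)^4 + (6 * (w t)\<^sup>2) * (?X \<epsilon>)\<^sup>2 + (?X \<epsilon>)^4)"
  proof -
    have "((w t + x)^4 + (- w t + x)^4) / 2 = (w t)^4 + (6 * (w t)\<^sup>2) * x\<^sup>2 + x^4" for x
      by (simp add: power4_eq_xxxx power2_eq_square algebra_simps)
    from this[of "?X _", symmetric] show ?thesis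
      by (simp only: sign_mean_half_add)
  qed
  also have "\<dots> = (w t)^4 + 6 * (w t)\<^sup>2 * ?s + sign_mean T (\<lambda>\<epsilon>. (?X \<epsilon>)^4)"
    using insert.hyps by (simp add: sign_mean_add sign_mean_const sign_mean_cmult sign_mean_square)
  also have "\<dots> \<le> (w t)^4 + 6 * (w t)\<^sup>2 * ?s + 3 * ?s\<^sup>2"
    using insert.IH by simp
  also have "\<dots> \<le> 3 * ((w t)\<^sup>2 + ?s)\<^sup>2"
  proof -
    have "3 * ((w t)\<^sup>2 + ?s)\<^sup>2 = 3 * (w t)^4 + 6 * (w t)\<^sup>2 * ?s + 3 * ?s\<^sup>2"
      by (simp add: power2_sum algebra_simps)
    moreover have "0 \<le> (w t)^4" by simp
    ultimately show ?thesis by linarith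
  qed
  finally show ?case using insert.hyps by simp
qed

lemma exp_minus_le_quadratic:
  fixes x :: real assumes "x \<ge> 0"
  shows "exp (- x) \<le> 1 - x + x\<^sup>2 / 2"
proof -
  obtain t where t: "exp (- x) = (\<Sum>m<3. (- x) ^ m / fact m) + exp t / fact 3 * (- x) ^ 3"
    using Maclaurin_exp_le[of "- x" 3] by blast
  have "exp t / fact 3 * (- x) ^ 3 \<le> 0"
    using assms by (simp add: mult_nonneg_nonpos power3_eq_cube)
  then show ?thesis
    unfolding t by (simp add: numeral_3_eq_3 lessThan_Suc power2_eq_square)
qed

text \<open>The second order expansion of the exponential function reduces the claim to the
  second and the fourth moment.\<close>

lemma sign_mean_exp_minus_square:
  assumes T: "finite T" "(\<Sum>t\<in>T. (w t)\<^sup>2) = 1" and lam: "\<theta> \<ge> 0"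
  shows "sign_mean T (\<lambda>\<epsilon>. exp (- \<theta> * (\<Sum>t\<in>T. \<epsilon> t * w t)\<^sup>2)) \<le> exp (- \<theta> + 3 / 2 * \<theta>\<^sup>2)"
proof -
  let ?X = "\<lambda>\<epsilon>. \<Sum>t\<in>T. \<epsilon> t * w t"
  have "sign_mean T (\<lambda>\<epsilon>. exp (- \<theta> * (?X \<epsilon>)\<^sup>2))
    \<le> sign_mean T (\<lambda>\<epsilon>. 1 + (- \<theta>) * (?X \<epsilon>)\<^sup>2 + (\<theta>\<^sup>2 / 2) * (?X \<epsilon>)^4)"
  proof (rule sign_mean_mono)
    fix \<epsilon>
    have "exp (- (\<theta> * (?X \<epsilon>)\<^sup>2)) \<le> 1 - \<theta> * (?X \<epsilon>)\<^sup>2 + (\<theta> * (?X \<epsilon>)\<^sup>2)\<^sup>2 / 2"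
      by (rule exp_minus_le_quadratic) (use lam in simp)
    then show "exp (- \<theta> * (?X \<epsilon>)\<^sup>2) \<le> 1 + (- \<theta>) * (?X \<epsilon>)\<^sup>2 + (\<theta>\<^sup>2 / 2) * (?X \<epsilon>)^4"
      by (simp add: power_mult_distrib)
  qed
  also have "\<dots> = 1 - \<theta> + \<theta>\<^sup>2 / 2 * sign_mean T (\<lambda>\<epsilon>. (?X \<epsilon>)^4)"
    unfolding sign_mean_add sign_mean_cmult using T by (simp add: sign_mean_const sign_mean_square)
  also have "\<dots> \<le> 1 - \<theta> + \<theta>\<^sup>2 / 2 * 3"
    using sign_mean_fourth_power[OF T(1), of w] T(2) by (intro add_left_mono mult_left_mono) auto
  also have "\<dots> \<le> exp (- \<theta> + 3 / 2 * \<theta>\<^sup>2)"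
    using exp_ge_add_one_self[of "- \<theta> + 3 / 2 * \<theta>\<^sup>2"] by (simp add: algebra_simps)
  finally show ?thesis .
qed

lemma sum_image_inj:
  assumes "inj_on e J"
  shows "(\<Sum>j\<in>J. F (e j) (w j)) = (\<Sum>t\<in>e ` J. F t (w (inv_into J e t)))"
  by (subst sum.reindex[OF assms]) (use assms in simp)

text \<open>Choose \<open>\<theta> = 1/6\<close> in the exponential Markov inequality: the exponent per sum is
  \<open>1/12 - 1/6 + 1/24 = - 1/24\<close>.\<close>

lemma sign_prob_small_energy:
  fixes e :: "'i \<Rightarrow> 'j \<Rightarrow> 't" and w :: "'j \<Rightarrow> real"
  assumes fin: "finite I" "finite J" and inj: "inj_on (case_prod e) (I \<times> J)"
    and w: "(\<Sum>j\<in>J. (w j)\<^sup>2) > 0"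
  shows "sign_prob (\<Union>i\<in>I. e i ` J)
     (\<lambda>\<epsilon>. (\<Sum>i\<in>I. (\<Sum>j\<in>J. \<epsilon> (e i j) * w j)\<^sup>2) \<le> card I * (\<Sum>j\<in>J. (w j)\<^sup>2) / 2)
    \<le> exp (- real (card I) / 24)"
proof -
  define N where "N = (\<Sum>j\<in>J. (w j)\<^sup>2)"
  have N: "N > 0" using w by (simp add: N_def)
  define u where "u j = w j / sqrt N" for j
  have u: "(\<Sum>j\<in>J. (u j)\<^sup>2) = 1"
    using N by (simp add: u_def power_divide N_def[symmetric] sum_divide_distrib[symmetric])
  have eq: "(\<Sum>i\<in>I. (\<Sum>j\<in>J. \<epsilon> (e i j) * u j)\<^sup>2) = (\<Sum>i\<in>I. (\<Sum>j\<in>J. \<epsilon> (e i j) * w j)\<^sup>2) / N" for \<epsilon> :: "'t \<Rightarrow> real"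
    using N by (simp add: u_def power_divide sum_divide_distrib[symmetric])
  have iff: "(\<lambda>\<epsilon>. (\<Sum>i\<in>I. (\<Sum>j\<in>J. \<epsilon> (e i j) * w j)\<^sup>2) \<le> card I * (\<Sum>j\<in>J. (w j)\<^sup>2) / 2)
    = (\<lambda>\<epsilon>. (\<Sum>i\<in>I. (\<Sum>j\<in>J. \<epsilon> (e i j) * u j)\<^sup>2) \<le> card I / 2)"
    unfolding eq N_def[symmetric] using N by (simp add: field_simps)
  have "sign_prob (\<Union>i\<in>I. e i ` J) (\<lambda>\<epsilon>. (\<Sum>i\<in>I. (\<Sum>j\<in>J. \<epsilon> (e i j) * u j)\<^sup>2) \<le> card I / 2)
    \<le> exp (1/6 * (card I / 2)) * exp (- (1/6) + 3/2 * (1/6)\<^sup>2) ^ card I"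
  proof (rule sign_prob_sum_squares_le[OF fin inj])
    fix i assume i: "i \<in> I"
    have ij: "inj_on (e i) J" using inj i by (auto simp: inj_on_def)
    show "sign_mean (e i ` J) (\<lambda>\<epsilon>. exp (- (1/6) * (\<Sum>j\<in>J. \<epsilon> (e i j) * u j)\<^sup>2)) \<le> exp (- (1/6) + 3/2 * (1/6)\<^sup>2)"
      unfolding sum_image_inj[OF ij, of "\<lambda>t y. _ t * y" u]
      by (rule sign_mean_exp_minus_square)
         (use fin u sum_image_inj[OF ij, of "\<lambda>t y. y\<^sup>2" u] in auto)
  qed auto
  also have "\<dots> = exp (- real (card I) / 24)"
    by (simp add: exp_of_nat_mult[symmetric] exp_add[symmetric] power2_eq_square field_simps)
  finally show ?thesis unfolding iff .
qed

section \<open>Anti-concentration of sign sums\<close>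

lemma sign_mean_cos_shift:
  assumes "finite T"
  shows "sign_mean T (\<lambda>\<epsilon>. cos (a + (\<Sum>t\<in>T. \<epsilon> t * w t))) = cos a * (\<Prod>t\<in>T. cos (w t))"
  using assms
proof (induction arbitrary: a)
  case empty
  then show ?case by (simp add: sign_mean_empty)
next
  case (insert t T)
  let ?X = "\<lambda>\<epsilon>. \<Sum>t\<in>T. \<epsilon> t * w t"
  have X: "?X (\<epsilon>(t := y)) = ?X \<epsilon>" for \<epsilon> y
    by (rule sum.cong) (use insert.hyps in auto)
  have "sign_mean (insert t T) (\<lambda>\<epsilon>. cos (a + (\<Sum>t\<in>insert t T. \<epsilon> t * w t)))
     = (sign_mean T (\<lambda>\<epsilon>. cos ((a + w t) + ?X \<epsilon>)) + sign_mean T (\<lambda>\<epsilon>. cos ((a - w t) + ?X \<epsilon>))) / 2"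
    by (simp only: sign_mean_insert[OF insert.hyps] sum.insert[OF insert.hyps] X) (simp add: algebra_simps)
  also have "\<dots> = (cos (a + w t) + cos (a - w t)) / 2 * (\<Prod>t\<in>T. cos (w t))"
    by (simp only: insert.IH) (simp add: algebra_simps add_divide_distrib)
  finally show ?case using insert.hyps by (simp add: cos_add cos_diff)
qed

text \<open>The characteristic function of a sign sum, in real form.\<close>

lemma sign_mean_cos:
  assumes "finite T"
  shows "sign_mean T (\<lambda>\<epsilon>. cos (\<Sum>t\<in>T. \<epsilon> t * w t)) = (\<Prod>t\<in>T. cos (w t))"
  using sign_mean_cos_shift[OF assms, of 0 w] by simp

lemma integrable_std_normal_bounded:
  assumes "f \<in> borel_measurable borel" "\<And>x. \<bar>f x\<bar> \<le> (B :: real)"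
  shows "integrable std_normal_distribution f"
proof -
  interpret real_distribution std_normal_distribution
    by (rule real_dist_normal_dist)
  show ?thesis
    by (rule integrable_const_bound[where B = B]) (use assms in auto)
qed

lemma std_normal_cos:
  "(LINT x|std_normal_distribution. cos (x * t)) = exp (- t\<^sup>2 / 2)"
proof -
  interpret real_distribution std_normal_distribution
    by (rule real_dist_normal_dist)
  have "complex_integrable std_normal_distribution (\<lambda>x. iexp (t * x))"
    by (rule integrable_iexp) auto
  then have "(LINT x|std_normal_distribution. Re (iexp (t * x))) = Re (char std_normal_distribution t)"
    unfolding char_def by (rule integral_Re)
  then show ?thesis
    by (simp add: char_std_normal_distribution Re_exp mult.commute)
qed

text \<open>The function \<open>exp(-x\<^sup>2/2)\<close> is its own Fourier transform up to scaling, that is, the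
  mean of \<open>cos(G x)\<close> over a standard normal \<open>G\<close>.  Exchanging the two means turns the
  average over signs into a product of cosines.\<close>

lemma sign_mean_exp_minus_square_eq_std_normal:
  assumes "finite T"
  shows "sign_mean T (\<lambda>\<epsilon>. exp (- (\<Sum>t\<in>T. \<epsilon> t * w t)\<^sup>2 / 2))
    = (LINT x|std_normal_distribution. (\<Prod>t\<in>T. cos (x * w t)))"
proof -
  have "sign_mean T (\<lambda>\<epsilon>. exp (- (\<Sum>t\<in>T. \<epsilon> t * w t)\<^sup>2 / 2))
    = sign_mean T (\<lambda>\<epsilon>. LINT x|std_normal_distribution. cos (x * (\<Sum>t\<in>T. \<epsilon> t * w t)))"
    by (simp only: std_normal_cos)
  also have "\<dots> = (LINT x|std_normal_distribution. sign_mean T (\<lambda>\<epsilon>. cos (x * (\<Sum>t\<in>T. \<epsilon> t * w t))))"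
    unfolding sign_mean_def
    by (subst integral_divide_zero, subst Bochner_Integration.integral_sum)
       (auto intro!: integrable_std_normal_bounded[where B = 1])
  also have "\<dots> = (LINT x|std_normal_distribution. (\<Prod>t\<in>T. cos (x * w t)))"
  proof (rule Bochner_Integration.integral_cong[OF refl])
    fix x :: real
    have "sign_mean T (\<lambda>\<epsilon>. cos (x * (\<Sum>t\<in>T. \<epsilon> t * w t))) = sign_mean T (\<lambda>\<epsilon>. cos (\<Sum>t\<in>T. \<epsilon> t * (x * w t)))"
      by (simp add: sum_distrib_left mult.left_commute)
    then show "sign_mean T (\<lambda>\<epsilon>. cos (x * (\<Sum>t\<in>T. \<epsilon> t * w t))) = (\<Prod>t\<in>T. cos (x * w t))"
      by (simp add: sign_mean_cos[OF assms])
  qed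
  finally show ?thesis .
qed

lemma abs_cos_le_exp:
  fixes y :: real assumes "\<bar>y\<bar> \<le> 1"
  shows "\<bar>cos y\<bar> \<le> exp (- y\<^sup>2 / 3)"
proof -
  obtain t where t: "cos y = (\<Sum>m<4. cos_coeff m * y ^ m) + cos (t + 1/2 * real 4 * pi) / fact 4 * y ^ 4"
    using Maclaurin_cos_expansion[of y 4] by blast
  have y2: "y\<^sup>2 \<le> 1" using assms by (simp add: abs_square_le_1)
  have "(\<Sum>m<4. cos_coeff m * y ^ m) = 1 - y\<^sup>2 / 2"
  proof -
    have "{..<4} = {0, 1, 2, 3::nat}" by auto
    moreover have "cos_coeff 0 = 1" "cos_coeff 1 = 0" "cos_coeff 2 = - 1 / 2" "cos_coeff 3 = 0"
      by (simp_all add: cos_coeff_def)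
    ultimately show ?thesis by simp
  qed
  moreover have "cos (t + 1/2 * real 4 * pi) / fact 4 * y ^ 4 \<le> 1 / 24 * y\<^sup>2"
  proof -
    have "cos (t + 1/2 * real 4 * pi) / fact 4 * y ^ 4 \<le> 1 / 24 * y^4"
      by (intro mult_right_mono) (auto simp: fact_numeral)
    also have "y ^ 4 = y\<^sup>2 * y\<^sup>2" by (simp add: power4_eq_xxxx power2_eq_square)
    also have "1 / 24 * (y\<^sup>2 * y\<^sup>2) \<le> 1 / 24 * y\<^sup>2" using mult_left_le[OF y2, of "y\<^sup>2"] by simp
    finally show ?thesis by (simp add: power4_eq_xxxx power2_eq_square mult.assoc)
  qed
  ultimately have "cos y \<le> 1 - y\<^sup>2 / 2 + 1 / 24 * y\<^sup>2" unfolding t by linarith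
  also have "\<dots> \<le> 1 + (- y\<^sup>2 / 3)" by simp
  also have "\<dots> \<le> exp (- y\<^sup>2 / 3)" by (rule exp_ge_add_one_self)
  finally have "cos y \<le> exp (- y\<^sup>2 / 3)" .
  moreover have "cos y \<ge> 0"
    using assms pi_gt3 by (intro cos_ge_zero) auto
  ultimately show ?thesis by simp
qed

text \<open>Up to the factor \<open>s\<close>, the integrand is the normal density with standard deviation \<open>s\<close>.\<close>

lemma std_normal_exp_minus_square:
  assumes "a \<ge> 0"
  shows "(LINT x|std_normal_distribution. exp (- a * x\<^sup>2 / 2)) = 1 / sqrt (1 + a)"
proof -
  define s where "s = 1 / sqrt (1 + a)"
  have s: "s > 0" "s\<^sup>2 = 1 / (1 + a)" using assms by (auto simp: s_def power_divide)
  have "(LINT x|std_normal_distribution. exp (- a * x\<^sup>2 / 2))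
      = (\<integral>x. std_normal_density x * exp (- a * x\<^sup>2 / 2) \<partial>lborel)"
    by (subst integral_density) (auto simp: normal_density_nonneg)
  also have "\<dots> = (\<integral>x. s * normal_density 0 s x \<partial>lborel)"
  proof (rule Bochner_Integration.integral_cong[OF refl])
    fix x :: real
    have "exp (- x\<^sup>2 / 2) * exp (- a * x\<^sup>2 / 2) = exp (- x\<^sup>2 / (2 * s\<^sup>2))"
      unfolding s(2) exp_add[symmetric] using assms by (simp add: field_simps)
    moreover have "s * (1 / sqrt (2 * pi * s\<^sup>2)) = 1 / sqrt (2 * pi)"
      using s(1) by (simp add: real_sqrt_mult)
    moreover have "std_normal_density x * exp (- a * x\<^sup>2 / 2)
        = 1 / sqrt (2 * pi) * (exp (- x\<^sup>2 / 2) * exp (- a * x\<^sup>2 / 2))"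
      by (simp add: std_normal_density_def)
    moreover have "s * normal_density 0 s x = s * (1 / sqrt (2 * pi * s\<^sup>2)) * exp (- x\<^sup>2 / (2 * s\<^sup>2))"
      by (simp add: normal_density_def)
    ultimately show "std_normal_density x * exp (- a * x\<^sup>2 / 2) = s * normal_density 0 s x"
      by simp
  qed
  also have "\<dots> = s" using s by simp
  finally show ?thesis by (simp add: s_def)
qed

text \<open>The small ball estimate.  As long as \<open>\<bar>G\<bar> \<beta> \<le> 1\<close>, all the cosines with index in \<open>S\<close> are
  bounded by Gaussians, and their product has mean at most \<open>1 / sqrt (1 + 2/3 \<Sum> w\<^sup>2)\<close>.  The event
  \<open>\<bar>G\<bar> \<beta> > 1\<close> has probability at most \<open>\<beta>\<^sup>2\<close> by Chebyshev's inequality, which enters here through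
  the pointwise bound \<open>1 \<le> \<beta>\<^sup>2 x\<^sup>2\<close>.\<close>

lemma sign_mean_exp_minus_square_spread:
  assumes T: "finite T" "S \<subseteq> T" and b: "\<beta> \<ge> 0" "\<And>t. t \<in> S \<Longrightarrow> \<bar>w t\<bar> \<le> \<beta>"
  shows "sign_mean T (\<lambda>\<epsilon>. exp (- (\<Sum>t\<in>T. \<epsilon> t * w t)\<^sup>2 / 2))
    \<le> 1 / sqrt (1 + 2 / 3 * (\<Sum>t\<in>S. (w t)\<^sup>2)) + \<beta>\<^sup>2"
proof -
  define a where "a = 2 / 3 * (\<Sum>t\<in>S. (w t)\<^sup>2)"
  have a: "a \<ge> 0" by (simp add: a_def sum_nonneg)
  have cos_prod: "\<bar>\<Prod>t\<in>U. cos (x * w t)\<bar> \<le> 1" for U x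
    unfolding abs_prod by (rule prod_le_1) auto
  have pt: "(\<Prod>t\<in>T. cos (x * w t)) \<le> exp (- a * x\<^sup>2 / 2) + \<beta>\<^sup>2 * x\<^sup>2" for x
  proof (cases "\<beta> * \<bar>x\<bar> \<le> 1")
    case True
    have "(\<Prod>t\<in>T. cos (x * w t)) \<le> \<bar>\<Prod>t\<in>T - S. cos (x * w t)\<bar> * \<bar>\<Prod>t\<in>S. cos (x * w t)\<bar>"
      by (subst prod.subset_diff[OF T(2,1)]) (simp flip: abs_mult)
    also have "\<dots> \<le> 1 * (\<Prod>t\<in>S. \<bar>cos (x * w t)\<bar>)"
      by (intro mult_mono cos_prod) (auto simp: abs_prod prod_nonneg)
    also have "\<dots> \<le> 1 * (\<Prod>t\<in>S. exp (- (x * w t)\<^sup>2 / 3))"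
    proof (intro mult_left_mono prod_mono conjI abs_cos_le_exp)
      fix t assume "t \<in> S"
      then have "\<bar>x * w t\<bar> \<le> \<bar>x\<bar> * \<beta>" using b by (auto simp: abs_mult intro!: mult_left_mono)
      then show "\<bar>x * w t\<bar> \<le> 1" using True by (simp add: mult.commute)
    qed auto
    also have "\<dots> = exp (- a * x\<^sup>2 / 2)"
      using finite_subset[OF T(2,1)]
      by (simp add: a_def exp_sum[symmetric] power_mult_distrib sum_negf sum_divide_distrib sum_distrib_left sum_distrib_right mult_ac)
    finally show ?thesis by (simp add: add_increasing2)
  next
    case False
    then have "1 \<le> (\<beta> * \<bar>x\<bar>)\<^sup>2" by (simp add: one_le_power)
    then have "1 \<le> \<beta>\<^sup>2 * x\<^sup>2" by (simp add: power_mult_distrib)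
    moreover have "(\<Prod>t\<in>T. cos (x * w t)) \<le> 1" using cos_prod[of x T] by linarith
    moreover have "0 \<le> exp (- a * x\<^sup>2 / 2)" by simp
    ultimately show ?thesis by linarith
  qed
  have i2: "integrable std_normal_distribution (\<lambda>x. x\<^sup>2)"
    using std_normal_distribution_even_moments(2)[of 1] by simp
  have i1: "integrable std_normal_distribution (\<lambda>x. exp (- a * x\<^sup>2 / 2))"
    by (rule integrable_std_normal_bounded[where B = 1]) (use a in auto)
  have "(LINT x|std_normal_distribution. (\<Prod>t\<in>T. cos (x * w t)))
    \<le> (LINT x|std_normal_distribution. exp (- a * x\<^sup>2 / 2) + \<beta>\<^sup>2 * x\<^sup>2)"
  proof (rule integral_mono)
    show "integrable std_normal_distribution (\<lambda>x. (\<Prod>t\<in>T. cos (x * w t)))"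
      by (rule integrable_std_normal_bounded[where B = 1]) (use cos_prod in auto)
  qed (use i1 i2 pt in auto)
  also have "\<dots> = 1 / sqrt (1 + a) + \<beta>\<^sup>2"
  proof -
    have "(LINT x|std_normal_distribution. x\<^sup>2) = 1"
      using std_normal_distribution_even_moments(1)[of 1] by simp
    then show ?thesis using i1 i2 std_normal_exp_minus_square[OF a] by simp
  qed
  finally show ?thesis
    unfolding sign_mean_exp_minus_square_eq_std_normal[OF T(1)] a_def .
qed

section \<open>Lattice points and rounding\<close>

definition int_ball :: "'j set \<Rightarrow> real \<Rightarrow> ('j \<Rightarrow> int) set" where
  "int_ball J K = {k \<in> J \<rightarrow>\<^sub>E UNIV. (\<Sum>j\<in>J. \<bar>real_of_int (k j)\<bar>) \<le> K}"

lemma sum_power_abs_symmetric_interval: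
  fixes x :: real assumes "x \<noteq> 1"
  shows "(\<Sum>y\<in>{- int n..int n}. x ^ nat \<bar>y\<bar>) = (1 + x - 2 * x ^ Suc n) / (1 - x)"
proof (induction n)
  case 0
  then show ?case using assms by (simp add: field_simps)
next
  case (Suc n)
  have "{- int (Suc n)..int (Suc n)} = insert (- int (Suc n)) (insert (int (Suc n)) {- int n..int n})"
    by auto
  then have "(\<Sum>y\<in>{- int (Suc n)..int (Suc n)}. x ^ nat \<bar>y\<bar>)
      = 2 * x ^ Suc n + (\<Sum>y\<in>{- int n..int n}. x ^ nat \<bar>y\<bar>)"
    by (simp add: nat_add_distrib)
  also have "\<dots> = (1 + x - 2 * x ^ Suc (Suc n)) / (1 - x)"
    unfolding Suc.IH using assms by (simp add: field_simps)
  finally show ?case .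
qed

text \<open>Each point of the ball contributes at least 1 to \<open>\<Sum> exp(b (K - \<parallel>k\<parallel>\<^sub>1))\<close>, and the sum over the whole
  lattice factorizes into geometric series.\<close>

lemma card_int_ball_le:
  assumes J: "finite J" and b: "b > 0"
  shows "finite (int_ball J K)"
    and "real (card (int_ball J K)) \<le> exp (b * K) * ((1 + exp (- b)) / (1 - exp (- b))) ^ card J"
proof -
  define x where "x = exp (- b)"
  have x: "0 < x" "x < 1" using b by (auto simp: x_def)
  define n where "n = nat \<lfloor>K\<rfloor>"
  define P where "P = (J \<rightarrow>\<^sub>E {- int n..int n})"
  have sub: "int_ball J K \<subseteq> P"
  proof
    fix k assume k: "k \<in> int_ball J K"
    have "k j \<in> {- int n..int n}" if "j \<in> J" for j
    proof -
      have "\<bar>real_of_int (k j)\<bar> \<le> (\<Sum>j\<in>J. \<bar>real_of_int (k j)\<bar>)"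
        by (rule member_le_sum) (use that J in auto)
      then have "real_of_int \<bar>k j\<bar> \<le> K" using k by (simp add: int_ball_def)
      then have "\<bar>k j\<bar> \<le> \<lfloor>K\<rfloor>" by (simp add: le_floor_iff)
      then show ?thesis unfolding n_def by (simp add: abs_le_iff; linarith)
    qed
    then show "k \<in> P" using k by (auto simp: P_def int_ball_def PiE_iff)
  qed
  have finP: "finite P" using J by (auto simp: P_def intro!: finite_PiE)
  show "finite (int_ball J K)" using sub finP finite_subset by blast
  have "real (card (int_ball J K)) = (\<Sum>k\<in>int_ball J K. 1)" by simp
  also have "\<dots> \<le> (\<Sum>k\<in>int_ball J K. exp (b * K) * (\<Prod>j\<in>J. x ^ nat \<bar>k j\<bar>))"
  proof (rule sum_mono)
    fix k assume k: "k \<in> int_ball J K"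
    have "(\<Prod>j\<in>J. x ^ nat \<bar>k j\<bar>) = (\<Prod>j\<in>J. exp (- b * \<bar>real_of_int (k j)\<bar>))"
      unfolding x_def by (intro prod.cong refl) (simp add: exp_of_nat_mult[symmetric] mult.commute)
    also have "\<dots> = exp (- b * (\<Sum>j\<in>J. \<bar>real_of_int (k j)\<bar>))"
      using J by (simp only: exp_sum sum_distrib_left)
    finally have "exp (b * K) * (\<Prod>j\<in>J. x ^ nat \<bar>k j\<bar>) = exp (b * (K - (\<Sum>j\<in>J. \<bar>real_of_int (k j)\<bar>)))"
      by (simp add: exp_add[symmetric] right_diff_distrib)
    moreover have "0 \<le> b * (K - (\<Sum>j\<in>J. \<bar>real_of_int (k j)\<bar>))"
      using k b by (simp add: int_ball_def)
    ultimately show "1 \<le> exp (b * K) * (\<Prod>j\<in>J. x ^ nat \<bar>k j\<bar>)" by simp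
  qed
  also have "\<dots> \<le> (\<Sum>k\<in>P. exp (b * K) * (\<Prod>j\<in>J. x ^ nat \<bar>k j\<bar>))"
    by (rule sum_mono2[OF finP sub]) (use x in \<open>simp add: prod_nonneg\<close>)
  also have "\<dots> = exp (b * K) * (\<Prod>j\<in>J. \<Sum>y\<in>{- int n..int n}. x ^ nat \<bar>y\<bar>)"
    unfolding P_def by (subst prod_sum_PiE) (use J in \<open>auto simp: sum_distrib_left\<close>)
  also have "\<dots> \<le> exp (b * K) * (\<Prod>j\<in>J. (1 + x) / (1 - x))"
  proof (intro mult_left_mono prod_mono conjI)
    fix j
    show "(\<Sum>y\<in>{- int n..int n}. x ^ nat \<bar>y\<bar>) \<le> (1 + x) / (1 - x)"
      using x by (subst sum_power_abs_symmetric_interval) (auto intro!: divide_right_mono)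
  qed (use x in \<open>auto intro!: sum_nonneg\<close>)
  finally show "real (card (int_ball J K)) \<le> exp (b * K) * ((1 + exp (- b)) / (1 - exp (- b))) ^ card J"
    by (simp add: x_def)
qed

text \<open>Random rounding, derandomized.  Coordinate \<open>j\<close> takes the value \<open>q j\<close> with probability
  \<open>\<theta> j\<close> and \<open>p j\<close> otherwise, with mean 0.  The right-hand side is the mean of the functional on the left:
  the mixed terms of the squares vanish because the coordinates are independent and centred.  Some
  choice is no worse than the mean, and it can be made one coordinate at a time.\<close>

lemma exists_rounding_le_average:
  fixes B :: "'i \<Rightarrow> 'j \<Rightarrow> real" and \<phi> :: "'j \<Rightarrow> real \<Rightarrow> real"
  assumes I: "finite I" and J: "finite J"
    and th: "\<And>j. j \<in> J \<Longrightarrow> 0 \<le> \<theta> j \<and> \<theta> j \<le> 1"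
    and mean: "\<And>j. j \<in> J \<Longrightarrow> (1 - \<theta> j) * p j + \<theta> j * q j = 0"
  shows "\<exists>y. (\<forall>j\<in>J. y j \<in> {p j, q j}) \<and>
    (\<Sum>i\<in>I. (\<Sum>j\<in>J. B i j * y j)\<^sup>2) + (\<Sum>j\<in>J. \<phi> j (y j))
      \<le> (\<Sum>j\<in>J. (1 - \<theta> j) * ((\<Sum>i\<in>I. (B i j)\<^sup>2) * (p j)\<^sup>2 + \<phi> j (p j))
               + \<theta> j * ((\<Sum>i\<in>I. (B i j)\<^sup>2) * (q j)\<^sup>2 + \<phi> j (q j)))"
  using J th mean
proof (induction J)
  case empty
  then show ?case by simp
next
  case (insert a J)
  let ?av = "\<lambda>j. (1 - \<theta> j) * ((\<Sum>i\<in>I. (B i j)\<^sup>2) * (p j)\<^sup>2 + \<phi> j (p j))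
               + \<theta> j * ((\<Sum>i\<in>I. (B i j)\<^sup>2) * (q j)\<^sup>2 + \<phi> j (q j))"
  obtain y where y: "\<forall>j\<in>J. y j \<in> {p j, q j}"
    "(\<Sum>i\<in>I. (\<Sum>j\<in>J. B i j * y j)\<^sup>2) + (\<Sum>j\<in>J. \<phi> j (y j)) \<le> (\<Sum>j\<in>J. ?av j)"
    using insert.IH insert.prems by auto
  define S where "S i = (\<Sum>j\<in>J. B i j * y j)" for i
  define R where "R = (\<Sum>j\<in>J. \<phi> j (y j))"
  define F where "F c = (\<Sum>i\<in>I. (B i a * c + S i)\<^sup>2) + (\<phi> a c + R)" for c
  define b where "b = (\<Sum>i\<in>I. (B i a)\<^sup>2)"
  define D where "D = (\<Sum>i\<in>I. B i a * S i)"
  have F: "F c = b * c\<^sup>2 + 2 * c * D + (\<Sum>i\<in>I. (S i)\<^sup>2) + (\<phi> a c + R)" for c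
    unfolding F_def b_def D_def
    by (simp add: power2_sum power_mult_distrib sum.distrib sum_distrib_left sum_distrib_right mult_ac)
  have th: "0 \<le> \<theta> a" "\<theta> a \<le> 1" and m: "(1 - \<theta> a) * p a + \<theta> a * q a = 0"
    using insert.prems by auto
  have "(1 - \<theta> a) * F (p a) + \<theta> a * F (q a)
     = ?av a + 2 * D * ((1 - \<theta> a) * p a + \<theta> a * q a) + ((\<Sum>i\<in>I. (S i)\<^sup>2) + R)"
    unfolding F b_def[symmetric] by (simp add: algebra_simps)
  also have "\<dots> \<le> ?av a + (\<Sum>j\<in>J. ?av j)"
    using y(2) unfolding m S_def R_def by simp
  finally have avg: "(1 - \<theta> a) * F (p a) + \<theta> a * F (q a) \<le> (\<Sum>j\<in>insert a J. ?av j)"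
    using insert.hyps by simp
  \<comment> \<open>a weighted mean of two numbers is at least the smaller one\<close>
  have "\<exists>c\<in>{p a, q a}. F c \<le> (\<Sum>j\<in>insert a J. ?av j)"
  proof (rule ccontr)
    let ?R = "\<Sum>j\<in>insert a J. ?av j"
    assume "\<not> ?thesis"
    then have gt: "?R < F (p a)" "?R < F (q a)" by auto
    have "(1 - \<theta> a) * ?R \<le> (1 - \<theta> a) * F (p a)" "\<theta> a * ?R \<le> \<theta> a * F (q a)"
      using gt th by (auto intro!: mult_left_mono)
    moreover have "(1 - \<theta> a) * ?R < (1 - \<theta> a) * F (p a) \<or> \<theta> a * ?R < \<theta> a * F (q a)"
      using gt th by (cases "\<theta> a = 0") (auto intro!: mult_strict_left_mono simp del: mult_less_cancel_left)
    moreover have "(1 - \<theta> a) * ?R + \<theta> a * ?R = ?R" by (simp only: distrib_right[symmetric]) simp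
    ultimately show False using avg by linarith
  qed
  then obtain c where c: "c \<in> {p a, q a}" "F c \<le> (\<Sum>j\<in>insert a J. ?av j)" by blast
  let ?y = "y(a := c)"
  have s: "(\<Sum>j\<in>J. B i j * ?y j) = S i" for i
    unfolding S_def using insert.hyps by (intro sum.cong) auto
  have r: "(\<Sum>j\<in>J. \<phi> j (?y j)) = R"
    unfolding R_def using insert.hyps by (intro sum.cong) auto
  have eq: "(\<Sum>i\<in>I. (\<Sum>j\<in>insert a J. B i j * ?y j)\<^sup>2) + (\<Sum>j\<in>insert a J. \<phi> j (?y j)) = F c"
    unfolding F_def sum.insert[OF insert.hyps] s r by simp
  show ?case
  proof (intro exI conjI)
    show "\<forall>j\<in>insert a J. ?y j \<in> {p j, q j}" using c y(1) by auto
    show "(\<Sum>i\<in>I. (\<Sum>j\<in>insert a J. B i j * ?y j)\<^sup>2) + (\<Sum>j\<in>insert a J. \<phi> j (?y j))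
      \<le> (\<Sum>j\<in>insert a J. ?av j)" unfolding eq by (rule c(2))
  qed
qed

text \<open>Each \<open>z j\<close> is rounded to one of its two neighbours in \<open>\<delta> \<int>\<close>, without bias.  The variance is at
  most \<open>\<delta> min(\<delta>, \<bar>z j\<bar>)\<close>.  The rounding does not cross 0, hence \<open>\<bar>z' j\<bar>\<close> is affine in the error and its
  mean is \<open>\<bar>z j\<bar>\<close>; this is why the \<open>l\<^sub>1\<close>-norm can be controlled together with the quadratic
  terms.  The weights \<open>\<alpha>\<close> and \<open>\<beta>\<close> let one inequality control all three quantities.\<close>

lemma exists_lattice_rounding:
  fixes B :: "'i \<Rightarrow> 'j \<Rightarrow> real" and z :: "'j \<Rightarrow> real" and \<delta> \<beta> \<alpha> :: real
  assumes I: "finite I" and J: "finite J" and del: "\<delta> > 0" and be: "\<beta> \<ge> 0"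
    and B: "\<And>i j. i \<in> I \<Longrightarrow> j \<in> J \<Longrightarrow> \<bar>B i j\<bar> = 1"
  shows "\<exists>k :: 'j \<Rightarrow> int. (\<forall>j\<in>J. \<bar>\<delta> * k j - z j\<bar> \<le> \<delta>) \<and>
    (\<Sum>i\<in>I. (\<Sum>j\<in>J. B i j * (\<delta> * k j - z j))\<^sup>2) + \<beta> * (\<Sum>j\<in>J. (\<delta> * k j - z j)\<^sup>2)
      + \<alpha> * ((\<Sum>j\<in>J. \<bar>\<delta> * k j\<bar>) - (\<Sum>j\<in>J. \<bar>z j\<bar>))
    \<le> (card I + \<beta>) * (\<Sum>j\<in>J. \<delta> * min \<delta> \<bar>z j\<bar>)"
proof -
  define n :: "'j \<Rightarrow> int" where "n j = \<lfloor>\<bar>z j\<bar> / \<delta>\<rfloor>" for j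
  define \<theta> where "\<theta> j = \<bar>z j\<bar> / \<delta> - n j" for j
  define p where "p j = sgn (z j) * (\<delta> * n j - \<bar>z j\<bar>)" for j
  define q where "q j = sgn (z j) * (\<delta> * (n j + 1) - \<bar>z j\<bar>)" for j
  define \<phi> where "\<phi> j y = \<beta> * y\<^sup>2 + \<alpha> * (sgn (z j) * y)" for j and y :: real
  have z: "\<bar>z j\<bar> = \<delta> * (\<theta> j + n j)" for j using del by (simp add: \<theta>_def field_simps)
  have n0: "0 \<le> n j" for j using del by (simp add: n_def)
  have th: "0 \<le> \<theta> j" "\<theta> j < 1" for j unfolding \<theta>_def n_def by linarith+
  have p: "p j = sgn (z j) * (- \<delta> * \<theta> j)" for j
    by (simp add: p_def z algebra_simps)
  have q: "q j = sgn (z j) * (\<delta> * (1 - \<theta> j))" for j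
    by (simp add: q_def z algebra_simps)
  have mean: "(1 - \<theta> j) * p j + \<theta> j * q j = 0" for j
    by (simp add: p q algebra_simps)
  have th01: "0 \<le> \<theta> j \<and> \<theta> j \<le> 1" for j using th[of j] by simp
  obtain y where y: "\<forall>j\<in>J. y j \<in> {p j, q j}"
    "(\<Sum>i\<in>I. (\<Sum>j\<in>J. B i j * y j)\<^sup>2) + (\<Sum>j\<in>J. \<phi> j (y j))
      \<le> (\<Sum>j\<in>J. (1 - \<theta> j) * ((\<Sum>i\<in>I. (B i j)\<^sup>2) * (p j)\<^sup>2 + \<phi> j (p j))
               + \<theta> j * ((\<Sum>i\<in>I. (B i j)\<^sup>2) * (q j)\<^sup>2 + \<phi> j (q j)))"
    using exists_rounding_le_average[OF I J, of \<theta> p q B \<phi>, OF th01 mean] by (elim exE conjE)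
  have avg: "(1 - \<theta> j) * ((\<Sum>i\<in>I. (B i j)\<^sup>2) * (p j)\<^sup>2 + \<phi> j (p j))
               + \<theta> j * ((\<Sum>i\<in>I. (B i j)\<^sup>2) * (q j)\<^sup>2 + \<phi> j (q j))
            \<le> (card I + \<beta>) * (\<delta> * min \<delta> \<bar>z j\<bar>)" if j: "j \<in> J" for j
  proof -
    have B2: "(\<Sum>i\<in>I. (B i j)\<^sup>2) = card I"
    proof -
      have "(B i j)\<^sup>2 = 1" if "i \<in> I" for i using B[OF that j] by (simp add: abs_square_eq_1)
      then show ?thesis by simp
    qed
    have "(1 - \<theta> j) * (card I * (p j)\<^sup>2 + \<phi> j (p j)) + \<theta> j * (card I * (q j)\<^sup>2 + \<phi> j (q j))
        = (card I + \<beta>) * ((1 - \<theta> j) * (p j)\<^sup>2 + \<theta> j * (q j)\<^sup>2)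
          + \<alpha> * sgn (z j) * ((1 - \<theta> j) * p j + \<theta> j * q j)"
      by (simp add: \<phi>_def algebra_simps)
    also have "\<dots> = (card I + \<beta>) * ((1 - \<theta> j) * (p j)\<^sup>2 + \<theta> j * (q j)\<^sup>2)"
      by (simp add: mean)
    also have "(1 - \<theta> j) * (p j)\<^sup>2 + \<theta> j * (q j)\<^sup>2 = (sgn (z j))\<^sup>2 * (\<delta> * (\<delta> * (\<theta> j * (1 - \<theta> j))))"
      by (simp add: p q power2_eq_square algebra_simps)
    also have "(card I + \<beta>) * ((sgn (z j))\<^sup>2 * (\<delta> * (\<delta> * (\<theta> j * (1 - \<theta> j))))) \<le> (card I + \<beta>) * (1 * (\<delta> * min \<delta> \<bar>z j\<bar>))"
    proof (intro mult_left_mono mult_mono)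
      have "\<theta> j * (1 - \<theta> j) \<le> \<theta> j" using th[of j] by (simp add: mult_left_le)
      then have "\<delta> * (\<theta> j * (1 - \<theta> j)) \<le> \<delta> * \<theta> j" using del by simp
      moreover have "\<delta> * \<theta> j \<le> \<bar>z j\<bar>" unfolding z using del n0[of j] by simp
      moreover have "\<delta> * \<theta> j \<le> \<delta>" using del th[of j] by simp
      ultimately show "\<delta> * (\<theta> j * (1 - \<theta> j)) \<le> min \<delta> \<bar>z j\<bar>" by linarith
    qed (use del be th[of j] in \<open>auto simp: sgn_if\<close>)
    finally show ?thesis unfolding B2 by simp
  qed
  define sg :: "'j \<Rightarrow> int" where "sg j = (if z j > 0 then 1 else if z j < 0 then - 1 else 0)" for j
  \<comment> \<open>if p j = q j, then z j = 0 and k j = 0 in either case\<close>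
  define k where "k j = sg j * (if y j = p j then n j else n j + 1)" for j
  have sg: "real_of_int (sg j) = sgn (z j)" for j by (simp add: sg_def sgn_if)
  have zz: "z j = sgn (z j) * \<bar>z j\<bar>" for j by (simp add: sgn_if)
  have yk: "\<delta> * k j - z j = y j" if "j \<in> J" for j
  proof -
    have "\<delta> * k j - z j = sgn (z j) * (\<delta> * (if y j = p j then n j else n j + 1) - \<bar>z j\<bar>)"
      using zz[of j] by (simp add: k_def sg algebra_simps)
    then show ?thesis using y(1) that by (auto simp: p_def q_def)
  qed
  have ak: "\<bar>\<delta> * k j\<bar> - \<bar>z j\<bar> = sgn (z j) * y j" if "j \<in> J" for j
  proof -
    have "\<bar>\<delta> * k j\<bar> = \<bar>sgn (z j)\<bar> * (\<delta> * (if y j = p j then n j else n j + 1))"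
      using del n0[of j] by (auto simp: k_def abs_mult sg[symmetric])
    moreover have "sgn (z j) * y j = sgn (z j) * (sgn (z j) * (\<delta> * (if y j = p j then n j else n j + 1) - \<bar>z j\<bar>))"
      using y(1) that by (auto simp: p_def q_def)
    ultimately show ?thesis by (auto simp: sgn_if)
  qed
  have yb: "\<bar>y j\<bar> \<le> \<delta>" if "j \<in> J" for j
  proof -
    have "y j = sgn (z j) * (- \<delta> * \<theta> j) \<or> y j = sgn (z j) * (\<delta> * (1 - \<theta> j))"
      using y(1) that by (auto simp: p q)
    moreover have "\<bar>- \<delta> * \<theta> j\<bar> \<le> \<delta>" "\<bar>\<delta> * (1 - \<theta> j)\<bar> \<le> \<delta>"
      using del th[of j] by (auto simp: abs_mult)
    ultimately obtain r where "y j = sgn (z j) * r" "\<bar>r\<bar> \<le> \<delta>" by blast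
    then show ?thesis by (auto simp: sgn_if split: if_splits)
  qed
  show ?thesis
  proof (intro exI[of _ k] conjI ballI)
    fix j assume "j \<in> J" then show "\<bar>\<delta> * k j - z j\<bar> \<le> \<delta>" by (simp add: yk yb)
  next
    have 1: "(\<Sum>j\<in>J. B i j * (\<delta> * k j - z j)) = (\<Sum>j\<in>J. B i j * y j)" for i
      by (intro sum.cong) (auto simp: yk)
    have 2: "\<beta> * (\<Sum>j\<in>J. (\<delta> * k j - z j)\<^sup>2) + \<alpha> * ((\<Sum>j\<in>J. \<bar>\<delta> * k j\<bar>) - (\<Sum>j\<in>J. \<bar>z j\<bar>)) = (\<Sum>j\<in>J. \<phi> j (y j))"
      unfolding sum_subtractf[symmetric] \<phi>_def sum.distrib sum_distrib_left[symmetric]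
      by (simp add: yk ak cong: sum.cong)
    have "(\<Sum>i\<in>I. (\<Sum>j\<in>J. B i j * y j)\<^sup>2) + (\<Sum>j\<in>J. \<phi> j (y j))
      \<le> (\<Sum>j\<in>J. (card I + \<beta>) * (\<delta> * min \<delta> \<bar>z j\<bar>))"
      using y(2) sum_mono[OF avg] by (rule order_trans)
    then show "(\<Sum>i\<in>I. (\<Sum>j\<in>J. B i j * (\<delta> * k j - z j))\<^sup>2) + \<beta> * (\<Sum>j\<in>J. (\<delta> * k j - z j)\<^sup>2)
      + \<alpha> * ((\<Sum>j\<in>J. \<bar>\<delta> * k j\<bar>) - (\<Sum>j\<in>J. \<bar>z j\<bar>))
    \<le> (card I + \<beta>) * (\<Sum>j\<in>J. \<delta> * min \<delta> \<bar>z j\<bar>)"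
      unfolding 1 2[symmetric] by (simp add: sum_distrib_left)
  qed
qed

section \<open>Uniform lower bounds for sign matrices\<close>

lemma sum_add_squared_le:
  fixes f g :: "'a \<Rightarrow> real"
  shows "(\<Sum>i\<in>I. (f i + g i)\<^sup>2) \<le> 2 * (\<Sum>i\<in>I. (f i)\<^sup>2) + 2 * (\<Sum>i\<in>I. (g i)\<^sup>2)"
proof -
  have "(f i + g i)\<^sup>2 \<le> 2 * (f i)\<^sup>2 + 2 * (g i)\<^sup>2" for i
    using zero_le_power2[of "f i - g i"] by (simp add: power2_sum power2_diff)
  then have "(\<Sum>i\<in>I. (f i + g i)\<^sup>2) \<le> (\<Sum>i\<in>I. 2 * (f i)\<^sup>2 + 2 * (g i)\<^sup>2)" by (rule sum_mono)
  then show ?thesis by (simp add: sum.distrib sum_distrib_left)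
qed

lemma sum_abs_squared_le:
  fixes x :: "'a \<Rightarrow> real"
  shows "(\<Sum>j\<in>S. \<bar>x j\<bar>)\<^sup>2 \<le> real (card S) * (\<Sum>j\<in>S. (x j)\<^sup>2)"
  using sum_squared_le_sum_of_squares[of "\<lambda>j. \<bar>x j\<bar>" S] by (cases "finite S") (auto simp: mult.commute)

lemma sum_squares_le_sum_abs_squared:
  fixes x :: "'a \<Rightarrow> real"
  shows "(\<Sum>j\<in>S. (x j)\<^sup>2) \<le> (\<Sum>j\<in>S. \<bar>x j\<bar>)\<^sup>2"
proof -
  have "L2_set x S \<le> (\<Sum>j\<in>S. \<bar>x j\<bar>)" by (rule L2_set_le_sum_abs)
  then have "(L2_set x S)\<^sup>2 \<le> (\<Sum>j\<in>S. \<bar>x j\<bar>)\<^sup>2" by (simp add: power_mono)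
  then show ?thesis by (simp add: L2_set_def sum_nonneg)
qed

lemma abs_sign_entry:
  assumes "\<epsilon> \<in> signs (\<Union>i\<in>I. e i ` J)" "i \<in> I" "j \<in> J"
  shows "\<bar>\<epsilon> (e i j)\<bar> = 1"
proof -
  have "e i j \<in> (\<Union>i\<in>I. e i ` J)" using assms by auto
  then have "\<epsilon> (e i j) \<in> {1, -1}"
    using assms(1) unfolding signs_def PiE_dflt_def by blast
  then show ?thesis by auto
qed

lemma sum_inner_scale:
  fixes c :: real
  shows "(\<Sum>i\<in>I. (\<Sum>j\<in>J. B i j * (c * x j))\<^sup>2) = c\<^sup>2 * (\<Sum>i\<in>I. (\<Sum>j\<in>J. B i j * x j)\<^sup>2)"
proof -
  have "(\<Sum>j\<in>J. B i j * (c * x j)) = c * (\<Sum>j\<in>J. B i j * x j)" for i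
    by (simp add: sum_distrib_left mult.left_commute)
  then have "(\<Sum>j\<in>J. B i j * (c * x j))\<^sup>2 = c\<^sup>2 * (\<Sum>j\<in>J. B i j * x j)\<^sup>2" for i
    by (simp only: power_mult_distrib)
  then show ?thesis by (simp only: sum_distrib_left)
qed

text \<open>A vector with \<open>\<parallel>z\<parallel>\<^sub>2 = 1\<close> and \<open>\<parallel>z\<parallel>\<^sub>1 = l\<close> is rounded to the lattice of mesh \<open>1 / (48 l)\<close>.  In the mean the
  squared errors of \<open>z\<close> and of its image are at most \<open>1/48\<close> and \<open>card I / 48\<close>, while the \<open>l\<^sub>1\<close>-norm is
  unchanged; one rounding exceeds none of these by more than the factor 3.  After division by the mesh
  it is an integer vector of \<open>l\<^sub>1\<close>-norm at most \<open>144 l\<^sup>2 \<le> K\<close>.  If \<open>z\<close> violates the claimed bound, then this integer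
  vector lies in the exceptional event of \<open>sign_prob_small_energy\<close>, and a union bound over the integer vectors finishes the proof.\<close>

lemma sign_prob_compressible:
  fixes e :: "'i \<Rightarrow> 'j \<Rightarrow> 't"
  assumes fin: "finite I" "finite J" and inj: "inj_on (case_prod e) (I \<times> J)"
  shows "sign_prob (\<Union>i\<in>I. e i ` J)
     (\<lambda>\<epsilon>. \<exists>z. (\<Sum>j\<in>J. \<bar>z j\<bar>)\<^sup>2 \<le> K / 144 * (\<Sum>j\<in>J. (z j)\<^sup>2) \<and>
        (\<Sum>i\<in>I. (\<Sum>j\<in>J. \<epsilon> (e i j) * z j)\<^sup>2) < card I / 32 * (\<Sum>j\<in>J. (z j)\<^sup>2))
    \<le> card (int_ball J K) * exp (- real (card I) / 24)"
proof -
  let ?T = "\<Union>i\<in>I. e i ` J"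
  let ?Q = "\<lambda>\<epsilon> x. \<Sum>i\<in>I. (\<Sum>j\<in>J. \<epsilon> (e i j) * x j)\<^sup>2"
  let ?n = "real (card I)"
  define KS where "KS = {k \<in> int_ball J K. (\<Sum>j\<in>J. (real_of_int (k j))\<^sup>2) > 0}"
  have finB: "finite (int_ball J K)" by (rule card_int_ball_le(1)[OF fin(2), of 1]) simp
  have finKS: "finite KS" unfolding KS_def using finB by simp
  have "sign_prob ?T (\<lambda>\<epsilon>. \<exists>z. (\<Sum>j\<in>J. \<bar>z j\<bar>)\<^sup>2 \<le> K / 144 * (\<Sum>j\<in>J. (z j)\<^sup>2) \<and>
        ?Q \<epsilon> z < ?n / 32 * (\<Sum>j\<in>J. (z j)\<^sup>2))
     \<le> sign_prob ?T (\<lambda>\<epsilon>. \<exists>k\<in>KS. ?Q \<epsilon> (\<lambda>j. real_of_int (k j)) \<le> ?n * (\<Sum>j\<in>J. (real_of_int (k j))\<^sup>2) / 2)"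
  proof (rule sign_prob_mono, elim exE conjE)
    fix \<epsilon> and z :: "'j \<Rightarrow> real" assume eps: "\<epsilon> \<in> signs ?T"
      and z1: "(\<Sum>j\<in>J. \<bar>z j\<bar>)\<^sup>2 \<le> K / 144 * (\<Sum>j\<in>J. (z j)\<^sup>2)"
      and z2: "?Q \<epsilon> z < ?n / 32 * (\<Sum>j\<in>J. (z j)\<^sup>2)"
    define N where "N = (\<Sum>j\<in>J. (z j)\<^sup>2)"
    have Q0: "0 \<le> ?Q \<epsilon> x" for x by (simp add: sum_nonneg)
    have "0 < ?n / 32 * N" using z2 Q0[of z] unfolding N_def by linarith
    moreover have "N \<ge> 0" by (simp add: N_def sum_nonneg)
    ultimately have N: "N > 0" and n: "?n > 0" by (auto simp: zero_less_mult_iff)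
    define u where "u j = (1 / sqrt N) * z j" for j
    have u1: "(\<Sum>j\<in>J. (u j)\<^sup>2) = 1"
      using N by (simp add: u_def power_divide N_def[symmetric] sum_divide_distrib[symmetric])
    \<comment> \<open>the vector u is z scaled to Euclidean norm 1\<close>
    define l where "l = (\<Sum>j\<in>J. \<bar>u j\<bar>)"
    have "l = (\<Sum>j\<in>J. \<bar>z j\<bar>) / sqrt N"
      using N by (simp add: l_def u_def abs_mult sum_divide_distrib)
    then have l2: "l\<^sup>2 \<le> K / 144"
      using z1 N by (simp add: N_def[symmetric] power_divide pos_divide_le_eq)
    have "1 \<le> l\<^sup>2" using sum_squares_le_sum_abs_squared[of u J] u1 by (simp add: l_def)
    moreover have "l \<ge> 0" by (simp add: l_def sum_nonneg)
    ultimately have l: "l > 0" by (cases "l = 0") auto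
    have Qu: "?Q \<epsilon> u < ?n / 32"
      using z2 N unfolding u_def sum_inner_scale by (simp add: N_def[symmetric] power_divide field_simps)
    define \<delta> where "\<delta> = 1 / (48 * l)"
    have del: "\<delta> > 0" and dl: "\<delta> * l = 1 / 48" using l by (auto simp: \<delta>_def)
    obtain k :: "'j \<Rightarrow> int" where k: "\<forall>j\<in>J. \<bar>\<delta> * k j - u j\<bar> \<le> \<delta>"
       "?Q \<epsilon> (\<lambda>j. \<delta> * k j - u j) + ?n * (\<Sum>j\<in>J. (\<delta> * k j - u j)\<^sup>2)
       + (?n * \<delta>) * ((\<Sum>j\<in>J. \<bar>\<delta> * k j\<bar>) - (\<Sum>j\<in>J. \<bar>u j\<bar>))
       \<le> (?n + ?n) * (\<Sum>j\<in>J. \<delta> * min \<delta> \<bar>u j\<bar>)"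
      using exists_lattice_rounding[OF fin del, of ?n "\<lambda>i j. \<epsilon> (e i j)" u "?n * \<delta>"] abs_sign_entry[OF eps]
      by auto
    define y where "y j = \<delta> * k j - u j" for j
    define S where "S = (\<Sum>j\<in>J. \<bar>\<delta> * k j\<bar>)"
    have "(\<Sum>j\<in>J. \<delta> * min \<delta> \<bar>u j\<bar>) \<le> (\<Sum>j\<in>J. \<delta> * \<bar>u j\<bar>)"
      using del by (intro sum_mono mult_left_mono) auto
    also have "\<dots> = \<delta> * l" by (simp only: sum_distrib_left l_def)
    also have "\<dots> = 1 / 48" by (rule dl)
    finally have "(?n + ?n) * (\<Sum>j\<in>J. \<delta> * min \<delta> \<bar>u j\<bar>) \<le> (?n + ?n) * (1 / 48)"
      by (rule mult_left_mono) simp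
    also have "\<dots> = ?n / 24" by simp
    finally have "(?n + ?n) * (\<Sum>j\<in>J. \<delta> * min \<delta> \<bar>u j\<bar>) \<le> ?n / 24" .
    from order_trans[OF k(2) this]
    have kk: "?Q \<epsilon> y + ?n * (\<Sum>j\<in>J. (y j)\<^sup>2) + ?n * \<delta> * (S - l) \<le> ?n / 24"
      unfolding y_def S_def l_def .
    have kk: "?Q \<epsilon> y + ?n * (\<Sum>j\<in>J. (y j)\<^sup>2) + ?n * (\<delta> * S) \<le> ?n / 16"
    proof -
      have "?n * \<delta> * (S - l) = ?n * (\<delta> * S) - ?n * (\<delta> * l)" by (simp only: right_diff_distrib mult.assoc)
      then show ?thesis using kk unfolding dl by linarith
    qed
    have pos: "0 \<le> ?n * (\<Sum>j\<in>J. (y j)\<^sup>2)" "0 \<le> ?n * (\<delta> * S)" "0 \<le> ?Q \<epsilon> y"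
      using del by (auto simp: S_def intro!: mult_nonneg_nonneg sum_nonneg)
    have Qy: "?Q \<epsilon> y \<le> ?n / 16" using kk pos by linarith
    have "?n * (\<Sum>j\<in>J. (y j)\<^sup>2) \<le> ?n * (1 / 16)" using kk pos by linarith
    then have y2: "(\<Sum>j\<in>J. (y j)\<^sup>2) \<le> 1 / 16" using n by (simp only: mult_le_cancel_left_pos)
    have "?n * (\<delta> * S) \<le> ?n * (1 / 16)" using kk pos by linarith
    then have "\<delta> * S \<le> 1 / 16" using n by (simp only: mult_le_cancel_left_pos)
    then have Sl: "S \<le> 3 * l" using l by (simp add: \<delta>_def field_simps)
    have ball: "restrict k J \<in> int_ball J K"
    proof -
      have "S = \<delta> * (\<Sum>j\<in>J. \<bar>real_of_int (k j)\<bar>)"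
        using del by (simp add: S_def abs_mult sum_distrib_left)
      then have "(\<Sum>j\<in>J. \<bar>real_of_int (k j)\<bar>) = 48 * l * S" using l by (simp add: \<delta>_def)
      also have "\<dots> \<le> 48 * l * (3 * l)" using Sl l by (intro mult_left_mono) auto
      also have "\<dots> \<le> K" using l2 by (simp add: power2_eq_square)
      finally show ?thesis by (simp add: int_ball_def)
    qed
    define N' where "N' = (\<Sum>j\<in>J. (real_of_int (k j))\<^sup>2)"
    have dN: "(\<Sum>j\<in>J. (\<delta> * k j)\<^sup>2) = \<delta>\<^sup>2 * N'"
      by (simp add: N'_def power_mult_distrib sum_distrib_left)
    have "1 \<le> 2 * (\<Sum>j\<in>J. (\<delta> * k j)\<^sup>2) + 2 * (\<Sum>j\<in>J. (- y j)\<^sup>2)"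
      using sum_add_squared_le[of "\<lambda>j. \<delta> * k j" "\<lambda>j. - y j" J] u1 by (simp add: y_def)
    then have N': "7 / 16 \<le> \<delta>\<^sup>2 * N'" using y2 unfolding dN by simp
    then have "0 < \<delta>\<^sup>2 * N'" by linarith
    then have "N' > 0" using del by (simp add: zero_less_mult_iff)
    have "?Q \<epsilon> (\<lambda>j. \<delta> * k j) \<le> 2 * ?Q \<epsilon> u + 2 * ?Q \<epsilon> y"
    proof -
      have "(\<Sum>j\<in>J. \<epsilon> (e i j) * (\<delta> * k j)) = (\<Sum>j\<in>J. \<epsilon> (e i j) * u j) + (\<Sum>j\<in>J. \<epsilon> (e i j) * y j)" for i
        by (simp add: y_def sum.distrib[symmetric] algebra_simps)
      then show ?thesis by (simp only: sum_add_squared_le)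
    qed
    also have "\<dots> \<le> ?n * (7 / 16) / 2" using Qu Qy by linarith
    also have "\<dots> \<le> ?n * (\<delta>\<^sup>2 * N') / 2"
      using N' by (intro divide_right_mono mult_left_mono) auto
    finally have "\<delta>\<^sup>2 * ?Q \<epsilon> (\<lambda>j. real_of_int (k j)) \<le> \<delta>\<^sup>2 * (?n * N' / 2)"
      unfolding sum_inner_scale by (simp add: mult_ac)
    then have "?Q \<epsilon> (\<lambda>j. real_of_int (k j)) \<le> ?n * N' / 2"
      using del by (simp only: mult_le_cancel_left_pos zero_less_power)
    then have "?Q \<epsilon> (\<lambda>j. real_of_int (restrict k J j)) \<le> ?n * (\<Sum>j\<in>J. (real_of_int (restrict k J j))\<^sup>2) / 2"
      by (simp add: N'_def cong: sum.cong)
    moreover have "restrict k J \<in> KS"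
      using ball \<open>N' > 0\<close> unfolding KS_def N'_def by (simp cong: sum.cong)
    ultimately show "\<exists>k\<in>KS. ?Q \<epsilon> (\<lambda>j. real_of_int (k j)) \<le> ?n * (\<Sum>j\<in>J. (real_of_int (k j))\<^sup>2) / 2"
      by blast
  qed
  also have "\<dots> \<le> card KS * exp (- ?n / 24)"
    by (rule sign_prob_union_bound[OF finKS]) (rule sign_prob_small_energy[OF fin inj], simp add: KS_def)
  also have "\<dots> \<le> card (int_ball J K) * exp (- ?n / 24)"
    using card_mono[OF finB, of KS] by (intro mult_right_mono) (auto simp: KS_def)
  finally show ?thesis .
qed

lemma sign_mean_exp_minus_square_spread_image:
  fixes e :: "'j \<Rightarrow> 't"
  assumes J: "finite J" "inj_on e J" "S \<subseteq> J" and b: "\<beta> \<ge> 0" "\<And>j. j \<in> S \<Longrightarrow> \<bar>w j\<bar> \<le> \<beta>"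
  shows "sign_mean (e ` J) (\<lambda>\<epsilon>. exp (- (\<Sum>j\<in>J. \<epsilon> (e j) * w j)\<^sup>2 / 2))
    \<le> 1 / sqrt (1 + 2 / 3 * (\<Sum>j\<in>S. (w j)\<^sup>2)) + \<beta>\<^sup>2"
proof -
  define w' where "w' t = w (inv_into J e t)" for t
  have w': "w' (e j) = w j" if "j \<in> J" for j using that J by (simp add: w'_def)
  have injS: "inj_on e S" using J inj_on_subset by blast
  have "(\<Sum>j\<in>J. \<epsilon> (e j) * w j) = (\<Sum>t\<in>e ` J. \<epsilon> t * w' t)" for \<epsilon> :: "'t \<Rightarrow> real"
    by (subst sum.reindex[OF J(2)]) (simp add: w' cong: sum.cong)
  moreover have "(\<Sum>j\<in>S. (w j)\<^sup>2) = (\<Sum>t\<in>e ` S. (w' t)\<^sup>2)"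
    by (subst sum.reindex[OF injS]) (use J(3) in \<open>auto simp: w' intro!: sum.cong\<close>)
  moreover have "\<bar>w' t\<bar> \<le> \<beta>" if "t \<in> e ` S" for t
    using that b(2) w' J(3) by auto
  moreover have "finite (e ` J)" "e ` S \<subseteq> e ` J" using J by auto
  ultimately show ?thesis
    using sign_mean_exp_minus_square_spread[of "e ` J" "e ` S" \<beta> w'] b(1) by simp
qed

text \<open>The sums have size about \<open>sqrt (card J) / \<delta>\<close>, because enough of the weights \<open>x j\<close> are of order
  \<open>1 / \<delta>\<close>.  Being of size \<open>2 sqrt (card J)\<close> for all \<open>i\<close> is therefore an event of probability of
  order \<open>\<delta>\<close> for each \<open>i\<close>.  The upper bound on the weights in \<open>S\<close> and the lower bound on
  \<open>card J\<close> make the Chebyshev term in the small ball estimate at most \<open>\<delta>\<close>.\<close>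

lemma sign_prob_spread_vector:
  fixes e :: "'i \<Rightarrow> 'j \<Rightarrow> 't" and x :: "'j \<Rightarrow> real" and \<delta> \<tau> :: real
  assumes fin: "finite I" "finite J" and inj: "inj_on (case_prod e) (I \<times> J)"
    and del: "0 < \<delta>" and tau: "0 < \<tau>" "\<tau> \<le> 1"
    and m: "real (card J) \<ge> 4 / (\<tau>\<^sup>2 * \<delta>^3)"
    and S: "S \<subseteq> J" "\<And>j. j \<in> S \<Longrightarrow> \<bar>\<delta> * x j\<bar> \<le> 4 / \<tau>" "(\<Sum>j\<in>S. (\<delta> * x j)\<^sup>2) \<ge> \<tau>\<^sup>2 * card J / 16"
  shows "sign_prob (\<Union>i\<in>I. e i ` J)
     (\<lambda>\<epsilon>. (\<Sum>i\<in>I. (\<Sum>j\<in>J. \<epsilon> (e i j) * x j)\<^sup>2) \<le> 4 * real (card I) * real (card J))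
    \<le> (20 * \<delta> / \<tau>) ^ card I"
proof -
  let ?m = "real (card J)" and ?n = "real (card I)"
  have m0: "?m > 0" using m del tau by (smt (verit) divide_pos_pos mult_pos_pos zero_less_power)
  \<comment> \<open>this scaling matches the exponent 1 / (8 card J) in the Markov inequality below\<close>
  define w where "w j = x j / (2 * sqrt ?m)" for j
  define \<beta> where "\<beta> = 2 / (\<tau> * \<delta> * sqrt ?m)"
  have b0: "\<beta> \<ge> 0" using del tau m0 by (simp add: \<beta>_def)
  have b2: "\<beta>\<^sup>2 \<le> \<delta>"
  proof -
    have "4 \<le> ?m * (\<tau>\<^sup>2 * \<delta>^3)" using m del tau by (simp add: field_simps)
    also have "\<dots> = \<delta> * (\<tau>\<^sup>2 * \<delta>\<^sup>2 * ?m)" by (simp add: power2_eq_square power3_eq_cube)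
    finally have "4 / (\<tau>\<^sup>2 * \<delta>\<^sup>2 * ?m) \<le> \<delta>" using m0 del tau by (simp add: pos_divide_le_eq)
    then show ?thesis using m0 by (simp add: \<beta>_def power_divide power_mult_distrib)
  qed
  have wb: "\<bar>w j\<bar> \<le> \<beta>" if "j \<in> S" for j
  proof -
    have "\<delta> * \<bar>x j\<bar> \<le> 4 / \<tau>" using S(2)[OF that] del by (simp add: abs_mult)
    then have "\<bar>x j\<bar> \<le> 4 / (\<tau> * \<delta>)" using del tau by (simp add: field_simps)
    then have "\<bar>x j\<bar> / (2 * sqrt ?m) \<le> 4 / (\<tau> * \<delta>) / (2 * sqrt ?m)"
      using m0 by (intro divide_right_mono) auto
    then show ?thesis using m0 by (simp add: w_def \<beta>_def abs_divide mult_ac)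
  qed
  have sw: "(\<Sum>j\<in>S. (w j)\<^sup>2) \<ge> \<tau>\<^sup>2 / (64 * \<delta>\<^sup>2)"
  proof -
    have "(\<Sum>j\<in>S. (w j)\<^sup>2) = (\<Sum>j\<in>S. (\<delta> * x j)\<^sup>2) / (4 * \<delta>\<^sup>2 * ?m)"
      using del m0 by (simp add: w_def power_divide power_mult_distrib sum_divide_distrib)
    also have "\<dots> \<ge> (\<tau>\<^sup>2 * ?m / 16) / (4 * \<delta>\<^sup>2 * ?m)"
      using S(3) m0 del by (intro divide_right_mono) auto
    also have "(\<tau>\<^sup>2 * ?m / 16) / (4 * \<delta>\<^sup>2 * ?m) = \<tau>\<^sup>2 / (64 * \<delta>\<^sup>2)"
      using m0 by simp
    finally show ?thesis .
  qed
  have q: "sign_mean (e i ` J) (\<lambda>\<epsilon>. exp (- (1 / (8 * ?m)) * (\<Sum>j\<in>J. \<epsilon> (e i j) * x j)\<^sup>2)) \<le> 11 * \<delta> / \<tau>"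
    if i: "i \<in> I" for i
  proof -
    have ij: "inj_on (e i) J" using inj i by (auto simp: inj_on_def)
    have "(\<Sum>j\<in>J. \<epsilon> (e i j) * w j) = (\<Sum>j\<in>J. \<epsilon> (e i j) * x j) / (2 * sqrt ?m)" for \<epsilon> :: "'t \<Rightarrow> real"
      by (simp add: w_def sum_divide_distrib)
    then have eq: "- (1 / (8 * ?m)) * (\<Sum>j\<in>J. \<epsilon> (e i j) * x j)\<^sup>2 = - (\<Sum>j\<in>J. \<epsilon> (e i j) * w j)\<^sup>2 / 2" for \<epsilon> :: "'t \<Rightarrow> real"
      using m0 by (simp add: power_divide power_mult_distrib)
    have "sign_mean (e i ` J) (\<lambda>\<epsilon>. exp (- (1 / (8 * ?m)) * (\<Sum>j\<in>J. \<epsilon> (e i j) * x j)\<^sup>2))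
      \<le> 1 / sqrt (1 + 2 / 3 * (\<Sum>j\<in>S. (w j)\<^sup>2)) + \<beta>\<^sup>2"
      unfolding eq by (rule sign_mean_exp_minus_square_spread_image[OF fin(2) ij S(1) b0 wb])
    also have "\<dots> \<le> 1 / (\<tau> / (10 * \<delta>)) + \<delta>"
    proof (rule add_mono[OF divide_left_mono b2])
      have "\<tau> / (10 * \<delta>) = sqrt ((\<tau> / (10 * \<delta>))\<^sup>2)" using tau del by simp
      also have "\<dots> \<le> sqrt (1 + 2 / 3 * (\<Sum>j\<in>S. (w j)\<^sup>2))"
      proof (rule real_sqrt_le_mono)
        have "(\<tau> / (10 * \<delta>))\<^sup>2 \<le> 2 / 3 * (\<tau>\<^sup>2 / (64 * \<delta>\<^sup>2))"
          using del by (simp add: power_divide power_mult_distrib field_simps)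
        also have "\<dots> \<le> 2 / 3 * (\<Sum>j\<in>S. (w j)\<^sup>2)" using sw by simp
        finally show "(\<tau> / (10 * \<delta>))\<^sup>2 \<le> 1 + 2 / 3 * (\<Sum>j\<in>S. (w j)\<^sup>2)" by simp
      qed
      finally show "\<tau> / (10 * \<delta>) \<le> sqrt (1 + 2 / 3 * (\<Sum>j\<in>S. (w j)\<^sup>2))" .
      have "0 \<le> (\<Sum>j\<in>S. (w j)\<^sup>2)" by (simp add: sum_nonneg)
      then show "0 < sqrt (1 + 2 / 3 * (\<Sum>j\<in>S. (w j)\<^sup>2)) * (\<tau> / (10 * \<delta>))"
        using del tau by (intro mult_pos_pos) auto
      show "(0::real) \<le> 1" by simp
    qed
    also have "\<dots> \<le> 11 * \<delta> / \<tau>"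
    proof -
      have "\<delta> \<le> \<delta> / \<tau>" using del tau by (simp add: pos_le_divide_eq mult_left_le)
      then show ?thesis by simp
    qed
    finally show ?thesis .
  qed
  have "sign_prob (\<Union>i\<in>I. e i ` J)
     (\<lambda>\<epsilon>. (\<Sum>i\<in>I. (\<Sum>j\<in>J. \<epsilon> (e i j) * x j)\<^sup>2) \<le> 4 * ?n * ?m)
    \<le> exp (1 / (8 * ?m) * (4 * ?n * ?m)) * (11 * \<delta> / \<tau>) ^ card I"
    by (rule sign_prob_sum_squares_le[OF fin inj _ q]) auto
  also have "exp (1 / (8 * ?m) * (4 * ?n * ?m)) = exp (1 / 2) ^ card I"
    using m0 by (simp add: exp_of_nat_mult[symmetric])
  also have "exp (1 / 2) ^ card I * (11 * \<delta> / \<tau>) ^ card I = (exp (1 / 2) * (11 * \<delta> / \<tau>)) ^ card I"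
    by (simp only: power_mult_distrib)
  also have "\<dots> \<le> (20 * \<delta> / \<tau>) ^ card I"
  proof (rule power_mono)
    have "exp (1 / 2 :: real) \<le> 1 + 1 / 2 + (1 / 2)\<^sup>2" by (rule exp_bound) auto
    then have "exp (1 / 2) * (11 * \<delta> / \<tau>) \<le> 20 / 11 * (11 * \<delta> / \<tau>)"
      using del tau by (intro mult_right_mono) (auto simp: power2_eq_square)
    then show "exp (1 / 2) * (11 * \<delta> / \<tau>) \<le> 20 * \<delta> / \<tau>" by simp
  qed (use del tau in auto)
  finally show ?thesis .
qed

text \<open>Normalize \<open>\<parallel>v\<parallel>\<^sub>2\<^sup>2 = card J\<close> and \<open>\<parallel>v\<parallel>\<^sub>1 \<ge> \<tau> card J\<close>.  Coordinates above \<open>2/\<tau>\<close> carry at most half of the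
  \<open>l\<^sub>1\<close>-norm, so the others carry squares of total at least a multiple of \<open>\<tau>\<^sup>2 card J\<close>.  A rounding to the lattice
  \<open>\<delta> \<int>\<close> moves each coordinate by at most \<open>\<delta>\<close>, hence it keeps this structure, and
  \<open>sign_prob_spread_vector\<close> applies to every lattice point that can occur.\<close>

lemma sign_prob_incompressible:
  fixes e :: "'i \<Rightarrow> 'j \<Rightarrow> 't" and \<delta> \<tau> :: real
  assumes fin: "finite I" "finite J" and inj: "inj_on (case_prod e) (I \<times> J)"
    and tau: "0 < \<tau>" "\<tau> \<le> 1" and del: "0 < \<delta>" "\<delta> \<le> \<tau> / 4"
    and m: "real (card J) \<ge> 4 / (\<tau>\<^sup>2 * \<delta>^3)"
  shows "sign_prob (\<Union>i\<in>I. e i ` J)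
     (\<lambda>\<epsilon>. \<exists>v::'j \<Rightarrow> real. (\<Sum>j\<in>J. (v j)\<^sup>2) = real (card J) \<and> (\<Sum>j\<in>J. \<bar>v j\<bar>) \<ge> \<tau> * real (card J) \<and>
        (\<Sum>i\<in>I. (\<Sum>j\<in>J. \<epsilon> (e i j) * v j)\<^sup>2) < \<delta>\<^sup>2 * real (card I) * real (card J))
    \<le> card (int_ball J (2 * real (card J) / \<delta>)) * (20 * \<delta> / \<tau>) ^ card I"
proof -
  let ?m = "real (card J)" and ?n = "real (card I)"
  let ?T = "\<Union>i\<in>I. e i ` J"
  let ?Q = "\<lambda>\<epsilon> x. \<Sum>i\<in>I. (\<Sum>j\<in>J. \<epsilon> (e i j) * x j)\<^sup>2"
  define KS where "KS = {k \<in> int_ball J (2 * ?m / \<delta>). \<exists>S\<subseteq>J. (\<forall>j\<in>S. \<bar>\<delta> * real_of_int (k j)\<bar> \<le> 4 / \<tau>)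
      \<and> (\<Sum>j\<in>S. (\<delta> * real_of_int (k j))\<^sup>2) \<ge> \<tau>\<^sup>2 * ?m / 16}"
  have finB: "finite (int_ball J (2 * ?m / \<delta>))" by (rule card_int_ball_le(1)[OF fin(2), of 1]) simp
  have finKS: "finite KS" unfolding KS_def using finB by simp
  have "sign_prob ?T (\<lambda>\<epsilon>. \<exists>v. (\<Sum>j\<in>J. (v j)\<^sup>2) = ?m \<and> (\<Sum>j\<in>J. \<bar>v j\<bar>) \<ge> \<tau> * ?m \<and>
        ?Q \<epsilon> v < \<delta>\<^sup>2 * ?n * ?m)
     \<le> sign_prob ?T (\<lambda>\<epsilon>. \<exists>k\<in>KS. ?Q \<epsilon> (\<lambda>j. real_of_int (k j)) \<le> 4 * ?n * ?m)"
  proof (rule sign_prob_mono, elim exE conjE)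
    fix \<epsilon> and v :: "'j \<Rightarrow> real" assume eps: "\<epsilon> \<in> signs ?T"
      and v2: "(\<Sum>j\<in>J. (v j)\<^sup>2) = ?m" and v1: "(\<Sum>j\<in>J. \<bar>v j\<bar>) \<ge> \<tau> * ?m"
      and vQ: "?Q \<epsilon> v < \<delta>\<^sup>2 * ?n * ?m"
    obtain k :: "'j \<Rightarrow> int" where k: "\<forall>j\<in>J. \<bar>\<delta> * k j - v j\<bar> \<le> \<delta>"
       "?Q \<epsilon> (\<lambda>j. \<delta> * k j - v j) \<le> ?n * (\<Sum>j\<in>J. \<delta> * min \<delta> \<bar>v j\<bar>)"
      using exists_lattice_rounding[OF fin del(1), of 0 "\<lambda>i j. \<epsilon> (e i j)" v 0] abs_sign_entry[OF eps]
      by auto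
    define y where "y j = \<delta> * k j - v j" for j
    have "?Q \<epsilon> y \<le> ?n * (\<Sum>j\<in>J. \<delta> * min \<delta> \<bar>v j\<bar>)" using k(2) by (simp add: y_def)
    also have "\<dots> \<le> ?n * (\<Sum>j\<in>J. \<delta> * \<delta>)"
      using del by (intro sum_mono mult_left_mono) auto
    finally have Qy: "?Q \<epsilon> y \<le> \<delta>\<^sup>2 * ?n * ?m" by (simp add: power2_eq_square mult_ac)
    have "?Q \<epsilon> (\<lambda>j. \<delta> * k j) \<le> 2 * ?Q \<epsilon> v + 2 * ?Q \<epsilon> y"
    proof -
      have "(\<Sum>j\<in>J. \<epsilon> (e i j) * (\<delta> * k j)) = (\<Sum>j\<in>J. \<epsilon> (e i j) * v j) + (\<Sum>j\<in>J. \<epsilon> (e i j) * y j)" for i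
        by (simp add: y_def sum.distrib[symmetric] algebra_simps)
      then show ?thesis by (simp only: sum_add_squared_le)
    qed
    also have "\<dots> \<le> \<delta>\<^sup>2 * (4 * ?n * ?m)" using vQ Qy by linarith
    finally have "?Q \<epsilon> (\<lambda>j. real_of_int (k j)) \<le> 4 * ?n * ?m"
      using del unfolding sum_inner_scale by (simp only: mult_le_cancel_left_pos zero_less_power)
    then have Qk: "?Q \<epsilon> (\<lambda>j. real_of_int (restrict k J j)) \<le> 4 * ?n * ?m"
      by (simp cong: sum.cong)
    have vm: "(\<Sum>j\<in>J. \<bar>v j\<bar>) \<le> ?m"
    proof -
      have "(\<Sum>j\<in>J. \<bar>v j\<bar>)\<^sup>2 \<le> ?m\<^sup>2"
        using sum_abs_squared_le[of v J] unfolding v2 power2_eq_square[of ?m] .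
      then show ?thesis by (rule power2_le_imp_le) simp
    qed
    have kJ: "(\<Sum>j\<in>J. \<bar>\<delta> * k j\<bar>) \<le> 2 * ?m"
    proof -
      have "(\<Sum>j\<in>J. \<bar>\<delta> * k j\<bar>) \<le> (\<Sum>j\<in>J. \<bar>v j\<bar> + 1)"
        using k(1) del tau by (intro sum_mono) fastforce
      then show ?thesis using vm by (simp add: sum.distrib)
    qed
    have ball: "restrict k J \<in> int_ball J (2 * ?m / \<delta>)"
    proof -
      have "\<delta> * (\<Sum>j\<in>J. \<bar>real_of_int (k j)\<bar>) \<le> 2 * ?m"
        using kJ del by (simp add: abs_mult sum_distrib_left)
      then show ?thesis using del by (simp add: int_ball_def pos_le_divide_eq mult.commute)
    qed
    define S where "S = {j \<in> J. \<bar>v j\<bar> \<le> 2 / \<tau>}"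
    have SJ: "S \<subseteq> J" by (auto simp: S_def)
    have out: "(\<Sum>j\<in>J - S. \<bar>v j\<bar>) \<le> \<tau> / 2 * ?m"
    proof -
      have "(\<Sum>j\<in>J - S. \<bar>v j\<bar>) \<le> (\<Sum>j\<in>J - S. \<tau> / 2 * (v j)\<^sup>2)"
      proof (rule sum_mono)
        fix j assume "j \<in> J - S"
        then have "1 \<le> \<tau> / 2 * \<bar>v j\<bar>" using tau by (auto simp: S_def field_simps)
        then have "\<bar>v j\<bar> * 1 \<le> \<bar>v j\<bar> * (\<tau> / 2 * \<bar>v j\<bar>)" by (intro mult_left_mono) auto
        also have "\<dots> = \<tau> / 2 * (v j)\<^sup>2" by (simp add: power2_eq_square)
        finally show "\<bar>v j\<bar> \<le> \<tau> / 2 * (v j)\<^sup>2" by simp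
      qed
      also have "\<dots> \<le> (\<Sum>j\<in>J. \<tau> / 2 * (v j)\<^sup>2)"
        using tau fin by (intro sum_mono2) auto
      also have "\<dots> = \<tau> / 2 * ?m" by (simp only: sum_distrib_left[symmetric] v2)
      finally show ?thesis .
    qed
    have inn: "(\<Sum>j\<in>S. \<bar>v j\<bar>) \<ge> \<tau> / 2 * ?m"
      using v1 out sum.subset_diff[OF SJ fin(2), of "\<lambda>j. \<bar>v j\<bar>"] by (simp add: field_simps)
    have cS: "real (card S) \<le> ?m" using card_mono[OF fin(2) SJ] by simp
    have "\<tau> / 4 * ?m \<le> (\<Sum>j\<in>S. \<bar>\<delta> * k j\<bar>)"
    proof -
      have "(\<Sum>j\<in>S. \<bar>v j\<bar> - \<delta>) \<le> (\<Sum>j\<in>S. \<bar>\<delta> * k j\<bar>)"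
        using k(1) SJ by (intro sum_mono) fastforce
      moreover have "real (card S) * \<delta> \<le> ?m * (\<tau> / 4)"
        using cS del by (intro mult_mono) auto
      ultimately show ?thesis using inn by (simp add: sum_subtractf field_simps)
    qed
    then have "(\<tau> / 4 * ?m)\<^sup>2 \<le> (\<Sum>j\<in>S. \<bar>\<delta> * k j\<bar>)\<^sup>2" using tau by (intro power_mono) auto
    also have "\<dots> \<le> real (card S) * (\<Sum>j\<in>S. (\<delta> * k j)\<^sup>2)" by (rule sum_abs_squared_le)
    also have "\<dots> \<le> ?m * (\<Sum>j\<in>S. (\<delta> * k j)\<^sup>2)" using cS by (intro mult_right_mono sum_nonneg) auto
    finally have mm: "?m * (\<tau>\<^sup>2 * ?m / 16) \<le> ?m * (\<Sum>j\<in>S. (\<delta> * k j)\<^sup>2)"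
      by (simp add: power2_eq_square field_simps)
    have m0: "?m > 0" using m del tau by (smt (verit) divide_pos_pos mult_pos_pos zero_less_power)
    from mm have big: "\<tau>\<^sup>2 * ?m / 16 \<le> (\<Sum>j\<in>S. (\<delta> * k j)\<^sup>2)"
      using m0 by (simp only: mult_le_cancel_left_pos)
    have bd: "\<bar>\<delta> * k j\<bar> \<le> 4 / \<tau>" if "j \<in> S" for j
    proof -
      have "\<bar>\<delta> * k j\<bar> \<le> \<bar>v j\<bar> + \<delta>" using k(1) that SJ by fastforce
      also have "\<dots> \<le> 2 / \<tau> + \<delta>" using that by (simp add: S_def)
      also have "\<delta> \<le> 2 / \<tau>"
      proof -
        have "\<delta> \<le> 1" using del tau by linarith
        moreover have "1 \<le> 2 / \<tau>" using tau by simp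
        ultimately show ?thesis by linarith
      qed
      finally show ?thesis by simp
    qed
    have "restrict k J \<in> KS"
      unfolding KS_def
    proof (intro CollectI conjI ball exI[of _ S] SJ ballI)
      have "(\<Sum>j\<in>S. (\<delta> * real_of_int (restrict k J j))\<^sup>2) = (\<Sum>j\<in>S. (\<delta> * real_of_int (k j))\<^sup>2)"
        using SJ by (intro sum.cong) auto
      then show "\<tau>\<^sup>2 * ?m / 16 \<le> (\<Sum>j\<in>S. (\<delta> * real_of_int (restrict k J j))\<^sup>2)" using big by simp
      show "\<bar>\<delta> * real_of_int (restrict k J j)\<bar> \<le> 4 / \<tau>" if "j \<in> S" for j
        using bd[OF that] SJ that by auto
    qed
    with Qk show "\<exists>k\<in>KS. ?Q \<epsilon> (\<lambda>j. real_of_int (k j)) \<le> 4 * ?n * ?m" by blast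
  qed
  also have "\<dots> \<le> card KS * (20 * \<delta> / \<tau>) ^ card I"
  proof (rule sign_prob_union_bound[OF finKS])
    fix k assume "k \<in> KS"
    then obtain S where "S \<subseteq> J" "\<And>j. j \<in> S \<Longrightarrow> \<bar>\<delta> * real_of_int (k j)\<bar> \<le> 4 / \<tau>"
      "(\<Sum>j\<in>S. (\<delta> * real_of_int (k j))\<^sup>2) \<ge> \<tau>\<^sup>2 * ?m / 16" by (auto simp: KS_def)
    then show "sign_prob ?T (\<lambda>\<epsilon>. ?Q \<epsilon> (\<lambda>j. real_of_int (k j)) \<le> 4 * ?n * ?m) \<le> (20 * \<delta> / \<tau>) ^ card I"
      by (rule sign_prob_spread_vector[OF fin inj del(1) tau m])
  qed
  also have "\<dots> \<le> card (int_ball J (2 * ?m / \<delta>)) * (20 * \<delta> / \<tau>) ^ card I"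
    using card_mono[OF finB, of KS] del tau by (intro mult_right_mono) (auto simp: KS_def)
  finally show ?thesis .
qed

section \<open>Two properties of Bernoulli matrices\<close>

text \<open>The mesh of the lattice for the spread vectors.  It equals \<open>\<tau>\<^sup>2 / 800\<close> with \<open>\<tau> = 1/400\<close>, which makes
  \<open>(36/\<delta>) (20 \<delta>/\<tau>)\<^sup>3 \<le> exp(-1)\<close> for \<open>\<delta> = mesh\<close>.\<close>

definition mesh :: real where "mesh = 1 / 128000000"

text \<open>The scale \<open>m / ln(d/m)\<close> is, up to a constant, the sparsity up to which \<open>m\<close> measurements
  determine a sparse vector of dimension \<open>d\<close>.\<close>

definition kernel_spread :: "nat \<Rightarrow> nat \<Rightarrow> (nat \<times> nat \<Rightarrow> real) \<Rightarrow> bool" where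
  "kernel_spread m d \<epsilon> \<longleftrightarrow>
     (\<forall>z. (\<Sum>j<d. \<bar>z j\<bar>)\<^sup>2 \<le> real m / (144000 * ln (real d / real m)) * (\<Sum>j<d. (z j)\<^sup>2) \<longrightarrow>
       real m / 32 * (\<Sum>j<d. (z j)\<^sup>2) \<le> (\<Sum>i<m. (\<Sum>j<d. \<epsilon> (i, j) * z j)\<^sup>2))"

definition transpose_bounded_below :: "nat \<Rightarrow> nat \<Rightarrow> (nat \<times> nat \<Rightarrow> real) \<Rightarrow> bool" where
  "transpose_bounded_below m d \<epsilon> \<longleftrightarrow>
     (\<forall>v. mesh\<^sup>2 * real d * (\<Sum>i<m. (v i)\<^sup>2) \<le> (\<Sum>j<d. (\<Sum>i<m. \<epsilon> (i, j) * v i)\<^sup>2))"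

lemma card_int_ball_le_exp:
  assumes J: "finite J" and x: "0 < x" "x \<le> 1 / 2"
  shows "real (card (int_ball J K)) \<le> exp (ln (1 / x) * K + 3 * x * real (card J))"
proof -
  have b: "ln (1 / x) > 0" "exp (- ln (1 / x)) = x" using x by (auto simp: ln_div)
  \<comment> \<open>uses x at most 1/2\<close>
  have r: "(1 + x) / (1 - x) \<le> exp (3 * x)"
  proof -
    have "1 \<le> (1 + 2 * x) * (1 - x)" using x by (simp add: algebra_simps)
    then have "1 / (1 - x) \<le> 1 + 2 * x" using x by (simp add: pos_divide_le_eq)
    also have "\<dots> \<le> exp (2 * x)" by (rule exp_ge_add_one_self)
    finally have "(1 + x) * (1 / (1 - x)) \<le> exp x * exp (2 * x)"
      using x by (intro mult_mono) auto
    then show ?thesis by (simp add: exp_add[symmetric])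
  qed
  have "real (card (int_ball J K)) \<le> exp (ln (1 / x) * K) * ((1 + x) / (1 - x)) ^ card J"
    using card_int_ball_le(2)[OF J b(1), of K] unfolding b(2) .
  also have "\<dots> \<le> exp (ln (1 / x) * K) * exp (3 * x) ^ card J"
    using r x by (intro mult_left_mono power_mono) auto
  also have "\<dots> = exp (ln (1 / x) * K + 3 * x * real (card J))"
    by (simp add: exp_add exp_of_nat_mult[symmetric] mult_ac)
  finally show ?thesis .
qed

lemma exp_one_bounds: "exp (1 :: real) < 272 / 100" "exp (1 :: real) > 13 / 5"
proof -
  have "13 / 8 \<le> exp (1 / 2 :: real)"
    using exp_lower_Taylor_quadratic[of "1 / 2"] by (simp add: power2_eq_square)
  then have "(13 / 8) * (13 / 8) \<le> exp (1 / 2 :: real) * exp (1 / 2)" by (intro mult_mono) auto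
  then show "exp (1 :: real) > 13 / 5" by (simp add: exp_add[symmetric])
qed (rule e_less_272)

lemma ln_300_le: "ln (300 :: real) \<le> 6"
proof -
  have "(300 :: real) \<le> (13 / 5) ^ 6" by (simp add: power_numeral_reduce)
  also have "\<dots> \<le> exp 1 ^ 6" using exp_one_bounds by (intro power_mono) auto
  also have "\<dots> = exp 6" by (simp add: exp_of_nat_mult[symmetric])
  finally have "ln 300 \<le> ln (exp (6 :: real))" by (subst ln_le_cancel_iff) auto
  then show ?thesis by simp
qed

lemma ln_ratio_ge_one:
  assumes "0 < m" "3 * real m \<le> real d"
  shows "1 \<le> ln (real d / real m)"
proof -
  have "exp 1 \<le> (3 :: real)" using exp_one_bounds by simp
  also have "3 \<le> real d / real m" using assms by (simp add: pos_le_divide_eq)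
  finally have "exp 1 \<le> real d / real m" .
  then have "ln (exp 1) \<le> ln (real d / real m)" using assms by (subst ln_le_cancel_iff) auto
  then show ?thesis by simp
qed

text \<open>With \<open>x = m / (300 d)\<close> in the count of lattice points, \<open>ln (1/x)\<close> is at most a multiple of \<open>ln (d/m)\<close>, which the
  denominator of \<open>K\<close> cancels, and \<open>3 x d\<close> is a small multiple of \<open>m\<close>.\<close>

lemma sign_prob_not_kernel_spread:
  assumes m: "0 < m" and d: "3 * real m \<le> real d"
  shows "sign_prob ({..<m} \<times> {..<d}) (\<lambda>\<epsilon>. \<not> kernel_spread m d \<epsilon>) \<le> exp (- real m / 48)"
proof -
  define L where "L = ln (real d / real m)"
  have L: "1 \<le> L" unfolding L_def using m d by (rule ln_ratio_ge_one)
  define K where "K = real m / (1000 * L)"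
  define x where "x = real m / (300 * real d)"
  have d0: "0 < real d" using m d by linarith
  have x: "0 < x" "x \<le> 1 / 2" using m d d0 by (auto simp: x_def field_simps)
  have lx: "ln (1 / x) \<le> 7 * L"
  proof -
    have "1 / x = 300 * (real d / real m)" by (simp add: x_def)
    then have "ln (1 / x) = ln 300 + L" using m d0 by (simp add: L_def ln_mult ln_div)
    then show ?thesis using ln_300_le L by linarith
  qed
  have T: "(\<Union>i\<in>{..<m}. Pair i ` {..<d}) = {..<m} \<times> {..<d}" by auto
  have K144: "K / 144 = real m / (144000 * L)" by (simp add: K_def)
  have "sign_prob ({..<m} \<times> {..<d}) (\<lambda>\<epsilon>. \<not> kernel_spread m d \<epsilon>)
    \<le> card (int_ball {..<d} K) * exp (- real m / 24)"
    using sign_prob_compressible[of "{..<m}" "{..<d}" Pair K]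
    unfolding T K144 kernel_spread_def L_def[symmetric] by (simp add: inj_on_def not_le not_less)
  also have "\<dots> \<le> exp (ln (1 / x) * K + 3 * x * real d) * exp (- real m / 24)"
    using card_int_ball_le_exp[OF _ x, of "{..<d}" K] by (intro mult_right_mono) auto
  also have "\<dots> \<le> exp (real m / 48) * exp (- real m / 24)"
  proof (intro mult_right_mono)
    have "ln (1 / x) * K \<le> 7 * L * K" using lx L by (intro mult_right_mono) (auto simp: K_def)
    also have "\<dots> = 7 / 1000 * real m" using L by (simp add: K_def)
    finally have "ln (1 / x) * K + 3 * x * real d \<le> 7 / 1000 * real m + 1 / 100 * real m"
      using d0 by (simp add: x_def)
    then show "exp (ln (1 / x) * K + 3 * x * real d) \<le> exp (real m / 48)" by simp
  qed auto
  also have "\<dots> = exp (- real m / 48)" by (simp add: exp_add[symmetric])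
  finally show ?thesis .
qed

lemma sign_prob_columns_compressible:
  assumes m: "0 < m" and d: "3 * real m \<le> real d"
  shows "sign_prob ({..<m} \<times> {..<d})
     (\<lambda>\<epsilon>. \<exists>v. (\<Sum>i<m. \<bar>v i\<bar>)\<^sup>2 \<le> real m / 144000 * (\<Sum>i<m. (v i)\<^sup>2) \<and>
        (\<Sum>j<d. (\<Sum>i<m. \<epsilon> (i, j) * v i)\<^sup>2) < real d / 32 * (\<Sum>i<m. (v i)\<^sup>2)) \<le> exp (- real m / 48)"
proof -
  have T: "(\<Union>j\<in>{..<d}. (\<lambda>i. (i, j)) ` {..<m}) = {..<m} \<times> {..<d}" by auto
  have K144: "real m / 1000 / 144 = real m / 144000" by simp
  have "sign_prob ({..<m} \<times> {..<d})
     (\<lambda>\<epsilon>. \<exists>v. (\<Sum>i<m. \<bar>v i\<bar>)\<^sup>2 \<le> real m / 144000 * (\<Sum>i<m. (v i)\<^sup>2) \<and>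
        (\<Sum>j<d. (\<Sum>i<m. \<epsilon> (i, j) * v i)\<^sup>2) < real d / 32 * (\<Sum>i<m. (v i)\<^sup>2))
     \<le> card (int_ball {..<m} (real m / 1000)) * exp (- real d / 24)"
    using sign_prob_compressible[of "{..<d}" "{..<m}" "\<lambda>j i. (i, j)" "real m / 1000"]
    unfolding T K144 by (simp add: inj_on_def)
  also have "\<dots> \<le> exp (ln (1 / (1/300)) * (real m / 1000) + 3 * (1/300) * real m) * exp (- real d / 24)"
    using card_int_ball_le_exp[of "{..<m}" "1/300" "real m / 1000"] by (intro mult_right_mono) auto
  also have "\<dots> \<le> exp (real m / 48) * exp (- real m / 24)"
  proof (intro mult_mono)
    have "ln 300 * (real m / 1000) \<le> 6 * (real m / 1000)" using ln_300_le by (intro mult_right_mono) auto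
    then show "exp (ln (1 / (1/300)) * (real m / 1000) + 3 * (1/300) * real m) \<le> exp (real m / 48)" by simp
    show "exp (- real d / 24) \<le> exp (- real m / 24)" using d by simp
  qed auto
  also have "\<dots> = exp (- real m / 48)" by (simp add: exp_add[symmetric])
  finally show ?thesis .
qed

text \<open>There are at most \<open>(exp 2 \<cdot> 4/mesh)\<^sup>m\<close> lattice points, each of which fails with probability at
  most \<open>(20 mesh/\<tau>)\<^sup>d \<le> (20 mesh/\<tau>)\<^sup>3\<^sup>m\<close>.  In the product the factors \<open>mesh\<close>
  combine to \<open>mesh\<^sup>2\<^sup>m\<close>, which beats the remaining constants.\<close>

lemma sign_prob_columns_incompressible:
  assumes m: "10 ^ 31 \<le> real m" and d: "3 * real m \<le> real d"
  shows "sign_prob ({..<m} \<times> {..<d})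
     (\<lambda>\<epsilon>. \<exists>v. (\<Sum>i<m. (v i)\<^sup>2) = real m \<and> (\<Sum>i<m. \<bar>v i\<bar>) \<ge> 1 / 400 * real m \<and>
        (\<Sum>j<d. (\<Sum>i<m. \<epsilon> (i, j) * v i)\<^sup>2) < mesh\<^sup>2 * real d * real m) \<le> exp (- real m / 48)"
proof -
  have T: "(\<Union>j\<in>{..<d}. (\<lambda>i. (i, j)) ` {..<m}) = {..<m} \<times> {..<d}" by auto
  have big: "4 / ((1 / 400)\<^sup>2 * mesh ^ 3) \<le> real m"
  proof -
    have "4 / ((1 / 400)\<^sup>2 * mesh ^ 3) \<le> (10 ^ 31 :: real)"
      by (simp add: mesh_def power2_eq_square power3_eq_cube)
    then show ?thesis using m by linarith
  qed
  have mesh: "0 < mesh" "mesh \<le> (1/400) / 4" by (simp_all add: mesh_def)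
  have "sign_prob ({..<m} \<times> {..<d})
     (\<lambda>\<epsilon>. \<exists>v. (\<Sum>i<m. (v i)\<^sup>2) = real m \<and> (\<Sum>i<m. \<bar>v i\<bar>) \<ge> 1 / 400 * real m \<and>
        (\<Sum>j<d. (\<Sum>i<m. \<epsilon> (i, j) * v i)\<^sup>2) < mesh\<^sup>2 * real d * real m)
     \<le> card (int_ball {..<m} (2 * real m / mesh)) * (20 * mesh / (1/400)) ^ d"
    using sign_prob_incompressible[of "{..<d}" "{..<m}" "\<lambda>j i. (i, j)" "1/400" mesh] big mesh
    unfolding T by (simp add: inj_on_def)
  also have "\<dots> \<le> (exp 2 * (4 / mesh)) ^ m * ((20 * mesh / (1/400)) ^ 3) ^ m"
  proof (intro mult_mono)
    define x where "x = exp (- mesh)"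
    have x: "0 < x" "x \<le> 1 - mesh / 2" "x \<le> 1"
    proof -
      have "x \<le> 1 - mesh + mesh\<^sup>2 / 2" unfolding x_def by (rule exp_minus_le_quadratic) (use mesh in simp)
      also have "\<dots> \<le> 1 - mesh / 2" by (simp add: mesh_def power2_eq_square)
      finally show "x \<le> 1 - mesh / 2" .
      then show "x \<le> 1" using mesh by linarith
    qed (simp add: x_def)
    have "(1 + x) / (1 - x) \<le> 2 / (mesh / 2)" using x mesh by (intro frac_le) auto
    then have r: "(1 + x) / (1 - x) \<le> 4 / mesh" by simp
    have "real (card (int_ball {..<m} (2 * real m / mesh))) \<le> exp (mesh * (2 * real m / mesh)) * ((1 + x) / (1 - x)) ^ card {..<m}"
      unfolding x_def by (rule card_int_ball_le(2)) (use mesh in auto)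
    also have "\<dots> = exp 2 ^ m * ((1 + x) / (1 - x)) ^ m"
      using mesh by (simp add: exp_of_nat_mult[symmetric] mult.commute)
    also have "\<dots> \<le> exp 2 ^ m * (4 / mesh) ^ m"
      using r x by (intro mult_left_mono power_mono) auto
    finally show "real (card (int_ball {..<m} (2 * real m / mesh))) \<le> (exp 2 * (4 / mesh)) ^ m"
      by (simp only: power_mult_distrib)
    have "(20 * mesh / (1/400)) ^ d \<le> (20 * mesh / (1/400)) ^ (3 * m)"
    proof (rule power_decreasing)
      show "3 * m \<le> d" using d by linarith
    qed (simp_all add: mesh_def)
    then show "(20 * mesh / (1/400)) ^ d \<le> ((20 * mesh / (1/400)) ^ 3) ^ m"
      by (simp only: power_mult)
  qed (use mesh in auto)
  also have "\<dots> = (exp 2 * (4 / mesh) * (20 * mesh / (1/400)) ^ 3) ^ m"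
    by (simp only: power_mult_distrib)
  also have "\<dots> \<le> exp (- 1) ^ m"
  proof (rule power_mono)
    have "exp (2::real) = exp 1 * exp 1" by (simp add: exp_add[symmetric])
    also have "\<dots> \<le> 3 * 3" using exp_one_bounds by (intro mult_mono) auto
    finally have e2: "exp (2::real) \<le> 9" by simp
    have "exp 2 * (4 / mesh) * (20 * mesh / (1/400)) ^ 3 \<le> 9 * (4 / mesh) * (20 * mesh / (1/400)) ^ 3"
      using e2 mesh by (intro mult_right_mono) auto
    also have "\<dots> \<le> 1 / 3" by (simp add: mesh_def power3_eq_cube)
    also have "\<dots> \<le> exp (- 1)" using exp_one_bounds by (simp add: exp_minus field_simps)
    finally show "exp 2 * (4 / mesh) * (20 * mesh / (1/400)) ^ 3 \<le> exp (- 1)" .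
  qed (use mesh in auto)
  also have "\<dots> = exp (- real m)" by (simp add: exp_of_nat_mult[symmetric])
  also have "\<dots> \<le> exp (- real m / 48)" by simp
  finally show ?thesis .
qed

text \<open>Every \<open>v\<close> is compressible or, after scaling to \<open>\<parallel>v\<parallel>\<^sub>2\<^sup>2 = m\<close>, spread out: the
  threshold \<open>1/400\<close> is below \<open>sqrt (1/144000)\<close>.\<close>

lemma sign_prob_not_transpose_bounded_below:
  assumes m: "10 ^ 31 \<le> real m" and d: "3 * real m \<le> real d"
  shows "sign_prob ({..<m} \<times> {..<d}) (\<lambda>\<epsilon>. \<not> transpose_bounded_below m d \<epsilon>) \<le> 2 * exp (- real m / 48)"
proof -
  have m0: "0 < m" "0 < real m" using m by (auto intro!: gr0I)
  let ?T = "{..<m} \<times> {..<d}"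
  let ?Q = "\<lambda>\<epsilon> v. \<Sum>j<d. (\<Sum>i<m. \<epsilon> (i, j) * v i)\<^sup>2"
  let ?A = "\<lambda>\<epsilon>. \<exists>v. (\<Sum>i<m. \<bar>v i\<bar>)\<^sup>2 \<le> real m / 144000 * (\<Sum>i<m. (v i)\<^sup>2) \<and> ?Q \<epsilon> v < real d / 32 * (\<Sum>i<m. (v i)\<^sup>2)"
  let ?B = "\<lambda>\<epsilon>. \<exists>v. (\<Sum>i<m. (v i)\<^sup>2) = real m \<and> (\<Sum>i<m. \<bar>v i\<bar>) \<ge> 1 / 400 * real m \<and> ?Q \<epsilon> v < mesh\<^sup>2 * real d * real m"
  have "sign_prob ?T (\<lambda>\<epsilon>. \<not> transpose_bounded_below m d \<epsilon>) \<le> sign_prob ?T (\<lambda>\<epsilon>. ?A \<epsilon> \<or> ?B \<epsilon>)"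
  proof (rule sign_prob_mono)
    fix \<epsilon> assume "\<not> transpose_bounded_below m d \<epsilon>"
    then obtain v where v: "?Q \<epsilon> v < mesh\<^sup>2 * real d * (\<Sum>i<m. (v i)\<^sup>2)"
      by (auto simp: transpose_bounded_below_def not_le)
    define N where "N = (\<Sum>i<m. (v i)\<^sup>2)"
    have "0 \<le> ?Q \<epsilon> v" by (simp add: sum_nonneg)
    then have "0 < mesh\<^sup>2 * real d * N" using v unfolding N_def by linarith
    moreover have "0 \<le> N" by (simp add: N_def sum_nonneg)
    ultimately have N: "N > 0" by (auto simp: zero_less_mult_iff)
    show "?A \<epsilon> \<or> ?B \<epsilon>"
    proof (cases "(\<Sum>i<m. \<bar>v i\<bar>)\<^sup>2 \<le> real m / 144000 * N")
      case True
      have "mesh\<^sup>2 * real d * N \<le> real d / 32 * N"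
        using N by (intro mult_right_mono) (auto simp: mesh_def power2_eq_square)
      then have "?Q \<epsilon> v < real d / 32 * N" using v unfolding N_def by linarith
      then show ?thesis using True unfolding N_def by blast
    next
      case False
      define c where "c = sqrt (real m / N)"
      have c: "0 < c" "c\<^sup>2 = real m / N" using N m0 by (auto simp: c_def)
      define u where "u i = c * v i" for i
      have u2: "(\<Sum>i<m. (u i)\<^sup>2) = real m"
        using N unfolding u_def power_mult_distrib sum_distrib_left[symmetric] c(2) N_def[symmetric] by simp
      have "(1 / 400 * real m)\<^sup>2 \<le> (\<Sum>i<m. \<bar>u i\<bar>)\<^sup>2"
      proof -
        have "(1 / 400 * real m)\<^sup>2 \<le> c\<^sup>2 * (real m / 144000 * N)"
          unfolding c(2) using N m0 by (simp add: power2_eq_square)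
        also have "\<dots> \<le> c\<^sup>2 * (\<Sum>i<m. \<bar>v i\<bar>)\<^sup>2"
          using False by (intro mult_left_mono) auto
        also have "\<dots> = (\<Sum>i<m. \<bar>u i\<bar>)\<^sup>2"
          using c by (simp add: u_def abs_mult sum_distrib_left[symmetric] power_mult_distrib)
        finally show ?thesis .
      qed
      then have "1 / 400 * real m \<le> (\<Sum>i<m. \<bar>u i\<bar>)"
        by (rule power2_le_imp_le) (simp add: sum_nonneg)
      moreover have "?Q \<epsilon> u < mesh\<^sup>2 * real d * real m"
      proof -
        have "?Q \<epsilon> u = c\<^sup>2 * ?Q \<epsilon> v" unfolding u_def by (rule sum_inner_scale)
        also have "\<dots> < c\<^sup>2 * (mesh\<^sup>2 * real d * N)"
          using v c(1) unfolding N_def by (intro mult_strict_left_mono) auto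
        also have "\<dots> = mesh\<^sup>2 * real d * real m" using N by (simp add: c(2))
        finally show ?thesis .
      qed
      ultimately show ?thesis using u2 by blast
    qed
  qed
  also have "\<dots> \<le> sign_prob ?T ?A + sign_prob ?T ?B" by (rule sign_prob_disj)
  also have "\<dots> \<le> exp (- real m / 48) + exp (- real m / 48)"
    by (intro add_mono sign_prob_columns_compressible[OF m0(1) d] sign_prob_columns_incompressible[OF m d])
  finally show ?thesis by simp
qed

lemma sign_prob_bad_matrix:
  assumes m: "10 ^ 31 \<le> real m" and d: "3 * real m \<le> real d"
  shows "sign_prob ({..<m} \<times> {..<d}) (\<lambda>\<epsilon>. \<not> (kernel_spread m d \<epsilon> \<and> transpose_bounded_below m d \<epsilon>))
    \<le> exp (- (1 / 96) * real m)"
proof -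
  have m0: "0 < m" using m by (auto intro!: gr0I)
  have "sign_prob ({..<m} \<times> {..<d}) (\<lambda>\<epsilon>. \<not> (kernel_spread m d \<epsilon> \<and> transpose_bounded_below m d \<epsilon>))
    \<le> sign_prob ({..<m} \<times> {..<d}) (\<lambda>\<epsilon>. \<not> kernel_spread m d \<epsilon> \<or> \<not> transpose_bounded_below m d \<epsilon>)"
    by (rule sign_prob_mono) auto
  also have "\<dots> \<le> sign_prob ({..<m} \<times> {..<d}) (\<lambda>\<epsilon>. \<not> kernel_spread m d \<epsilon>)
      + sign_prob ({..<m} \<times> {..<d}) (\<lambda>\<epsilon>. \<not> transpose_bounded_below m d \<epsilon>)"
    by (rule sign_prob_disj)
  also have "\<dots> \<le> exp (- real m / 48) + 2 * exp (- real m / 48)"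
    by (intro add_mono sign_prob_not_kernel_spread[OF m0 d] sign_prob_not_transpose_bounded_below[OF m d])
  also have "\<dots> = 3 * (exp (- (1 / 96) * real m) * exp (- (1 / 96) * real m))"
    by (simp add: exp_add[symmetric])
  also have "\<dots> \<le> 3 * (exp (- (1 / 96) * real m) * (1 / 3))"
  proof (intro mult_left_mono)
    have "3 \<le> exp (1 / 96 * real m)"
    proof -
      have "(192 :: real) \<le> 10 ^ 31" by simp
      then show ?thesis using exp_ge_add_one_self[of "1 / 96 * real m"] m by linarith
    qed
    then have "inverse (exp (1 / 96 * real m)) \<le> inverse 3" by (intro le_imp_inverse_le) auto
    then show "exp (- (1 / 96) * real m) \<le> 1 / 3" by (simp add: exp_minus)
  qed auto
  finally show ?thesis by simp
qed

section \<open>Linear systems and the null space property\<close>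

lemma scalar_prod_sum:
  assumes "a \<in> carrier_vec d" "x \<in> carrier_vec d"
  shows "a \<bullet> x = (\<Sum>j<d. a $ j * x $ j)"
  using assms by (simp add: scalar_prod_def atLeast0LessThan)

text \<open>The adjugate matrix gives the solution, since an injective square matrix has
  nonzero determinant.\<close>

lemma square_system_solvable:
  fixes M :: "nat \<Rightarrow> nat \<Rightarrow> real"
  assumes inj: "\<And>v. (\<forall>i<m. (\<Sum>k<m. M i k * v k) = 0) \<Longrightarrow> \<forall>i<m. v i = 0"
  shows "\<exists>v. \<forall>i<m. (\<Sum>k<m. M i k * v k) = y i"
proof -
  define A where "A = Matrix.mat m m (\<lambda>(i, k). M i k)"
  have A: "A \<in> carrier_mat m m" by (simp add: A_def)
  have Av: "(A *\<^sub>v v) $ i = (\<Sum>k<m. M i k * v $ k)" if "i < m" "v \<in> carrier_vec m" for v i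
    using that by (simp add: A_def scalar_prod_def atLeast0LessThan)
  have det: "Determinant.det A \<noteq> 0"
  proof
    assume "Determinant.det A = 0"
    then obtain v where v: "v \<in> carrier_vec m" "v \<noteq> 0\<^sub>v m" "A *\<^sub>v v = 0\<^sub>v m"
      using det_0_iff_vec_prod_zero_field[OF A] by auto
    have "\<forall>i<m. (\<Sum>k<m. M i k * v $ k) = 0"
      using v Av by (metis index_zero_vec(1))
    from inj[OF this] have "v = 0\<^sub>v m" using v(1) by (intro eq_vecI) auto
    with v(2) show False by simp
  qed
  define v where "v = (1 / Determinant.det A) \<cdot>\<^sub>v (adj_mat A *\<^sub>v Matrix.vec m y)"
  have v: "v \<in> carrier_vec m" using adj_mat(1)[OF A] by (simp add: v_def)
  have "A *\<^sub>v v = (1 / Determinant.det A) \<cdot>\<^sub>v (A *\<^sub>v (adj_mat A *\<^sub>v Matrix.vec m y))"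
    unfolding v_def using A adj_mat(1)[OF A] by (intro mult_mat_vec) auto
  also have "A *\<^sub>v (adj_mat A *\<^sub>v Matrix.vec m y) = (A * adj_mat A) *\<^sub>v Matrix.vec m y"
    using A adj_mat(1)[OF A] by (intro assoc_mult_mat_vec[symmetric]) auto
  also have "(A * adj_mat A) *\<^sub>v Matrix.vec m y = Determinant.det A \<cdot>\<^sub>v Matrix.vec m y"
    unfolding adj_mat(2)[OF A] by (intro eq_vecI) (auto simp: row_smult scalar_prod_left_unit)
  also have "(1 / Determinant.det A) \<cdot>\<^sub>v (Determinant.det A \<cdot>\<^sub>v Matrix.vec m y) = Matrix.vec m y"
    using det by (intro eq_vecI) auto
  finally have "A *\<^sub>v v = Matrix.vec m y" .
  then have "\<forall>i<m. (\<Sum>k<m. M i k * v $ k) = y i" using Av[OF _ v] by auto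
  then show ?thesis by (rule exI[of _ "\<lambda>k. v $ k"])
qed

lemma mesh_pos: "0 < mesh" by (simp add: mesh_def)

text \<open>The minimum norm solution \<open>u = A\<^sup>T (A A\<^sup>T)\<^sup>-\<^sup>1 y\<close>.  With \<open>v = (A A\<^sup>T)\<^sup>-\<^sup>1 y\<close> one has
  \<open>\<parallel>u\<parallel>\<^sub>2\<^sup>2 = \<langle>v, y\<rangle> \<le> \<parallel>v\<parallel>\<^sub>2 \<parallel>y\<parallel>\<^sub>2\<close> and \<open>mesh sqrt d \<parallel>v\<parallel>\<^sub>2 \<le> \<parallel>u\<parallel>\<^sub>2\<close>, hence \<open>mesh sqrt d \<parallel>u\<parallel>\<^sub>2 \<le> \<parallel>y\<parallel>\<^sub>2\<close>.\<close>

lemma l1_bounded_preimage: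
  assumes tb: "transpose_bounded_below m d \<epsilon>" and d: "0 < d"
  shows "\<exists>u. (\<forall>i<m. (\<Sum>j<d. \<epsilon> (i, j) * u j) = y i) \<and> (\<Sum>j<d. \<bar>u j\<bar>) \<le> sqrt (\<Sum>i<m. (y i)\<^sup>2) / mesh"
proof -
  define M where "M i k = (\<Sum>j<d. \<epsilon> (i, j) * \<epsilon> (k, j))" for i k
  define At where "At v j = (\<Sum>k<m. \<epsilon> (k, j) * v k)" for v j
  have M: "(\<Sum>k<m. M i k * v k) = (\<Sum>j<d. \<epsilon> (i, j) * At v j)" for i v
    unfolding M_def At_def sum_distrib_left sum_distrib_right by (subst sum.swap) (simp add: mult_ac)
  have quad: "(\<Sum>i<m. v i * (\<Sum>k<m. M i k * v k)) = (\<Sum>j<d. (At v j)\<^sup>2)" for v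
  proof -
    have "(\<Sum>i<m. v i * (\<Sum>k<m. M i k * v k)) = (\<Sum>i<m. \<Sum>j<d. v i * \<epsilon> (i, j) * At v j)"
      unfolding M sum_distrib_left by (simp add: mult_ac)
    also have "\<dots> = (\<Sum>j<d. \<Sum>i<m. v i * \<epsilon> (i, j) * At v j)" by (rule sum.swap)
    also have "\<dots> = (\<Sum>j<d. At v j * At v j)"
    proof (rule sum.cong[OF refl])
      fix j show "(\<Sum>i<m. v i * \<epsilon> (i, j) * At v j) = At v j * At v j"
        unfolding sum_distrib_right[symmetric] by (simp add: At_def mult.commute)
    qed
    finally show ?thesis by (simp add: power2_eq_square)
  qed
  have low: "mesh\<^sup>2 * real d * (\<Sum>i<m. (v i)\<^sup>2) \<le> (\<Sum>j<d. (At v j)\<^sup>2)" for v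
    using tb by (simp add: transpose_bounded_below_def At_def)
  have "\<exists>v. \<forall>i<m. (\<Sum>k<m. M i k * v k) = y i"
  proof (rule square_system_solvable)
    fix v assume "\<forall>i<m. (\<Sum>k<m. M i k * v k) = 0"
    then have "(\<Sum>j<d. (At v j)\<^sup>2) = 0" unfolding quad[symmetric] by simp
    then have "mesh\<^sup>2 * real d * (\<Sum>i<m. (v i)\<^sup>2) \<le> 0" using low[of v] by simp
    then have "(\<Sum>i<m. (v i)\<^sup>2) \<le> 0" using d mesh_pos by (simp add: mult_le_0_iff)
    then have "(\<Sum>i<m. (v i)\<^sup>2) = 0" by (simp add: antisym sum_nonneg)
    then show "\<forall>i<m. v i = 0" by (subst (asm) sum_nonneg_eq_0_iff) auto
  qed
  then obtain v where v: "\<And>i. i < m \<Longrightarrow> (\<Sum>k<m. M i k * v k) = y i" by blast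
  define V where "V = (\<Sum>i<m. (v i)\<^sup>2)"
  define Y where "Y = (\<Sum>i<m. (y i)\<^sup>2)"
  define U where "U = (\<Sum>j<d. (At v j)\<^sup>2)"
  have pos: "V \<ge> 0" "Y \<ge> 0" "U \<ge> 0" by (auto simp: V_def Y_def U_def sum_nonneg)
  have "U = (\<Sum>i<m. v i * y i)"
    unfolding U_def quad[symmetric] by (intro sum.cong) (auto simp: v)
  then have "U\<^sup>2 \<le> V * Y"
    using Cauchy_Schwarz_ineq_sum[of v y "{..<m}"] by (simp add: V_def Y_def)
  then have "mesh\<^sup>2 * real d * U\<^sup>2 \<le> mesh\<^sup>2 * real d * (V * Y)" by (intro mult_left_mono) auto
  also have "\<dots> \<le> U * Y"
    using mult_right_mono[OF low[of v] pos(2)] by (simp add: V_def U_def mult.assoc)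
  finally have "U * (mesh\<^sup>2 * real d * U) \<le> U * Y" by (simp add: power2_eq_square mult_ac)
  then have UY: "mesh\<^sup>2 * real d * U \<le> Y"
    using pos by (cases "U = 0") (auto simp: mult_le_cancel_left)
  have "(mesh * (\<Sum>j<d. \<bar>At v j\<bar>))\<^sup>2 \<le> mesh\<^sup>2 * (real d * U)"
    unfolding power_mult_distrib using sum_abs_squared_le[of "At v" "{..<d}"]
    by (intro mult_left_mono) (auto simp: U_def)
  also have "\<dots> \<le> Y" using UY by (simp add: mult.assoc)
  finally have "mesh * (\<Sum>j<d. \<bar>At v j\<bar>) \<le> sqrt Y" by (rule real_le_rsqrt)
  then have "(\<Sum>j<d. \<bar>At v j\<bar>) \<le> sqrt Y / mesh"
    using mesh_pos by (simp add: pos_le_divide_eq mult.commute)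
  moreover have "\<forall>i<m. (\<Sum>j<d. \<epsilon> (i, j) * At v j) = y i" using v unfolding M by simp
  ultimately show ?thesis unfolding Y_def by blast
qed

text \<open>A kernel vector has \<open>\<parallel>z\<parallel>\<^sub>2 \<le> \<parallel>z\<parallel>\<^sub>1 / sqrt \<kappa>\<close> with \<open>\<kappa> = m / (144000 ln(d/m))\<close>; by the Cauchy-Schwarz
  inequality its \<open>l\<^sub>1\<close>-norm on \<open>S\<close> is at most \<open>sqrt (card S / \<kappa>) \<parallel>z\<parallel>\<^sub>1\<close>.\<close>

lemma null_space_property:
  assumes ks: "kernel_spread m d \<epsilon>" and m: "0 < m"
    and ker: "\<And>i. i < m \<Longrightarrow> (\<Sum>j<d. \<epsilon> (i, j) * z j) = 0"
    and S: "S \<subseteq> {..<d}" "16 * real (card S) \<le> real m / (144000 * ln (real d / real m))"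
  shows "4 * (\<Sum>j\<in>S. \<bar>z j\<bar>) \<le> (\<Sum>j<d. \<bar>z j\<bar>)"
proof -
  define N where "N = (\<Sum>j<d. (z j)\<^sup>2)"
  let ?\<kappa> = "real m / (144000 * ln (real d / real m))"
  have N0: "N \<ge> 0" by (simp add: N_def sum_nonneg)
  have "?\<kappa> * N \<le> (\<Sum>j<d. \<bar>z j\<bar>)\<^sup>2"
  proof (rule ccontr)
    assume "\<not> ?thesis"
    then have lt: "(\<Sum>j<d. \<bar>z j\<bar>)\<^sup>2 < ?\<kappa> * N" by simp
    then have "real m / 32 * N \<le> (\<Sum>i<m. (\<Sum>j<d. \<epsilon> (i, j) * z j)\<^sup>2)"
      using ks unfolding kernel_spread_def N_def by (meson less_imp_le)
    also have "\<dots> = 0" using ker by simp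
    finally have "N = 0" using m N0 by (simp add: mult_le_0_iff)
    with lt show False by simp
  qed
  moreover have "(4 * (\<Sum>j\<in>S. \<bar>z j\<bar>))\<^sup>2 \<le> ?\<kappa> * N"
  proof -
    have "(\<Sum>j\<in>S. \<bar>z j\<bar>)\<^sup>2 \<le> real (card S) * (\<Sum>j\<in>S. (z j)\<^sup>2)" by (rule sum_abs_squared_le)
    also have "\<dots> \<le> real (card S) * N"
      unfolding N_def using S(1) by (intro mult_left_mono sum_mono2) auto
    finally have "16 * (\<Sum>j\<in>S. \<bar>z j\<bar>)\<^sup>2 \<le> 16 * (real (card S) * N)" by simp
    also have "\<dots> \<le> ?\<kappa> * N" using mult_right_mono[OF S(2) N0] by simp
    finally show ?thesis by (simp add: power_mult_distrib)
  qed
  ultimately have "(4 * (\<Sum>j\<in>S. \<bar>z j\<bar>))\<^sup>2 \<le> (\<Sum>j<d. \<bar>z j\<bar>)\<^sup>2" by linarith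
  then show ?thesis by (rule power2_le_imp_le) (simp add: sum_nonneg)
qed

text \<open>Going from \<open>X\<close> to \<open>W\<close> saves at most \<open>\<parallel>W - X\<parallel>\<^sub>1\<close> on \<open>S\<close>, and costs at least
  \<open>\<parallel>W - X\<parallel>\<^sub>1 - 2 \<parallel>X\<parallel>\<^sub>1\<close> on the complement.  As at most a quarter of the difference lies on \<open>S\<close> and
  the cost does not exceed the saving, the difference is small.\<close>

lemma l1_minimizer_error:
  fixes X W :: "nat \<Rightarrow> real"
  assumes min: "(\<Sum>j<d. \<bar>W j\<bar>) \<le> (\<Sum>j<d. \<bar>X j\<bar>)" and S: "S \<subseteq> {..<d}"
    and nsp: "4 * (\<Sum>j\<in>S. \<bar>W j - X j\<bar>) \<le> (\<Sum>j<d. \<bar>W j - X j\<bar>)"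
  shows "(\<Sum>j<d. \<bar>W j - X j\<bar>) \<le> 4 * (\<Sum>j\<in>{..<d} - S. \<bar>X j\<bar>)"
proof -
  let ?C = "{..<d} - S"
  have split: "(\<Sum>j<d. F j) = (\<Sum>j\<in>?C. F j) + (\<Sum>j\<in>S. F j)" for F :: "nat \<Rightarrow> real"
    using S by (intro sum.subset_diff) auto
  have "(\<Sum>j\<in>S. \<bar>X j\<bar> - \<bar>W j - X j\<bar>) \<le> (\<Sum>j\<in>S. \<bar>W j\<bar>)" by (intro sum_mono) auto
  moreover have "(\<Sum>j\<in>?C. \<bar>W j - X j\<bar> - \<bar>X j\<bar>) \<le> (\<Sum>j\<in>?C. \<bar>W j\<bar>)" by (intro sum_mono) auto
  ultimately show ?thesis
    using min nsp unfolding split sum_subtractf by linarith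
qed

lemma l1_normalize_error:
  fixes W a :: "nat \<Rightarrow> real"
  assumes a: "(\<Sum>j<d. \<bar>a j\<bar>) = 1" and g: "\<gamma> > 0" and W: "l = (\<Sum>j<d. \<bar>W j\<bar>)" "l > 0"
  shows "(\<Sum>j<d. \<bar>W j / l - a j\<bar>) \<le> 2 * (\<Sum>j<d. \<bar>W j - \<gamma> * a j\<bar>) / l"
proof -
  let ?D = "\<Sum>j<d. \<bar>W j - \<gamma> * a j\<bar>"
  have ga: "(\<Sum>j<d. \<bar>\<gamma> * a j\<bar>) = \<gamma>"
    using a g by (simp add: abs_mult sum_distrib_left[symmetric])
  have "\<bar>l - \<gamma>\<bar> = \<bar>\<Sum>j<d. \<bar>W j\<bar> - \<bar>\<gamma> * a j\<bar>\<bar>"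
    unfolding sum_subtractf ga W(1) ..
  also have "\<dots> \<le> (\<Sum>j<d. \<bar>\<bar>W j\<bar> - \<bar>\<gamma> * a j\<bar>\<bar>)" by (rule sum_abs)
  also have "\<dots> \<le> ?D" by (intro sum_mono) auto
  finally have lg: "\<bar>l - \<gamma>\<bar> \<le> ?D" .
  have "(\<Sum>j<d. \<bar>W j / l - a j\<bar>) = (\<Sum>j<d. \<bar>W j - l * a j\<bar>) / l"
  proof -
    have "\<bar>W j / l - a j\<bar> = \<bar>W j - l * a j\<bar> / l" for j
    proof -
      have "W j / l - a j = (W j - l * a j) / l" using W(2) by (simp add: field_simps)
      then show ?thesis using W(2) by (simp add: abs_divide)
    qed
    then show ?thesis by (simp add: sum_divide_distrib)
  qed
  also have "(\<Sum>j<d. \<bar>W j - l * a j\<bar>) \<le> (\<Sum>j<d. \<bar>W j - \<gamma> * a j\<bar> + \<bar>l - \<gamma>\<bar> * \<bar>a j\<bar>)"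
  proof (rule sum_mono)
    fix j
    have "W j - l * a j = (W j - \<gamma> * a j) - (l - \<gamma>) * a j" by (simp add: algebra_simps)
    then show "\<bar>W j - l * a j\<bar> \<le> \<bar>W j - \<gamma> * a j\<bar> + \<bar>l - \<gamma>\<bar> * \<bar>a j\<bar>"
      using abs_triangle_ineq4[of "W j - \<gamma> * a j" "(l - \<gamma>) * a j"] by (simp add: abs_mult)
  qed
  also have "\<dots> = ?D + \<bar>l - \<gamma>\<bar>"
    unfolding sum.distrib sum_distrib_left[symmetric] a by simp
  also have "\<dots> \<le> 2 * ?D" using lg by simp
  finally show ?thesis using W(2) by (simp add: divide_right_mono)
qed

lemma linearization_error:
  fixes g g' :: "real \<Rightarrow> real"
  assumes der: "\<forall>t\<in>{-1..1}. (g has_real_derivative g' t) (at t within {-1..1})"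
    and lip: "\<forall>t1\<in>{-1..1}. \<forall>t2\<in>{-1..1}. \<bar>g' t1 - g' t2\<bar> \<le> c1 * \<bar>t1 - t2\<bar>"
    and c1: "c1 \<ge> 0" and x: "\<bar>x\<bar> \<le> 1"
  shows "\<bar>g x - g 0 - g' 0 * x\<bar> \<le> c1 * x\<^sup>2"
proof -
  let ?S = "{- \<bar>x\<bar>..\<bar>x\<bar>}"
  have "norm ((g x - g' 0 * x) - (g 0 - g' 0 * 0)) \<le> (c1 * \<bar>x\<bar>) * norm (x - 0)"
  proof (rule field_differentiable_bound[where S = ?S and f' = "\<lambda>t. g' t - g' 0"])
    fix t assume t: "t \<in> ?S"
    then have t1: "t \<in> {-1..1}" using x by auto
    have "(g has_real_derivative g' t) (at t within ?S)"
      using der[rule_format, OF t1] by (rule DERIV_subset) (use x in auto)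
    then show "((\<lambda>t. g t - g' 0 * t) has_real_derivative g' t - g' 0) (at t within ?S)"
      by (auto intro!: derivative_eq_intros)
    have "\<bar>g' t - g' 0\<bar> \<le> c1 * \<bar>t\<bar>" using lip[rule_format, OF t1, of 0] by simp
    also have "\<dots> \<le> c1 * \<bar>x\<bar>" using t c1 by (intro mult_left_mono) auto
    finally show "norm (g' t - g' 0) \<le> c1 * \<bar>x\<bar>" by simp
  qed auto
  then show ?thesis by (simp add: power2_eq_square algebra_simps)
qed

section \<open>Ridge functions\<close>

lemma l1_norm_nonneg: "0 \<le> l1_norm x"
  by (simp add: l1_norm_def sum_nonneg)

lemma abs_scalar_prod_le_l1:
  assumes "w \<in> carrier_vec d" "x \<in> carrier_vec d" and "\<And>j. j < d \<Longrightarrow> \<bar>x $ j\<bar> \<le> B"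
  shows "\<bar>w \<bullet> x\<bar> \<le> B * l1_norm w"
proof -
  have "\<bar>w \<bullet> x\<bar> \<le> (\<Sum>j<d. \<bar>w $ j * x $ j\<bar>)"
    unfolding scalar_prod_sum[OF assms(1,2)] by (rule sum_abs)
  also have "\<dots> \<le> (\<Sum>j<d. \<bar>w $ j\<bar> * B)"
    unfolding abs_mult using assms(3) by (intro sum_mono mult_left_mono) auto
  also have "\<dots> = B * l1_norm w"
    using assms(1) by (simp add: l1_norm_def sum_distrib_left mult.commute)
  finally show ?thesis .
qed

lemma scalar_prod_sign_vec:
  assumes "w \<in> carrier_vec d"
  shows "w \<bullet> sign_vec w = l1_norm w"
proof -
  have "w $ j * sgn (w $ j) = \<bar>w $ j\<bar>" for j by (simp add: sgn_if)
  then show ?thesis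
    using assms by (simp add: scalar_prod_sum[of _ d] sign_vec_def l1_norm_def)
qed

text \<open>With \<open>1 = \<langle>w, sign w\<rangle>\<close>, the arguments of \<open>g\<close> differ by
  \<open>\<langle>w - a, x\<rangle>\<close> and \<open>\<langle>w, x\<rangle> \<langle>w - a, sign w\<rangle>\<close>, up to sign; each is at most \<open>\<parallel>w - a\<parallel>\<^sub>1\<close>.\<close>

lemma sup_norm_reconstruction_le:
  assumes a: "a \<in> carrier_vec d" "l1_norm a = 1" and w: "w \<in> carrier_vec d" "l1_norm w = 1"
    and lip: "\<forall>t1\<in>{-1..1}. \<forall>t2\<in>{-1..1}. \<bar>g t1 - g t2\<bar> \<le> c0 * \<bar>t1 - t2\<bar>"
    and c0: "c0 \<ge> 0"
  shows "sup_norm_cube d (\<lambda>x. ridge g a x - reconstruction (ridge g a) w x) \<le> 2 * c0 * l1_norm (w - a)"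
  unfolding sup_norm_cube_def
proof (rule cSUP_least)
  show "unit_cube d \<noteq> {}" unfolding unit_cube_def by (auto intro!: exI[of _ "0\<^sub>v d"])
  fix x assume "x \<in> unit_cube d"
  then have x: "x \<in> carrier_vec d" "\<And>j. j < d \<Longrightarrow> \<bar>x $ j\<bar> \<le> 1" by (auto simp: unit_cube_def)
  let ?s = "sign_vec w"
  have s: "?s \<in> carrier_vec d" "\<And>j. j < d \<Longrightarrow> \<bar>?s $ j\<bar> \<le> 1"
    using w(1) by (auto simp: sign_vec_def sgn_if)
  have wa: "w - a \<in> carrier_vec d" using w a by simp
  have "\<bar>a \<bullet> x\<bar> \<le> 1" "\<bar>w \<bullet> x\<bar> \<le> 1" "\<bar>a \<bullet> ?s\<bar> \<le> 1"
    using abs_scalar_prod_le_l1[OF a(1) x] abs_scalar_prod_le_l1[OF w(1) x] abs_scalar_prod_le_l1[OF a(1) s] a w by auto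
  note bd = this
  have ts: "a \<bullet> ((w \<bullet> x) \<cdot>\<^sub>v ?s) = (w \<bullet> x) * (a \<bullet> ?s)" using a s by (simp add: scalar_prod_smult_distrib)
  have bts: "\<bar>(w \<bullet> x) * (a \<bullet> ?s)\<bar> \<le> 1" using bd by (simp add: abs_mult mult_le_one)
  have "(w - a) \<bullet> x = w \<bullet> x - a \<bullet> x" "(w - a) \<bullet> ?s = w \<bullet> ?s - a \<bullet> ?s"
    using w a x s by (simp_all add: minus_scalar_prod_distrib)
  then have eq: "a \<bullet> x - (w \<bullet> x) * (a \<bullet> ?s) = - ((w - a) \<bullet> x) + (w \<bullet> x) * ((w - a) \<bullet> ?s)"
    using scalar_prod_sign_vec[OF w(1)] w(2) by (simp add: right_diff_distrib)
  have "\<bar>a \<bullet> x - (w \<bullet> x) * (a \<bullet> ?s)\<bar> \<le> \<bar>(w - a) \<bullet> x\<bar> + \<bar>w \<bullet> x\<bar> * \<bar>(w - a) \<bullet> ?s\<bar>"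
    unfolding eq abs_mult[symmetric] by linarith
  also have "\<dots> \<le> l1_norm (w - a) + 1 * l1_norm (w - a)"
    using abs_scalar_prod_le_l1[OF wa x] abs_scalar_prod_le_l1[OF wa s] bd(2) l1_norm_nonneg
    by (intro add_mono mult_mono) auto
  finally have diff: "\<bar>a \<bullet> x - (w \<bullet> x) * (a \<bullet> ?s)\<bar> \<le> 2 * l1_norm (w - a)" by simp
  have "\<bar>ridge g a x - reconstruction (ridge g a) w x\<bar> = \<bar>g (a \<bullet> x) - g ((w \<bullet> x) * (a \<bullet> ?s))\<bar>"
    by (simp add: ridge_def reconstruction_def ts)
  also have "\<dots> \<le> c0 * \<bar>a \<bullet> x - (w \<bullet> x) * (a \<bullet> ?s)\<bar>"
    using bd bts by (intro lip[rule_format]) (auto simp: abs_le_iff)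
  also have "\<dots> \<le> c0 * (2 * l1_norm (w - a))" using diff c0 by (rule mult_left_mono)
  finally show "\<bar>ridge g a x - reconstruction (ridge g a) w x\<bar> \<le> 2 * c0 * l1_norm (w - a)" by simp
qed

lemma best_approx_error_greatest:
  assumes "a \<in> carrier_vec d"
    and "\<And>w. w \<in> carrier_vec d \<Longrightarrow> sparse s w \<Longrightarrow> B \<le> l1_norm (a - w)"
  shows "B \<le> best_approx_error s a"
  unfolding best_approx_error_def
proof (rule cINF_greatest)
  have "{i. i < d \<and> 0\<^sub>v d $ i \<noteq> (0::real)} = {}" by auto
  then have "sparse s (0\<^sub>v d)" by (simp only: sparse_def index_zero_vec card.empty)
  then show "{z \<in> carrier_vec (dim_vec a). sparse s z} \<noteq> {}"
    using assms(1) by (auto intro!: exI[of _ "0\<^sub>v d"])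
qed (use assms in auto)

lemma best_approx_error_nonneg:
  assumes "a \<in> carrier_vec d"
  shows "0 \<le> best_approx_error s a"
  by (rule best_approx_error_greatest[OF assms l1_norm_nonneg])

text \<open>If the error bound \<open>M (\<gamma> \<sigma> + h)\<close> is below \<open>\<gamma>/2\<close> then the minimizer has norm
  at least \<open>\<gamma>/2\<close> and normalizing is harmless.  Otherwise the right-hand side is at least 2, which bounds
  the distance of any two unit vectors.\<close>

lemma relative_error_bound:
  fixes \<gamma> \<sigma> h c1 M l \<Delta> E :: real
  assumes "\<gamma> > 0" "\<sigma> \<ge> 0" "h > 0" "c1 > 0" and M: "M > 0" "\<Delta> \<le> M * (\<gamma> * \<sigma> + h)"
    and den: "\<gamma> * (1 - \<sigma>) - c1 * h > 0" and l: "l > 0" "\<gamma> - \<Delta> \<le> l"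
    and E: "E \<le> 2" "E \<le> 2 * \<Delta> / l"
  shows "E \<le> 4 * M * ((\<gamma> * \<sigma> + h) / (\<gamma> * (1 - \<sigma>) - c1 * h))"
proof -
  define G where "G = \<gamma> * \<sigma> + h"
  define D where "D = \<gamma> * (1 - \<sigma>) - c1 * h"
  have G: "G > 0" using assms by (simp add: G_def add_nonneg_pos)
  have "0 \<le> \<gamma> * \<sigma>" "0 \<le> c1 * h" using assms by auto
  then have D: "D > 0" "D \<le> \<gamma>"
    using den by (auto simp: D_def right_diff_distrib)
  show ?thesis
  proof (cases "2 * M * G \<ge> \<gamma>")
    case True
    then have "1 \<le> 2 * M * G / D" using D by (simp add: pos_le_divide_eq)
    then have "2 \<le> 4 * M * (G / D)" by simp
    then show ?thesis using E(1) unfolding G_def D_def by linarith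
  next
    case False
    then have "\<gamma> / 2 \<le> l" using M(2) l(2) unfolding G_def by linarith
    have "E \<le> 2 * \<Delta> / l" by (rule E(2))
    also have "\<dots> \<le> 2 * (M * G) / l" using M(2) l(1) unfolding G_def by (intro divide_right_mono) auto
    also have "\<dots> \<le> 2 * (M * G) / (D / 2)"
      using \<open>\<gamma> / 2 \<le> l\<close> D M G by (intro divide_left_mono) auto
    also have "\<dots> = 4 * M * (G / D)" by simp
    finally show ?thesis unfolding G_def D_def .
  qed
qed

definition scaled_matrix :: "nat \<Rightarrow> nat \<Rightarrow> (nat \<times> nat \<Rightarrow> real) \<Rightarrow> real mat" where
  "scaled_matrix m d \<epsilon> = Matrix.mat m d (\<lambda>ij. \<epsilon> ij / sqrt (real m))"

lemma bernoulli_matrix_eq: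
  assumes "0 < m"
  shows "bernoulli_matrix m d =
    map_pmf (scaled_matrix m d) (Pi_pmf ({..<m} \<times> {..<d}) 0 (\<lambda>_. pmf_of_set {1, -1}))"
proof -
  let ?f = "\<lambda>x. x / sqrt (real m)"
  have "map_pmf ?f (pmf_of_set {1, -1}) = pmf_of_set (?f ` {1, -1})"
    using assms by (intro map_pmf_of_set_inj) (auto simp: inj_on_def)
  then have "pmf_of_set {1 / sqrt (real m), - 1 / sqrt (real m)} = map_pmf ?f (pmf_of_set {1, -1})"
    by simp
  then have "Pi_pmf ({..<m} \<times> {..<d}) 0 (\<lambda>_. pmf_of_set {1 / sqrt (real m), - 1 / sqrt (real m)})
    = map_pmf (\<lambda>\<epsilon>. ?f \<circ> \<epsilon>) (Pi_pmf ({..<m} \<times> {..<d}) 0 (\<lambda>_. pmf_of_set {1, -1}))"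
    by (simp only:) (rule Pi_pmf_map, auto)
  then show ?thesis
    by (simp add: bernoulli_matrix_def map_pmf_comp scaled_matrix_def[abs_def] comp_def)
qed

lemma feasible_scaled_matrix_iff:
  assumes m: "0 < m" and b: "b \<in> carrier_vec m"
  shows "feasible (scaled_matrix m d \<epsilon>) b w \<longleftrightarrow>
    w \<in> carrier_vec d \<and> (\<forall>i<m. (\<Sum>j<d. \<epsilon> (i, j) * w $ j) = sqrt (real m) * b $ i)"
proof (cases "w \<in> carrier_vec d")
  case True
  have "(scaled_matrix m d \<epsilon> *\<^sub>v w) $ i = (\<Sum>j<d. \<epsilon> (i, j) * w $ j) / sqrt (real m)" if "i < m" for i
    using that True by (simp add: scaled_matrix_def scalar_prod_def atLeast0LessThan sum_divide_distrib)
  then have "scaled_matrix m d \<epsilon> *\<^sub>v w = b \<longleftrightarrow> (\<forall>i<m. (\<Sum>j<d. \<epsilon> (i, j) * w $ j) / sqrt (real m) = b $ i)"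
    using b by (auto simp: vec_eq_iff scaled_matrix_def)
  then show ?thesis
    using True m by (simp add: feasible_def scaled_matrix_def divide_eq_eq mult.commute)
qed (simp add: feasible_def scaled_matrix_def)

text \<open>The deterministic core.  The minimizer is compared with
  \<open>X = g'(0) a + u\<close>, which satisfies the constraints exactly.  The part \<open>u\<close> enters the error once through
  \<open>X - g'(0) a\<close> and four times through the \<open>l\<^sub>1\<close>-mass of \<open>X\<close> outside the support of a sparse vector,
  which explains the constant 5.\<close>

lemma recovery_on_good_matrix:
  fixes g g' :: "real \<Rightarrow> real"
  assumes m: "0 < m" and d: "0 < d" and h: "0 < h" "h \<le> sqrt (real m)"
    and a: "a \<in> carrier_vec d" "l1_norm a = 1"
    and der: "\<forall>t\<in>{-1..1}. (g has_real_derivative g' t) (at t within {-1..1})"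
    and lip: "\<forall>t1\<in>{-1..1}. \<forall>t2\<in>{-1..1}. \<bar>g' t1 - g' t2\<bar> \<le> c1 * \<bar>t1 - t2\<bar>"
    and c1: "c1 > 0" and g0: "g' 0 > 0"
    and s: "16 * real s \<le> real m / (144000 * ln (real d / real m))"
    and den: "g' 0 * (1 - best_approx_error s a) - c1 * h > 0"
    and eps: "\<epsilon> \<in> signs ({..<m} \<times> {..<d})"
    and ks: "kernel_spread m d \<epsilon>" and tb: "transpose_bounded_below m d \<epsilon>"
    and b: "b = measurements (ridge g a) h (scaled_matrix m d \<epsilon>)"
  shows "\<exists>w. feasible (scaled_matrix m d \<epsilon>) b w"
    and "l1_solution (scaled_matrix m d \<epsilon>) b w \<Longrightarrow> w \<noteq> 0\<^sub>v d \<Longrightarrow>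
      l1_normalize w \<in> carrier_vec d \<and> l1_norm (l1_normalize w) = 1 \<and>
      l1_norm (l1_normalize w - a) \<le> 4 * (4 + 5 * c1 / mesh) *
        ((g' 0 * best_approx_error s a + h) / (g' 0 * (1 - best_approx_error s a) - c1 * h))"
proof -
  let ?\<Phi> = "scaled_matrix m d \<epsilon>" and ?r = "sqrt (real m)" and ?\<sigma> = "best_approx_error s a"
  have r: "?r > 0" using m by simp
  have rr: "?r * ?r = real m" by simp
  have b_dim: "b \<in> carrier_vec m" by (simp add: b measurements_def scaled_matrix_def)
  have a1: "(\<Sum>j<d. \<bar>a $ j\<bar>) = 1" using a by (simp add: l1_norm_def)
  define t where "t i = (\<Sum>j<d. \<epsilon> (i, j) * a $ j) / ?r" for i
  have row: "a \<bullet> (h \<cdot>\<^sub>v Matrix.row ?\<Phi> i) = h * t i" if "i < m" for i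
  proof -
    have "a \<bullet> (h \<cdot>\<^sub>v Matrix.row ?\<Phi> i) = (\<Sum>j<d. a $ j * (h * (\<epsilon> (i, j) / ?r)))"
      using that a by (subst scalar_prod_sum[where d = d]) (auto simp: scaled_matrix_def)
    then show ?thesis
      by (simp add: t_def sum_distrib_left sum_divide_distrib mult_ac)
  qed
  have bi: "b $ i = (g (h * t i) - g 0) / h" if "i < m" for i
  proof -
    have "b $ i = (g (a \<bullet> (h \<cdot>\<^sub>v Matrix.row ?\<Phi> i)) - g (a \<bullet> 0\<^sub>v d)) / h"
      using that unfolding b measurements_def ridge_def by (simp add: scaled_matrix_def)
    then show ?thesis unfolding row[OF that] using a by simp
  qed
  have tb1: "\<bar>t i\<bar> \<le> 1 / ?r" if "i < m" for i
  proof -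
    have e1: "\<bar>\<epsilon> (i, j)\<bar> = 1" if "j < d" for j
    proof -
      have "(i, j) \<in> {..<m} \<times> {..<d}" using that \<open>i < m\<close> by simp
      then have "\<epsilon> (i, j) \<in> {1, -1}" using eps unfolding signs_def PiE_dflt_def by blast
      then show ?thesis by auto
    qed
    have "\<bar>\<Sum>j<d. \<epsilon> (i, j) * a $ j\<bar> \<le> (\<Sum>j<d. \<bar>\<epsilon> (i, j) * a $ j\<bar>)" by (rule sum_abs)
    also have "\<dots> = (\<Sum>j<d. \<bar>a $ j\<bar>)" by (intro sum.cong) (auto simp: abs_mult e1)
    also have "\<dots> = 1" by (rule a1)
    finally show ?thesis using r by (simp add: t_def abs_divide divide_right_mono)
  qed
  define y where "y i = ?r * (b $ i - g' 0 * t i)" for i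
  have yb: "\<bar>y i\<bar> \<le> c1 * h / ?r" if i: "i < m" for i
  proof -
    have "\<bar>h * t i\<bar> \<le> h * (1 / ?r)" using mult_left_mono[OF tb1[OF i], of h] h by (simp add: abs_mult)
    also have "\<dots> \<le> 1" using h r by simp
    finally have ht: "\<bar>h * t i\<bar> \<le> 1" .
    have "b $ i - g' 0 * t i = (g (h * t i) - g 0 - g' 0 * (h * t i)) / h"
      using h by (simp add: bi[OF i] field_simps)
    then have "\<bar>y i\<bar> = ?r * (\<bar>g (h * t i) - g 0 - g' 0 * (h * t i)\<bar> / h)"
      using h r by (simp add: y_def abs_mult abs_divide)
    also have "\<dots> \<le> ?r * (c1 * (h * t i)\<^sup>2 / h)"
      using linearization_error[OF der lip _ ht] c1 h r by (intro mult_left_mono divide_right_mono) auto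
    also have "\<dots> = ?r * (c1 * h * (t i)\<^sup>2)" using h by (simp add: power2_eq_square)
    also have "\<dots> \<le> ?r * (c1 * h * (1 / ?r)\<^sup>2)"
    proof (intro mult_left_mono)
      show "(t i)\<^sup>2 \<le> (1 / ?r)\<^sup>2" using power_mono[OF tb1[OF i], of 2] by simp
    qed (use c1 h r in auto)
    also have "\<dots> = c1 * h / ?r"
    proof -
      have "x * (k * (1 / x)\<^sup>2) = k / x" if "x > 0" for x k :: real
        using that by (simp add: power2_eq_square)
      from this[OF r] show ?thesis .
    qed
    finally show ?thesis .
  qed
  have y2: "(\<Sum>i<m. (y i)\<^sup>2) \<le> (c1 * h)\<^sup>2"
  proof -
    have "(y i)\<^sup>2 \<le> (c1 * h)\<^sup>2 / real m" if "i < m" for i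
      using power_mono[OF yb[OF that], of 2] by (simp add: power_divide)
    then have "(\<Sum>i<m. (y i)\<^sup>2) \<le> (\<Sum>i<m. (c1 * h)\<^sup>2 / real m)" by (intro sum_mono) auto
    then show ?thesis using m by simp
  qed
  obtain u where u: "\<And>i. i < m \<Longrightarrow> (\<Sum>j<d. \<epsilon> (i, j) * u j) = y i"
      "(\<Sum>j<d. \<bar>u j\<bar>) \<le> sqrt (\<Sum>i<m. (y i)\<^sup>2) / mesh"
    using l1_bounded_preimage[OF tb d, of y] by blast
  have "sqrt (\<Sum>i<m. (y i)\<^sup>2) \<le> c1 * h" using y2 c1 h by (intro real_le_lsqrt) auto
  then have u1: "(\<Sum>j<d. \<bar>u j\<bar>) \<le> c1 * h / mesh"
    using u(2) mesh_pos by (meson divide_right_mono less_imp_le order_trans)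
  define X where "X j = g' 0 * a $ j + u j" for j
  have X: "(\<Sum>j<d. \<epsilon> (i, j) * X j) = ?r * b $ i" if i: "i < m" for i
  proof -
    have "(\<Sum>j<d. \<epsilon> (i, j) * X j) = g' 0 * (\<Sum>j<d. \<epsilon> (i, j) * a $ j) + (\<Sum>j<d. \<epsilon> (i, j) * u j)"
      by (simp add: X_def sum_distrib_left sum.distrib[symmetric] algebra_simps)
    also have "(\<Sum>j<d. \<epsilon> (i, j) * a $ j) = ?r * t i" using r by (simp add: t_def)
    finally show ?thesis unfolding u(1)[OF i] y_def by (simp add: algebra_simps)
  qed
  have feasX: "feasible ?\<Phi> b (Matrix.vec d X)"
    using X by (simp add: feasible_scaled_matrix_iff[OF m b_dim])
  then show "\<exists>w. feasible ?\<Phi> b w" by blast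
  assume sol: "l1_solution ?\<Phi> b w" and w0: "w \<noteq> 0\<^sub>v d"
  have feas: "feasible ?\<Phi> b w" and min: "l1_norm w \<le> l1_norm (Matrix.vec d X)"
    using sol feasX by (auto simp: l1_solution_def is_arg_min_linorder)
  have w: "w \<in> carrier_vec d" and wb: "\<And>i. i < m \<Longrightarrow> (\<Sum>j<d. \<epsilon> (i, j) * w $ j) = ?r * b $ i"
    using feas by (auto simp: feasible_scaled_matrix_iff[OF m b_dim])
  have min': "(\<Sum>j<d. \<bar>w $ j\<bar>) \<le> (\<Sum>j<d. \<bar>X j\<bar>)" using min w by (simp add: l1_norm_def)
  have ker: "(\<Sum>j<d. \<epsilon> (i, j) * (w $ j - X j)) = 0" if "i < m" for i
    using wb[OF that] X[OF that] by (simp add: right_diff_distrib sum_subtractf)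
  define \<Delta> where "\<Delta> = (\<Sum>j<d. \<bar>w $ j - g' 0 * a $ j\<bar>)"
  have main: "\<Delta> \<le> 4 * (g' 0 * l1_norm (a - v)) + 5 * (c1 * h / mesh)"
    if v: "v \<in> carrier_vec d" "sparse s v" for v
  proof -
    define S where "S = {i. i < d \<and> v $ i \<noteq> 0}"
    have S: "S \<subseteq> {..<d}" and cS: "card S \<le> s" using v by (auto simp: S_def sparse_def)
    have "16 * real (card S) \<le> real m / (144000 * ln (real d / real m))" using s cS by linarith
    from null_space_property[OF ks m ker S this]
    have "(\<Sum>j<d. \<bar>w $ j - X j\<bar>) \<le> 4 * (\<Sum>j\<in>{..<d} - S. \<bar>X j\<bar>)"
      by (rule l1_minimizer_error[OF min' S])
    also have "(\<Sum>j\<in>{..<d} - S. \<bar>X j\<bar>) \<le> (\<Sum>j\<in>{..<d} - S. g' 0 * \<bar>(a - v) $ j\<bar> + \<bar>u j\<bar>)"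
    proof (rule sum_mono)
      fix j assume "j \<in> {..<d} - S"
      then have "(a - v) $ j = a $ j" using a v by (auto simp: S_def)
      then show "\<bar>X j\<bar> \<le> g' 0 * \<bar>(a - v) $ j\<bar> + \<bar>u j\<bar>"
        using abs_triangle_ineq[of "g' 0 * a $ j" "u j"] g0 by (simp add: X_def abs_mult)
    qed
    also have "\<dots> \<le> (\<Sum>j<d. g' 0 * \<bar>(a - v) $ j\<bar> + \<bar>u j\<bar>)"
      using g0 by (intro sum_mono2) auto
    also have "\<dots> = g' 0 * l1_norm (a - v) + (\<Sum>j<d. \<bar>u j\<bar>)"
      using a v by (simp add: l1_norm_def sum.distrib sum_distrib_left)
    finally have "(\<Sum>j<d. \<bar>w $ j - X j\<bar>) \<le> 4 * (g' 0 * l1_norm (a - v)) + 4 * (\<Sum>j<d. \<bar>u j\<bar>)"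
      by simp
    moreover have "\<Delta> \<le> (\<Sum>j<d. \<bar>w $ j - X j\<bar> + \<bar>u j\<bar>)"
      unfolding \<Delta>_def by (intro sum_mono) (auto simp: X_def)
    ultimately show ?thesis using u1 by (simp add: sum.distrib)
  qed
  \<comment> \<open>the estimate holds for every sparse v, so it passes to the infimum that defines the best approximation error\<close>
  have "(\<Delta> - 5 * (c1 * h / mesh)) / (4 * g' 0) \<le> ?\<sigma>"
  proof (rule best_approx_error_greatest[OF a(1)])
    fix v assume "v \<in> carrier_vec d" "sparse s v"
    from main[OF this] show "(\<Delta> - 5 * (c1 * h / mesh)) / (4 * g' 0) \<le> l1_norm (a - v)"
      using g0 by (simp add: pos_divide_le_eq mult_ac)
  qed
  then have D1: "\<Delta> \<le> 4 * (g' 0 * ?\<sigma>) + 5 * (c1 * h / mesh)"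
    using g0 by (simp add: pos_divide_le_eq mult_ac)
  have sig0: "?\<sigma> \<ge> 0" by (rule best_approx_error_nonneg[OF a(1)])
  define M where "M = 4 + 5 * c1 / mesh"
  have cm: "0 \<le> 5 * c1 / mesh" using c1 mesh_pos by simp
  have DM: "\<Delta> \<le> M * (g' 0 * ?\<sigma> + h)"
  proof -
    have "0 \<le> 5 * c1 / mesh * (g' 0 * ?\<sigma>)" "0 \<le> 4 * h"
      using mult_nonneg_nonneg[OF cm, of "g' 0 * ?\<sigma>"] g0 sig0 h by (simp_all only: mult_nonneg_nonneg less_imp_le zero_le_numeral)
    moreover have "M * (g' 0 * ?\<sigma> + h) = 4 * (g' 0 * ?\<sigma>) + 5 * (c1 * h / mesh) + 5 * c1 / mesh * (g' 0 * ?\<sigma>) + 4 * h"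
      by (simp add: M_def algebra_simps add_divide_distrib)
    ultimately show ?thesis using D1 by linarith
  qed
  define l where "l = (\<Sum>j<d. \<bar>w $ j\<bar>)"
  have lw: "l1_norm w = l" using w by (simp add: l_def l1_norm_def)
  have l: "l > 0"
  proof (rule ccontr)
    assume "\<not> l > 0"
    then have "l = 0" using l1_norm_nonneg[of w] lw by simp
    then have "\<forall>j<d. w $ j = 0" unfolding l_def by (subst (asm) sum_nonneg_eq_0_iff) auto
    then have "w = 0\<^sub>v d" using w by (intro eq_vecI) auto
    with w0 show False by simp
  qed
  have lD: "g' 0 - \<Delta> \<le> l"
  proof -
    have "g' 0 = (\<Sum>j<d. \<bar>g' 0 * a $ j\<bar>)" using a1 g0 by (simp add: abs_mult sum_distrib_left[symmetric])
    also have "\<dots> \<le> (\<Sum>j<d. \<bar>w $ j - g' 0 * a $ j\<bar> + \<bar>w $ j\<bar>)" by (intro sum_mono) auto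
    finally show ?thesis by (simp add: sum.distrib \<Delta>_def l_def)
  qed
  have nw: "l1_normalize w \<in> carrier_vec d" using w by (simp add: l1_normalize_def)
  have nj: "l1_normalize w $ j = w $ j / l" if "j < d" for j
    using that w by (simp add: l1_normalize_def lw)
  have n1: "l1_norm (l1_normalize w) = 1"
  proof -
    have "l1_norm (l1_normalize w) = (\<Sum>j<d. \<bar>w $ j\<bar> / l)"
      using nw nj l by (simp add: l1_norm_def)
    also have "\<dots> = 1" using l by (simp add: sum_divide_distrib[symmetric] l_def[symmetric])
    finally show ?thesis .
  qed
  have E: "l1_norm (l1_normalize w - a) = (\<Sum>j<d. \<bar>w $ j / l - a $ j\<bar>)"
    using nw nj a by (simp add: l1_norm_def)
  have "(\<Sum>j<d. \<bar>w $ j / l - a $ j\<bar>) \<le> 2 * \<Delta> / l"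
    unfolding \<Delta>_def by (rule l1_normalize_error[OF a1 g0 l_def l])
  then have E1: "l1_norm (l1_normalize w - a) \<le> 2 * \<Delta> / l" unfolding E .
  have E2: "l1_norm (l1_normalize w - a) \<le> 2"
  proof -
    have "l1_norm (l1_normalize w - a) \<le> (\<Sum>j<d. \<bar>w $ j / l\<bar> + \<bar>a $ j\<bar>)"
      unfolding E by (intro sum_mono abs_triangle_ineq4)
    also have "\<dots> = l1_norm (l1_normalize w) + 1"
      using nw nj a1 by (simp add: l1_norm_def sum.distrib)
    finally show ?thesis using n1 by simp
  qed
  have M0: "M > 0" using cm by (simp add: M_def)
  have "l1_norm (l1_normalize w - a) \<le> 4 * M * ((g' 0 * ?\<sigma> + h) / (g' 0 * (1 - ?\<sigma>) - c1 * h))"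
    by (rule relative_error_bound[OF g0 sig0 h(1) c1 M0 DM den l lD E2 E1])
  with nw n1 show "l1_normalize w \<in> carrier_vec d \<and> l1_norm (l1_normalize w) = 1 \<and>
      l1_norm (l1_normalize w - a) \<le> 4 * (4 + 5 * c1 / mesh) *
        ((g' 0 * ?\<sigma> + h) / (g' 0 * (1 - ?\<sigma>) - c1 * h))"
    unfolding M_def by blast
qed

text \<open>Here \<open>ln 6 \<ge> 7/4\<close>, as \<open>exp 7 \<le> (11/4)\<^sup>7 \<le> 6\<^sup>4\<close>.\<close>

lemma ln_6_squared_ge_3: "3 \<le> (ln 6 :: real)\<^sup>2"
proof -
  have "exp (7 / 4 :: real) ^ 4 = exp 1 ^ 7" by (simp add: exp_of_nat_mult[symmetric])
  also have "\<dots> \<le> (11 / 4) ^ 7" using exp_one_bounds by (intro power_mono) auto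
  also have "\<dots> \<le> 6 ^ 4" by (simp add: power_numeral_reduce)
  finally have "exp (7 / 4 :: real) \<le> 6" by (rule power_le_imp_le_base[of _ 3, simplified]) auto
  then have "ln (exp (7 / 4)) \<le> ln (6 :: real)" by (subst ln_le_cancel_iff) auto
  then have "(7 / 4)\<^sup>2 \<le> (ln 6 :: real)\<^sup>2" by (intro power_mono) auto
  then show ?thesis by (simp add: power2_eq_square)
qed

text \<open>The value \<open>2 / 10\<^sup>3\<^sup>1\<close> in the condition on \<open>s\<close> forces \<open>m \<ge> 10\<^sup>3\<^sup>1\<close>, which the
  estimate for spread vectors needs for the constant \<open>mesh\<close>.\<close>

lemma recovery_probability:
  fixes g g' :: "real \<Rightarrow> real"
  assumes m: "0 < m" and d: "0 < d" "(ln 6)\<^sup>2 * real m \<le> real d" and h: "0 < h" "h \<le> sqrt (real m)"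
    and a: "a \<in> carrier_vec d" "l1_norm a = 1"
    and der: "\<forall>t\<in>{-1..1}. (g has_real_derivative g' t) (at t within {-1..1})"
    and lip0: "\<forall>t1\<in>{-1..1}. \<forall>t2\<in>{-1..1}. \<bar>g t1 - g t2\<bar> \<le> c0 * \<bar>t1 - t2\<bar>"
    and lip: "\<forall>t1\<in>{-1..1}. \<forall>t2\<in>{-1..1}. \<bar>g' t1 - g' t2\<bar> \<le> c1 * \<bar>t1 - t2\<bar>"
    and c: "c0 > 0" "c1 > 0" and g0: "g' 0 > 0"
    and s: "0 < s" "2 * real s \<le> 2 / 10 ^ 31 * real m / ln (real d / real m)"
    and den: "g' 0 * (1 - best_approx_error s a) - c1 * h > 0"
  shows "1 - exp (- (1 / 96) * real m) \<le> measure_pmf.prob (bernoulli_matrix m d)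
    {\<Phi>. let b = measurements (ridge g a) h \<Phi> in
       (\<exists>w. feasible \<Phi> b w) \<and>
       (\<forall>atilde. l1_solution \<Phi> b atilde \<longrightarrow> atilde \<noteq> 0\<^sub>v d \<longrightarrow>
         (let ahat = l1_normalize atilde in
            sup_norm_cube d (\<lambda>x. ridge g a x - reconstruction (ridge g a) ahat x) \<le> 2 * c0 * l1_norm (ahat - a) \<and>
            2 * c0 * l1_norm (ahat - a) \<le>
              2 * c0 * (4 * (4 + 5 * c1 / mesh)) * ((g' 0 * best_approx_error s a + h) /
                (g' 0 * (1 - best_approx_error s a) - c1 * h))))}"
    (is "_ \<le> measure_pmf.prob _ ?E")
proof -
  let ?T = "{..<m} \<times> {..<d}" and ?P = "Pi_pmf ({..<m} \<times> {..<d}) 0 (\<lambda>_. pmf_of_set {1, -1::real})"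
  let ?good = "\<lambda>\<epsilon>. \<epsilon> \<in> signs ?T \<and> kernel_spread m d \<epsilon> \<and> transpose_bounded_below m d \<epsilon>"
  have d3: "3 * real m \<le> real d"
    using d(2) mult_right_mono[OF ln_6_squared_ge_3, of "real m"] by linarith
  define L where "L = ln (real d / real m)"
  have L: "1 \<le> L" unfolding L_def by (rule ln_ratio_ge_one[OF m d3])
  have sL: "2 * (real s * L) \<le> 2 / 10 ^ 31 * real m"
    using s(2) L unfolding L_def[symmetric] by (simp add: pos_le_divide_eq mult.assoc)
  have "1 * 1 \<le> real s * L" using s(1) L by (intro mult_mono) auto
  with sL have big: "10 ^ 31 \<le> real m" by simp
  have "16 * real s * (144000 * L) \<le> real m" using sL by simp
  then have s16: "16 * real s \<le> real m / (144000 * ln (real d / real m))"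
    using L unfolding L_def[symmetric] by (simp add: pos_le_divide_eq)
  have good: "scaled_matrix m d \<epsilon> \<in> ?E" if "?good \<epsilon>" for \<epsilon>
  proof -
    let ?b = "measurements (ridge g a) h (scaled_matrix m d \<epsilon>)"
    have eps: "\<epsilon> \<in> signs ?T" "kernel_spread m d \<epsilon>" "transpose_bounded_below m d \<epsilon>" using that by auto
    note R = recovery_on_good_matrix[OF m d(1) h a der lip c(2) g0 s16 den eps refl]
    have "sup_norm_cube d (\<lambda>x. ridge g a x - reconstruction (ridge g a) (l1_normalize w) x) \<le> 2 * c0 * l1_norm (l1_normalize w - a) \<and>
            2 * c0 * l1_norm (l1_normalize w - a) \<le>
              2 * c0 * (4 * (4 + 5 * c1 / mesh)) * ((g' 0 * best_approx_error s a + h) /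
                (g' 0 * (1 - best_approx_error s a) - c1 * h))"
      if w: "l1_solution (scaled_matrix m d \<epsilon>) ?b w" "w \<noteq> 0\<^sub>v d" for w
    proof
      have n: "l1_normalize w \<in> carrier_vec d" "l1_norm (l1_normalize w) = 1"
        and e: "l1_norm (l1_normalize w - a) \<le> 4 * (4 + 5 * c1 / mesh) *
          ((g' 0 * best_approx_error s a + h) / (g' 0 * (1 - best_approx_error s a) - c1 * h))"
        using R(2)[OF w] by auto
      show "sup_norm_cube d (\<lambda>x. ridge g a x - reconstruction (ridge g a) (l1_normalize w) x) \<le> 2 * c0 * l1_norm (l1_normalize w - a)"
        by (rule sup_norm_reconstruction_le[OF a n lip0]) (use c in auto)
      have "2 * c0 * l1_norm (l1_normalize w - a) \<le> 2 * c0 * (4 * (4 + 5 * c1 / mesh) *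
          ((g' 0 * best_approx_error s a + h) / (g' 0 * (1 - best_approx_error s a) - c1 * h)))"
        using e c by (intro mult_left_mono) auto
      then show "2 * c0 * l1_norm (l1_normalize w - a) \<le>
              2 * c0 * (4 * (4 + 5 * c1 / mesh)) * ((g' 0 * best_approx_error s a + h) /
                (g' 0 * (1 - best_approx_error s a) - c1 * h))"
        by (simp only: mult.assoc)
    qed
    with R(1) show ?thesis by (simp add: Let_def)
  qed
  have "1 - exp (- (1 / 96) * real m) \<le> 1 - sign_prob ?T (\<lambda>\<epsilon>. \<not> (kernel_spread m d \<epsilon> \<and> transpose_bounded_below m d \<epsilon>))"
    using sign_prob_bad_matrix[OF big d3] by simp
  also have "\<dots> \<le> 1 - sign_prob ?T (\<lambda>\<epsilon>. \<not> ?good \<epsilon>)"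
    using sign_prob_mono[of ?T "\<lambda>\<epsilon>. \<not> ?good \<epsilon>" "\<lambda>\<epsilon>. \<not> (kernel_spread m d \<epsilon> \<and> transpose_bounded_below m d \<epsilon>)"] by auto
  also have "\<dots> = measure_pmf.prob ?P {\<epsilon>. ?good \<epsilon>}"
    by (rule prob_signs_compl[symmetric]) auto
  also have "\<dots> \<le> measure_pmf.prob ?P (scaled_matrix m d -` ?E)"
    using good by (intro measure_pmf.finite_measure_mono) auto
  also have "\<dots> = measure_pmf.prob (bernoulli_matrix m d) ?E"
    by (simp only: bernoulli_matrix_eq[OF m] measure_map_pmf)
  finally show ?thesis .
qed

theorem theorem3p5:
  "\<exists>C1>0. \<exists>C2>0. \<forall>c0>0. \<forall>c1>0. \<exists>C0'>0.
     \<forall>(d::nat) (m::nat) (h::real) (a::real vec) (g::real \<Rightarrow> real) (g'::real \<Rightarrow> real) (s::nat).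
       0 < d \<longrightarrow> 0 < m \<longrightarrow> real d \<ge> (ln 6)\<^sup>2 * real m \<longrightarrow>
       0 < h \<longrightarrow> h \<le> sqrt (real m) \<longrightarrow>
       a \<in> carrier_vec d \<longrightarrow> l1_norm a = 1 \<longrightarrow>
       (\<forall>t\<in>{-1..1}. (g has_real_derivative g' t) (at t within {-1..1})) \<longrightarrow>
       (\<forall>t1\<in>{-1..1}. \<forall>t2\<in>{-1..1}. \<bar>g t1 - g t2\<bar> \<le> c0 * \<bar>t1 - t2\<bar>) \<longrightarrow>
       (\<forall>t1\<in>{-1..1}. \<forall>t2\<in>{-1..1}. \<bar>g' t1 - g' t2\<bar> \<le> c1 * \<bar>t1 - t2\<bar>) \<longrightarrow>
       g' 0 > 0 \<longrightarrow>
       0 < s \<longrightarrow> 2 * real s \<le> (C2 * real m) / ln (real d / real m) \<longrightarrow>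
       g' 0 * (1 - best_approx_error s a) - c1 * h > 0 \<longrightarrow>
       (let f = ridge g a in
        measure_pmf.prob (bernoulli_matrix m d)
          {\<Phi>. let b = measurements f h \<Phi> in
              (\<exists>w. feasible \<Phi> b w) \<and>
              (\<forall>atilde. l1_solution \<Phi> b atilde \<longrightarrow> atilde \<noteq> 0\<^sub>v d \<longrightarrow>
                (let ahat = l1_normalize atilde in
                   sup_norm_cube d (\<lambda>x. f x - reconstruction f ahat x) \<le> 2 * c0 * l1_norm (ahat - a) \<and>
                   2 * c0 * l1_norm (ahat - a) \<le>
                     2 * c0 * C0' * ((g' 0 * best_approx_error s a + h) /
                       (g' 0 * (1 - best_approx_error s a) - c1 * h))))}
          \<ge> 1 - exp (- sqrt (real m * real d)) - exp (- C1 * real m))"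
proof (rule exI[of _ "1 / 96"], intro conjI, goal_cases)
  case 1
  show ?case by simp
next
  case 2
  show ?case
  proof (rule exI[of _ "2 / 10 ^ 31"], intro conjI allI impI, goal_cases)
    case 1
    show ?case by simp
  next
    case (2 c0 c1)
    show ?case
    proof (rule exI[of _ "4 * (4 + 5 * c1 / mesh)"], intro conjI allI impI, goal_cases)
      case 1
      show ?case using 2 mesh_pos by (simp add: add_pos_nonneg)
    next
      case hyps: (2 d m h a g g' s)
      have "1 - exp (- sqrt (real m * real d)) - exp (- (1 / 96) * real m) \<le> 1 - exp (- (1 / 96) * real m)"
        by simp
      then show ?case
        unfolding Let_def[of "ridge g a"]
        by (rule order_trans) (rule recovery_probability, use 2 hyps in auto)
    qed
  qed
qed

end
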